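(* Let $G$ be a finite-dimensional connected and simply connected Poisson-Lie group with Lie bialgebra $\mathfrak g$. Assume that $(\mathfrak g^*,[\ ,\ ]_{\mathfrak g^*})$ admits a pre-Lie structure $\circ$ and also that $\mathfrak g^*$ admits a (not necessarily unital) Poisson algebra structure $(\mathfrak g^*,\ast,[\ ,\ ]_{\mathfrak g^*})$, i.e. a commutative associative product $\ast$ with $$[f,\phi\ast\psi]_{\mathfrak g^*}=[f,\phi]_{\mathfrak g^*}\ast\psi+\phi\ast[f,\psi]_{\mathfrak g^*},\quad\forall f,\phi,\psi\in\mathfrak g^*.$$ Then the semidirect sum Lie algebra $\underline{\mathfrak g^*}\rtimes\mathfrak g^*$ admits a pre-Lie algebra product $$(\phi,f)\,\tilde\circ\,(\psi,h)=(\phi\ast\psi+[f,\psi]_{\mathfrak g^*},\,f\circ h),$$ and the tangent bundle of $G$, with its Poisson-Lie group structure $\overline G\bowtie\underline{\mathfrak g}$ described in the context, admits a Poisson-compatible left-covariant flat preconnection.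
   Context: A Poisson-Lie group $G$ is a Lie group with a Poisson bracket $\{\ ,\ \}$ on $C^\infty(G)$ such that multiplication is a Poisson map. Let $P$ be its Poisson bivector, $\{f,h\}=P(df,dh)$, $D^\vee(g)=(L_{g^{-1}})_*P(g)\in\mathfrak g\otimes\mathfrak g$. Its Lie algebra $\mathfrak g$ is a Lie bialgebra with cobracket $\delta_{\mathfrak g}(x)=\frac{d}{dt}|_0D^\vee(\exp tx)=x_{(1)}\otimes x_{(2)}$, and $\langle[\phi,\psi]_{\mathfrak g^*},x\rangle=\langle\phi\otimes\psi,\delta_{\mathfrak g}(x)\rangle$. Tangent bundle: $TG=G\ltimes\underline{\mathfrak g}$ with product $(g_1,x)(g_2,y)=(g_1g_2,\mathrm{Ad}(g_2^{-1})(x)+y)$, where $\underline{\mathfrak g}$ is $\mathfrak g$ as an abelian group. It carries the known Poisson-Lie structure (denoted here $\overline G\bowtie\underline{\mathfrak g}$, a right-left bicross sum) with Poisson bracket $$\{f,h\}=0,\quad\{\phi,\psi\}=[\phi,\psi]_{\mathfrak g^*},\quad\{\phi,f\}=\widetilde\phi f$$ for $f,h\in C^\infty(G)$ and $\phi,\psi\in\mathfrak g^*\subset C^\infty(\underline{\mathfrak g})$, where $\widetilde\phi$ is the vector field $\widetilde\phi_g=(L_g)_*((\phi\otimes\mathrm{id})D^\vee(g))$ on $G$. Its Lie bialgebra is $\overline{\mathfrak g}\oplus\underline{\mathfrak g}$ (two copies of $\mathfrak g$) with, for $\xi,\eta\in\overline{\mathfrak g}$, $x,y\in\underline{\mathfrak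 g}$: $[\xi,\eta]=[\xi,\eta]_{\mathfrak g}$, $[x,y]=0$, $[x,\xi]=[x,\xi]_{\mathfrak g}\in\underline{\mathfrak g}$; $\delta\xi=\underline{\xi_{(1)}}\otimes\overline{\xi_{(2)}}-\overline{\xi_{(2)}}\otimes\underline{\xi_{(1)}}$, $\delta x=\delta_{\mathfrak g}x\in\underline{\mathfrak g}\otimes\underline{\mathfrak g}$. The dual Lie algebra is the semidirect sum $\underline{\mathfrak g^*}\rtimes\mathfrak g^*$, i.e. $\underline{\mathfrak g^*}\oplus\mathfrak g^*$ (first summand dual to $\overline{\mathfrak g}$, second dual to $\underline{\mathfrak g}$) with $[\phi,\psi]=0$, $[f,\phi]=[f,\phi]_{\mathfrak g^*}\in\underline{\mathfrak g^*}$, $[f,h]=[f,h]_{\mathfrak g^*}$ for $\phi,\psi\in\underline{\mathfrak g^*}$, $f,h\in\mathfrak g^*$. A pre-Lie structure on a Lie algebra $L$ is a bilinear product $\circ$ with $(x\circ y)\circ z-(y\circ x)\circ z=x\circ(y\circ z)-y\circ(x\circ z)$ and $x\circ y-y\circ x=[x,y]$. A preconnection on a Poisson-Lie group $K$ is a bilinear map $\gamma:C^\infty(K)\otimes\Omega^1(K)\to\Omega^1(K)$ with $\gamma(ab,\tau)=\gamma(a,\tau)b+a\gamma(b,\tau)$ and $\gamma(a,b\tau)=b\gamma(a,\tau)+\{a,b\}\tau$. It is Poisson-compatible if $d\{a,b\}=\gamma(a,db)-\gamma(b,da)$, and flat if $\gamma(a,\gamma(b,\tau))-\gamma(b,\gamma(a,\tau))=\gamma(\{a,b\},\tau)$.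 It is left-covariant (the associated first-order differential calculus is left-covariant to lowest deformation order) exactly when there is a linear map $\Xi:\mathfrak k^*\otimes\mathfrak k^*\to\mathfrak k^*$ ($\mathfrak k$ the Lie algebra of $K$) such that $\gamma(a,\sum_k\tau_k\omega^k)=\sum_k(\{a,\tau_k\}+\sum_{i,j}\Xi^{ij}_k(\partial_ia)\tau_j)\omega^k$, where $\{e_i\}$ is a basis of $\mathfrak k$ with dual basis $\{f^i\}$, $\Xi(f^i,f^j)=\sum_k\Xi^{ij}_kf^k$, $\{\partial_i\}$ are the left-invariant vector fields generated by $\{e_i\}$ and $\{\omega^i\}$ the dual left-invariant 1-forms; this is taken as the definition here. *)

theory Defs
  imports "HOL-Analysis.Analysis"
begin

section \<open>Smooth manifolds\<close>

text \<open>For open \<open>S\<close> in a finite-dimensional space this is the usual notion of a \<open>C\<^sup>k\<close> map: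
  all iterated directional derivatives up to order \<open>k\<close> exist and are continuous.\<close>

primrec Ck_on :: "nat \<Rightarrow> 'a::real_normed_vector set \<Rightarrow> ('a \<Rightarrow> 'b::real_normed_vector) \<Rightarrow> bool" where
  "Ck_on 0 S f \<longleftrightarrow> continuous_on S f"
| "Ck_on (Suc k) S f \<longleftrightarrow>
     (\<forall>x\<in>S. f differentiable (at x)) \<and> (\<forall>v. Ck_on k S (\<lambda>x. frechet_derivative f (at x) v))"

definition smooth_on :: "'a::real_normed_vector set \<Rightarrow> ('a \<Rightarrow> 'b::real_normed_vector) \<Rightarrow> bool" where
  "smooth_on S f \<longleftrightarrow> (\<forall>k. Ck_on k S f)"

text \<open>A chart is a domain with a coordinate map; values of the map outside the domain are irrelevant.\<close>

type_synonym ('m, 'e) chart = "'m set \<times> ('m \<Rightarrow> 'e)"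

definition dom :: "('m, 'e) chart \<Rightarrow> 'm set" where
  "dom c = fst c"

definition crd :: "('m, 'e) chart \<Rightarrow> 'm \<Rightarrow> 'e" where
  "crd c = snd c"

definition img :: "('m, 'e) chart \<Rightarrow> 'e set" where
  "img c = crd c ` dom c"

definition inv_crd :: "('m, 'e) chart \<Rightarrow> 'e \<Rightarrow> 'm" where
  "inv_crd c = inv_into (dom c) (crd c)"

definition is_chart :: "('m::topological_space, 'e::euclidean_space) chart \<Rightarrow> bool" where
  "is_chart c \<longleftrightarrow> open (dom c) \<and> open (img c) \<and> homeomorphism (dom c) (img c) (crd c) (inv_crd c)"

definition smooth_atlas :: "('m::topological_space, 'e::euclidean_space) chart set \<Rightarrow> bool" where
  "smooth_atlas A \<longleftrightarrow>
     (\<forall>c\<in>A. is_chart c) \<and> (\<Union>c\<in>A. dom c) = UNIV \<and>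
     (\<forall>c\<in>A. \<forall>c'\<in>A. smooth_on (crd c ` (dom c \<inter> dom c')) (crd c' \<circ> inv_crd c))"

definition smooth_map ::
  "('m::topological_space, 'e::euclidean_space) chart set \<Rightarrow>
   ('n::topological_space, 'f::euclidean_space) chart set \<Rightarrow> ('m \<Rightarrow> 'n) \<Rightarrow> bool" where
  "smooth_map A B F \<longleftrightarrow> continuous_on UNIV F \<and>
     (\<forall>c\<in>A. \<forall>c'\<in>B. smooth_on (crd c ` (dom c \<inter> F -` dom c')) (crd c' \<circ> F \<circ> inv_crd c))"

definition prod_chart :: "('m, 'e) chart \<Rightarrow> ('n, 'f) chart \<Rightarrow> ('m \<times> 'n, 'e \<times> 'f) chart" where
  "prod_chart c c' = (dom c \<times> dom c', map_prod (crd c) (crd c'))"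

definition prod_atlas ::
  "('m, 'e) chart set \<Rightarrow> ('n, 'f) chart set \<Rightarrow> ('m \<times> 'n, 'e \<times> 'f) chart set" where
  "prod_atlas A B = (\<lambda>(c, c'). prod_chart c c') ` (A \<times> B)"

definition id_chart :: "('e, 'e) chart" where
  "id_chart = (UNIV, id)"

section \<open>Lie groups\<close>

text \<open>The underlying manifold is the whole type \<open>'g\<close>, of dimension \<open>DIM('e)\<close>.
  The field \<open>base_chart\<close> is a chart around the unit through which the Lie algebra
  (the tangent space at the unit) is identified with \<open>'e\<close>.
  The choice of this chart is arbitrary; it is part of the data only to fix the identification.\<close>

record ('g, 'e) lie_group_data =
  atlas :: "('g, 'e) chart set"
  mult :: "'g \<Rightarrow> 'g \<Rightarrow> 'g"
  one :: 'g
  ginv :: "'g \<Rightarrow> 'g"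
  base_chart :: "('g, 'e) chart"

definition lie_group ::
  "('g::{t2_space,second_countable_topology}, 'e::euclidean_space) lie_group_data \<Rightarrow> bool" where
  "lie_group K \<longleftrightarrow>
     smooth_atlas (atlas K) \<and> base_chart K \<in> atlas K \<and> one K \<in> dom (base_chart K) \<and>
     (\<forall>a b c. mult K (mult K a b) c = mult K a (mult K b c)) \<and>
     (\<forall>a. mult K (one K) a = a \<and> mult K a (one K) = a) \<and>
     (\<forall>a. mult K (ginv K a) a = one K \<and> mult K a (ginv K a) = one K) \<and>
     smooth_map (prod_atlas (atlas K) (atlas K)) (atlas K) (\<lambda>(a, b). mult K a b) \<and>
     smooth_map (atlas K) (atlas K) (ginv K)"

definition Cinf :: "('g::topological_space, 'e::euclidean_space) lie_group_data \<Rightarrow> ('g \<Rightarrow> real) set" where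
  "Cinf K = {f. smooth_map (atlas K) {id_chart} f}"

text \<open>The inverse of the base chart, recentred so that \<open>0\<close> is sent to the unit;
  \<open>t \<mapsto> near_one K (t *\<^sub>R x)\<close> is a curve through the unit with velocity \<open>x\<close>.\<close>

definition near_one :: "('g, 'e::real_vector) lie_group_data \<Rightarrow> 'e \<Rightarrow> 'g" where
  "near_one K v = inv_crd (base_chart K) (crd (base_chart K) (one K) + v)"

text \<open>The covector \<open>L\<^sub>g\<^sup>*(df\<^sub>g)\<close> in the dual of the Lie algebra. Its value at \<open>x\<close> is the value at
  \<open>g\<close> of the derivative of \<open>f\<close> along the left-invariant vector field generated by \<open>x\<close>.\<close>

definition left_diff ::
  "('g, 'e::euclidean_space) lie_group_data \<Rightarrow> ('g \<Rightarrow> real) \<Rightarrow> 'g \<Rightarrow> 'e \<Rightarrow>\<^sub>L real" where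
  "left_diff K f g = Blinfun (frechet_derivative (\<lambda>v. f (mult K g (near_one K v))) (at 0))"

definition left_field ::
  "('g, 'e::euclidean_space) lie_group_data \<Rightarrow> 'e \<Rightarrow> ('g \<Rightarrow> real) \<Rightarrow> 'g \<Rightarrow> real" where
  "left_field K x f g = blinfun_apply (left_diff K f g) x"

definition Ad :: "('g, 'e::euclidean_space) lie_group_data \<Rightarrow> 'g \<Rightarrow> 'e \<Rightarrow> 'e" where
  "Ad K g = frechet_derivative
     (\<lambda>v. crd (base_chart K) (mult K (mult K g (near_one K v)) (ginv K g))) (at 0)"

section \<open>Differential forms of degree one\<close>

text \<open>A 1-form is given by its local representatives in all charts of the atlas; the
  representatives are related by the chain rule and vanish outside the chart domains, so that
  equality of 1-forms is equality of functions.\<close>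

type_synonym ('g, 'e) form = "('g, 'e) chart \<Rightarrow> 'g \<Rightarrow> 'e \<Rightarrow>\<^sub>L real"

definition Omega1 :: "('g::topological_space, 'e::euclidean_space) lie_group_data \<Rightarrow> ('g, 'e) form set" where
  "Omega1 K = {\<tau>.
     (\<forall>c g. c \<notin> atlas K \<or> g \<notin> dom c \<longrightarrow> \<tau> c g = 0) \<and>
     (\<forall>c\<in>atlas K. \<forall>c'\<in>atlas K. \<forall>g\<in>dom c \<inter> dom c'. \<forall>v.
        blinfun_apply (\<tau> c g) v =
        blinfun_apply (\<tau> c' g) (frechet_derivative (crd c' \<circ> inv_crd c) (at (crd c g)) v)) \<and>
     (\<forall>c\<in>atlas K. \<forall>v. smooth_on (img c) (\<lambda>u. blinfun_apply (\<tau> c (inv_crd c u)) v))}"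

definition form_add :: "('g, 'e::real_normed_vector) form \<Rightarrow> ('g, 'e) form \<Rightarrow> ('g, 'e) form" where
  "form_add \<tau> \<sigma> = (\<lambda>c g. \<tau> c g + \<sigma> c g)"

definition form_diff :: "('g, 'e::real_normed_vector) form \<Rightarrow> ('g, 'e) form \<Rightarrow> ('g, 'e) form" where
  "form_diff \<tau> \<sigma> = (\<lambda>c g. \<tau> c g - \<sigma> c g)"

definition form_mult :: "('g \<Rightarrow> real) \<Rightarrow> ('g, 'e::real_normed_vector) form \<Rightarrow> ('g, 'e) form" where
  "form_mult a \<tau> = (\<lambda>c g. a g *\<^sub>R \<tau> c g)"

definition form_sum :: "('i \<Rightarrow> ('g, 'e::real_normed_vector) form) \<Rightarrow> 'i set \<Rightarrow> ('g, 'e) form" where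
  "form_sum \<tau> I = (\<lambda>c g. \<Sum>i\<in>I. \<tau> i c g)"

definition ext_d ::
  "('g, 'e::euclidean_space) lie_group_data \<Rightarrow> ('g \<Rightarrow> real) \<Rightarrow> ('g, 'e) form" where
  "ext_d K f = (\<lambda>c g. if c \<in> atlas K \<and> g \<in> dom c
     then Blinfun (frechet_derivative (f \<circ> inv_crd c) (at (crd c g))) else 0)"

text \<open>The left-invariant 1-form with value \<open>\<phi>\<close> at the unit: at \<open>g\<close> it is the pullback of
  \<open>\<phi>\<close> along \<open>L\<^bsub>g\<inverse>\<^esub>\<close>.\<close>

definition left_form ::
  "('g, 'e::euclidean_space) lie_group_data \<Rightarrow> ('e \<Rightarrow>\<^sub>L real) \<Rightarrow> ('g, 'e) form" where
  "left_form K \<phi> = (\<lambda>c g. if c \<in> atlas K \<and> g \<in> dom c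
     then Blinfun (\<lambda>v. blinfun_apply \<phi> (frechet_derivative
       (\<lambda>u. crd (base_chart K) (mult K (ginv K g) (inv_crd c u))) (at (crd c g)) v))
     else 0)"

section \<open>Poisson-Lie groups\<close>

type_synonym 'g bracket = "('g \<Rightarrow> real) \<Rightarrow> ('g \<Rightarrow> real) \<Rightarrow> 'g \<Rightarrow> real"

definition poisson_bracket ::
  "('g::topological_space, 'e::euclidean_space) lie_group_data \<Rightarrow> 'g bracket \<Rightarrow> bool" where
  "poisson_bracket K br \<longleftrightarrow>
     (\<forall>f\<in>Cinf K. \<forall>h\<in>Cinf K. br f h \<in> Cinf K) \<and>
     (\<forall>f\<in>Cinf K. \<forall>h\<in>Cinf K. \<forall>k\<in>Cinf K. \<forall>r.
        br (\<lambda>g. r * f g + h g) k = (\<lambda>g. r * br f k g + br h k g)) \<and>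
     (\<forall>f\<in>Cinf K. \<forall>h\<in>Cinf K. br f h = (\<lambda>g. - br h f g)) \<and>
     (\<forall>f\<in>Cinf K. \<forall>h\<in>Cinf K. \<forall>k\<in>Cinf K.
        br f (\<lambda>g. h g * k g) = (\<lambda>g. br f h g * k g + h g * br f k g)) \<and>
     (\<forall>f\<in>Cinf K. \<forall>h\<in>Cinf K. \<forall>k\<in>Cinf K. \<forall>g.
        br f (br h k) g + br h (br k f) g + br k (br f h) g = 0)"

definition prod_bracket :: "'g bracket \<Rightarrow> 'h bracket \<Rightarrow> ('g \<times> 'h) bracket" where
  "prod_bracket br br' F H = (\<lambda>(a, b).
     br (\<lambda>a'. F (a', b)) (\<lambda>a'. H (a', b)) a + br' (\<lambda>b'. F (a, b')) (\<lambda>b'. H (a, b')) b)"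

text \<open>The last clause says that multiplication is a Poisson map.\<close>

definition poisson_lie_group ::
  "('g::{t2_space,second_countable_topology}, 'e::euclidean_space) lie_group_data \<Rightarrow> 'g bracket \<Rightarrow> bool" where
  "poisson_lie_group K br \<longleftrightarrow> lie_group K \<and> poisson_bracket K br \<and>
     (let m = (\<lambda>(a, b). mult K a b)
      in \<forall>f\<in>Cinf K. \<forall>h\<in>Cinf K. br f h \<circ> m = prod_bracket br br (f \<circ> m) (h \<circ> m))"

text \<open>Elements of the tensor square of the (finite-dimensional) Lie algebra are represented as
  bilinear forms on its dual. The predicate says that \<open>D\<close> is
  \<open>D\<^sup>\<or>(g) = (L\<^bsub>g\<inverse>\<^esub>)\<^sub>* P(g)\<close> for the Poisson bivector field \<open>P\<close> of the bracket: the identity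
  \<open>{f, h} = P(df, dh)\<close> is moved to the unit by left translation.\<close>

type_synonym 'e tensor2 = "('e \<Rightarrow>\<^sub>L real) \<Rightarrow> ('e \<Rightarrow>\<^sub>L real) \<Rightarrow> real"

definition left_bivector ::
  "('g::topological_space, 'e::euclidean_space) lie_group_data \<Rightarrow> 'g bracket \<Rightarrow> ('g \<Rightarrow> 'e tensor2) \<Rightarrow> bool" where
  "left_bivector K br D \<longleftrightarrow>
     (\<forall>g. bilinear (D g)) \<and> (\<forall>g \<phi> \<psi>. D g \<phi> \<psi> = - D g \<psi> \<phi>) \<and>
     (\<forall>\<phi> \<psi>. (\<lambda>g. D g \<phi> \<psi>) \<in> Cinf K) \<and>
     (\<forall>f\<in>Cinf K. \<forall>h\<in>Cinf K. \<forall>g. br f h g = D g (left_diff K f g) (left_diff K h g))"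

text \<open>\<open>\<delta>(x)\<close> is the velocity at the unit of \<open>D\<^sup>\<or>\<close> along any curve with velocity \<open>x\<close>,
  in particular along \<open>t \<mapsto> exp (t x)\<close>.\<close>

definition cobracket ::
  "('g, 'e::euclidean_space) lie_group_data \<Rightarrow> ('g \<Rightarrow> 'e tensor2) \<Rightarrow> 'e \<Rightarrow> 'e tensor2" where
  "cobracket K D x \<phi> \<psi> = left_field K x (\<lambda>g. D g \<phi> \<psi>) (one K)"

definition dual_bracket ::
  "('g, 'e::euclidean_space) lie_group_data \<Rightarrow> ('g \<Rightarrow> 'e tensor2) \<Rightarrow>
   ('e \<Rightarrow>\<^sub>L real) \<Rightarrow> ('e \<Rightarrow>\<^sub>L real) \<Rightarrow> ('e \<Rightarrow>\<^sub>L real)" where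
  "dual_bracket K D \<phi> \<psi> = Blinfun (\<lambda>x. cobracket K D x \<phi> \<psi>)"

text \<open>The vector \<open>(\<phi> \<otimes> id) T\<close>.\<close>

definition contract_left :: "('e::euclidean_space \<Rightarrow>\<^sub>L real) \<Rightarrow> 'e tensor2 \<Rightarrow> 'e" where
  "contract_left \<phi> T = (\<Sum>b\<in>Basis. T \<phi> (blinfun_inner_left b) *\<^sub>R b)"

text \<open>The vector field written \<open>\<phi>\<close> with a tilde.\<close>

definition dressing ::
  "('g, 'e::euclidean_space) lie_group_data \<Rightarrow> ('g \<Rightarrow> 'e tensor2) \<Rightarrow> ('e \<Rightarrow>\<^sub>L real) \<Rightarrow> ('g \<Rightarrow> real) \<Rightarrow> 'g \<Rightarrow> real" where
  "dressing K D \<phi> f g = left_field K (contract_left \<phi> (D g)) f g"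

section \<open>The tangent bundle\<close>

definition tangent_group ::
  "('g, 'e::euclidean_space) lie_group_data \<Rightarrow> ('g \<times> 'e, 'e \<times> 'e) lie_group_data" where
  "tangent_group K = \<lparr>
     atlas = prod_atlas (atlas K) {id_chart},
     mult = (\<lambda>(a, x) (b, y). (mult K a b, Ad K (ginv K b) x + y)),
     one = (one K, 0),
     ginv = (\<lambda>(a, x). (ginv K a, - Ad K a x)),
     base_chart = prod_chart (base_chart K) id_chart \<rparr>"

definition fibre_diff :: "('g \<times> 'e::euclidean_space \<Rightarrow> real) \<Rightarrow> 'g \<Rightarrow> 'e \<Rightarrow> 'e \<Rightarrow>\<^sub>L real" where
  "fibre_diff a g x = Blinfun (frechet_derivative (\<lambda>y. a (g, y)) (at x))"

text \<open>The extension, as a biderivation, of the bracket given on functions on \<open>G\<close> and on linear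
  functions on the fibre; the values on these generators are verified below. A biderivation only
  depends on the differentials of its arguments, hence is determined by these values.\<close>

definition tangent_bracket ::
  "('g, 'e::euclidean_space) lie_group_data \<Rightarrow> ('g \<Rightarrow> 'e tensor2) \<Rightarrow> ('g \<times> 'e) bracket" where
  "tangent_bracket K D a b = (\<lambda>(g, x).
     blinfun_apply (dual_bracket K D (fibre_diff a g x) (fibre_diff b g x)) x
     + dressing K D (fibre_diff a g x) (\<lambda>g'. b (g', x)) g
     - dressing K D (fibre_diff b g x) (\<lambda>g'. a (g', x)) g)"

lemma fibre_diff_base [simp]: "fibre_diff (\<lambda>p. f (fst p)) g x = 0"
  by (simp add: fibre_diff_def zero_blinfun_def)

lemma fibre_diff_linear [simp]: "fibre_diff (\<lambda>p. blinfun_apply \<phi> (snd p)) g x = \<phi>"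
proof -
  have "(blinfun_apply \<phi> has_derivative blinfun_apply \<phi>) (at x)"
    by (simp add: bounded_linear_imp_has_derivative blinfun.bounded_linear_right)
  then have "frechet_derivative (blinfun_apply \<phi>) (at x) = blinfun_apply \<phi>"
    by (metis frechet_derivative_at)
  then show ?thesis
    by (simp add: fibre_diff_def blinfun_apply_inverse)
qed

lemma dressing_const [simp]: "dressing K D \<phi> (\<lambda>g. r) g = 0"
proof -
  have "left_diff K (\<lambda>g. r) g = 0"
    by (simp add: left_diff_def zero_blinfun_def)
  then show ?thesis
    by (simp add: dressing_def left_field_def)
qed

lemma tangent_bracket_generators:
  assumes "\<And>g. bilinear (D g)"
  shows "tangent_bracket K D (\<lambda>p. f (fst p)) (\<lambda>p. h (fst p)) = (\<lambda>p. 0)"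
    and "tangent_bracket K D (\<lambda>p. blinfun_apply \<phi> (snd p)) (\<lambda>p. blinfun_apply \<psi> (snd p)) =
           (\<lambda>p. blinfun_apply (dual_bracket K D \<phi> \<psi>) (snd p))"
    and "tangent_bracket K D (\<lambda>p. blinfun_apply \<phi> (snd p)) (\<lambda>p. f (fst p)) =
           (\<lambda>p. dressing K D \<phi> f (fst p))"
proof -
  have D0: "D g 0 \<zeta> = 0" "D g \<zeta> 0 = 0" for g \<zeta>
    using assms by (simp_all add: bilinear_lzero bilinear_rzero)
  have l0: "left_field K x (\<lambda>g. 0) g = 0" for x g
    by (simp add: left_field_def left_diff_def flip: zero_blinfun_def)
  have b0: "dual_bracket K D 0 \<zeta> = 0" "dual_bracket K D \<zeta> 0 = 0" for \<zeta>
    by (simp_all add: dual_bracket_def cobracket_def D0 l0 flip: zero_blinfun_def)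
  have d0: "dressing K D 0 k g = 0" for k g
    by (simp add: dressing_def contract_left_def D0 left_field_def)
  show "tangent_bracket K D (\<lambda>p. f (fst p)) (\<lambda>p. h (fst p)) = (\<lambda>p. 0)"
    and "tangent_bracket K D (\<lambda>p. blinfun_apply \<phi> (snd p)) (\<lambda>p. blinfun_apply \<psi> (snd p)) =
           (\<lambda>p. blinfun_apply (dual_bracket K D \<phi> \<psi>) (snd p))"
    and "tangent_bracket K D (\<lambda>p. blinfun_apply \<phi> (snd p)) (\<lambda>p. f (fst p)) =
           (\<lambda>p. dressing K D \<phi> f (fst p))"
    by (simp_all add: tangent_bracket_def fun_eq_iff b0 d0)
qed

section \<open>Algebraic structures\<close>

definition lie_bracket :: "('v::real_vector \<Rightarrow> 'v \<Rightarrow> 'v) \<Rightarrow> bool" where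
  "lie_bracket lb \<longleftrightarrow> bilinear lb \<and> (\<forall>x. lb x x = 0) \<and>
     (\<forall>x y z. lb x (lb y z) + lb y (lb z x) + lb z (lb x y) = 0)"

definition pre_lie_structure ::
  "('v::real_vector \<Rightarrow> 'v \<Rightarrow> 'v) \<Rightarrow> ('v \<Rightarrow> 'v \<Rightarrow> 'v) \<Rightarrow> bool" where
  "pre_lie_structure lb pl \<longleftrightarrow> lie_bracket lb \<and> bilinear pl \<and>
     (\<forall>x y z. pl (pl x y) z - pl (pl y x) z = pl x (pl y z) - pl y (pl x z)) \<and>
     (\<forall>x y. pl x y - pl y x = lb x y)"

definition poisson_algebra ::
  "('v::real_vector \<Rightarrow> 'v \<Rightarrow> 'v) \<Rightarrow> ('v \<Rightarrow> 'v \<Rightarrow> 'v) \<Rightarrow> bool" where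
  "poisson_algebra ast lb \<longleftrightarrow> lie_bracket lb \<and> bilinear ast \<and>
     (\<forall>x y. ast x y = ast y x) \<and> (\<forall>x y z. ast (ast x y) z = ast x (ast y z)) \<and>
     (\<forall>f x y. lb f (ast x y) = ast (lb f x) y + ast x (lb f y))"

text \<open>The semidirect sum of a Lie algebra (second summand) acting by the adjoint action on its
  underlying abelian Lie algebra (first summand).\<close>

definition semidirect_bracket ::
  "('v::real_vector \<Rightarrow> 'v \<Rightarrow> 'v) \<Rightarrow> 'v \<times> 'v \<Rightarrow> 'v \<times> 'v \<Rightarrow> 'v \<times> 'v" where
  "semidirect_bracket lb = (\<lambda>(\<phi>, f) (\<psi>, h). (lb f \<psi> - lb h \<phi>, lb f h))"

section \<open>Preconnections\<close>

type_synonym ('g, 'e) preconn = "('g \<Rightarrow> real) \<Rightarrow> ('g, 'e) form \<Rightarrow> ('g, 'e) form"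

definition preconnection ::
  "('g::topological_space, 'e::euclidean_space) lie_group_data \<Rightarrow> 'g bracket \<Rightarrow> ('g, 'e) preconn \<Rightarrow> bool" where
  "preconnection K br \<gamma> \<longleftrightarrow>
     (\<forall>a\<in>Cinf K. \<forall>\<tau>\<in>Omega1 K. \<gamma> a \<tau> \<in> Omega1 K) \<and>
     (\<forall>a\<in>Cinf K. \<forall>b\<in>Cinf K. \<forall>\<tau>\<in>Omega1 K. \<forall>r.
        \<gamma> (\<lambda>g. r * a g + b g) \<tau> = form_add (form_mult (\<lambda>_. r) (\<gamma> a \<tau>)) (\<gamma> b \<tau>)) \<and>
     (\<forall>a\<in>Cinf K. \<forall>\<tau>\<in>Omega1 K. \<forall>\<sigma>\<in>Omega1 K. \<forall>r.
        \<gamma> a (form_add (form_mult (\<lambda>_. r) \<tau>) \<sigma>) =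
          form_add (form_mult (\<lambda>_. r) (\<gamma> a \<tau>)) (\<gamma> a \<sigma>)) \<and>
     (\<forall>a\<in>Cinf K. \<forall>b\<in>Cinf K. \<forall>\<tau>\<in>Omega1 K.
        \<gamma> (\<lambda>g. a g * b g) \<tau> = form_add (form_mult b (\<gamma> a \<tau>)) (form_mult a (\<gamma> b \<tau>))) \<and>
     (\<forall>a\<in>Cinf K. \<forall>b\<in>Cinf K. \<forall>\<tau>\<in>Omega1 K.
        \<gamma> a (form_mult b \<tau>) = form_add (form_mult b (\<gamma> a \<tau>)) (form_mult (br a b) \<tau>))"

definition poisson_compatible ::
  "('g::topological_space, 'e::euclidean_space) lie_group_data \<Rightarrow> 'g bracket \<Rightarrow> ('g, 'e) preconn \<Rightarrow> bool" where
  "poisson_compatible K br \<gamma> \<longleftrightarrow>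
     (\<forall>a\<in>Cinf K. \<forall>b\<in>Cinf K.
        ext_d K (br a b) = form_diff (\<gamma> a (ext_d K b)) (\<gamma> b (ext_d K a)))"

definition flat_preconnection ::
  "('g::topological_space, 'e::euclidean_space) lie_group_data \<Rightarrow> 'g bracket \<Rightarrow> ('g, 'e) preconn \<Rightarrow> bool" where
  "flat_preconnection K br \<gamma> \<longleftrightarrow>
     (\<forall>a\<in>Cinf K. \<forall>b\<in>Cinf K. \<forall>\<tau>\<in>Omega1 K.
        form_diff (\<gamma> a (\<gamma> b \<tau>)) (\<gamma> b (\<gamma> a \<tau>)) = \<gamma> (br a b) \<tau>)"

text \<open>The basis \<open>e\<^sub>i\<close> of the Lie algebra is \<open>Basis\<close>, with dual basis \<open>blinfun_inner_left i\<close>; the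
  linear map \<open>\<Xi>\<close> on the tensor square is given as a bilinear map, and
  \<open>\<Xi>\<^sup>i\<^sup>j\<^sub>k = \<Xi> (f\<^sup>i) (f\<^sup>j) e\<^sub>k\<close>. The condition does not depend on the basis.\<close>

definition left_covariant ::
  "('g::topological_space, 'e::euclidean_space) lie_group_data \<Rightarrow> 'g bracket \<Rightarrow> ('g, 'e) preconn \<Rightarrow> bool" where
  "left_covariant K br \<gamma> \<longleftrightarrow>
     (\<exists>\<Xi> :: ('e \<Rightarrow>\<^sub>L real) \<Rightarrow> ('e \<Rightarrow>\<^sub>L real) \<Rightarrow> ('e \<Rightarrow>\<^sub>L real). bilinear \<Xi> \<and>
       (\<forall>a\<in>Cinf K. \<forall>t :: 'e \<Rightarrow> 'g \<Rightarrow> real. (\<forall>k\<in>Basis. t k \<in> Cinf K) \<longrightarrow>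
          \<gamma> a (form_sum (\<lambda>k. form_mult (t k) (left_form K (blinfun_inner_left k))) Basis) =
          form_sum (\<lambda>k. form_mult
            (\<lambda>g. br a (t k) g +
              (\<Sum>i\<in>Basis. \<Sum>j\<in>Basis.
                 blinfun_apply (\<Xi> (blinfun_inner_left i) (blinfun_inner_left j)) k
                 * left_field K i a g * t j g))
            (left_form K (blinfun_inner_left k))) Basis))"

end

theory Submission
  imports Defs
begin

text \<open>
  Write \<open>\<partial>\<^sub>x\<close> for the left-invariant vector field of \<open>x\<close> and \<open>da\<close> for the differential of \<open>a\<close>, moved to the
  unit by left translation. In the left-invariant frame a left-covariant preconnection is given by a bilinear
  map \<open>\<Xi>\<close> on the dual of the Lie algebra. If the Poisson bracket satisfies
  \<open>\<partial>\<^sub>x{a, b} = {\<partial>\<^sub>xa, b} + {a, \<partial>\<^sub>xb} + \<langle>[da, db], x\<rangle>\<close>, then compatibility and flatness of the preconnection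
  become exactly the axioms of a pre-Lie structure \<open>\<Xi>\<close> on the dual Lie algebra. It remains to verify
  the Jacobi identity and the displayed identity on the tangent group.

  On \<open>G\<close> the displayed identity is the derivative of the multiplicativity of the bracket. Applied to functions
  with a prescribed differential at one point (these exist because there are bump functions), it shows, together
  with the Jacobi identity, how the dressing fields commute with left-invariant fields and with each other, and
  that the cobracket is a cocycle. The bracket of the tangent group is expressed by dressing fields and vertical
  derivatives, where the former commute with the latter, so that these three facts give both identities.
\<close>

section \<open>Smooth maps between Euclidean spaces\<close>

text \<open>Two points shape the development. First, the passage from a pre-Lie product to a
  preconnection is stated for a Lie group with any Poisson bracket satisfying the displayed
  identity, so that it applies to the tangent group, whose bracket is given by a formula and not by
  a bivector. Second, the fibre coordinate of the tangent group is not left-invariant: over a fibre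
  point \<open>u\<close> the left-invariant differential of \<open>a\<close> has the components
  \<open>hor a p + coad u (vert a p)\<close> and \<open>vert a p\<close>. Differentiating this
  correction produces coadjoint terms; some match those in the commutator of a left-invariant field
  with a dressing field, and the rest, linear in \<open>u\<close>, form exactly the cocycle
  identity. Functions with prescribed differential serve to remove second derivatives: these enter
  only through derivatives of left-translated differentials and cancel between two computations of
  the same bracket, so that the remaining identity involves the values of the differentials alone
  and holds for arbitrary covectors.\<close>

lemma Ck_on_subset: "Ck_on k S f \<Longrightarrow> T \<subseteq> S \<Longrightarrow> Ck_on k T f"
  by (induction k arbitrary: f) (auto intro: continuous_on_subset)

lemma Ck_on_cong:
  assumes "open S" "\<And>x. x \<in> S \<Longrightarrow> f x = g x"
  shows "Ck_on k S f \<longleftrightarrow> Ck_on k S g"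
proof -
  have main: "Ck_on k S g" if "Ck_on k S f" "\<And>x. x \<in> S \<Longrightarrow> f x = g x" for f g :: "'a \<Rightarrow> 'b"
    using that
  proof (induction k arbitrary: f g)
    case 0
    then show ?case
      by (simp add: continuous_on_eq)
  next
    case (Suc k)
    have D: "(g has_derivative frechet_derivative f (at x)) (at x)" if "x \<in> S" for x
    proof -
      have "(f has_derivative frechet_derivative f (at x)) (at x)"
        using Suc.prems(1) that by (simp flip: frechet_derivative_works)
      then show ?thesis
        using assms(1) that Suc.prems(2) has_derivative_transform_within_open by blast
    qed
    then have "frechet_derivative f (at x) = frechet_derivative g (at x)" if "x \<in> S" for x
      using frechet_derivative_at that by blast
    then have "Ck_on k S (\<lambda>x. frechet_derivative g (at x) v)" for v
      using Suc.IH[of "\<lambda>x. frechet_derivative f (at x) v" "\<lambda>x. frechet_derivative g (at x) v"] Suc.prems(1)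
      by simp
    moreover have "\<forall>x\<in>S. g differentiable at x"
      using D differentiable_def by blast
    ultimately show ?case
      by simp
  qed
  then show ?thesis
    using assms(2) by metis
qed

lemma Ck_on_Suc_imp: "Ck_on (Suc k) S f \<Longrightarrow> Ck_on k S f"
proof (induction k arbitrary: f)
  case 0
  then show ?case
    by (simp add: continuous_at_imp_continuous_on differentiable_imp_continuous_within)
qed simp

text \<open>All derivatives are taken in the whole space and not within \<open>S\<close>, so the
  neighbourhoods \<open>U\<close> may leave \<open>S\<close>.\<close>

lemma Ck_on_local:
  assumes "\<And>x. x \<in> S \<Longrightarrow> \<exists>U. open U \<and> x \<in> U \<and> Ck_on k U f"
  shows "Ck_on k S f"
  using assms
proof (induction k arbitrary: f)
  case 0
  have "isCont f x" if "x \<in> S" for x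
    using 0[OF that] continuous_on_eq_continuous_at by auto
  then show ?case
    by (simp add: continuous_at_imp_continuous_on)
next
  case (Suc k)
  then show ?case
    by (auto; meson)
qed

lemma Ck_on_const: "Ck_on k S (\<lambda>x. c)"
  by (induction k arbitrary: c) auto

lemma Ck_on_bounded_linear:
  assumes "bounded_linear L"
  shows "Ck_on k S L"
proof (cases k)
  case 0
  then show ?thesis
    by (simp add: assms linear_continuous_on)
next
  case (Suc m)
  have D: "(L has_derivative L) (at x)" for x
    by (simp add: assms bounded_linear_imp_has_derivative)
  then have "frechet_derivative L (at x) = L" for x
    by (metis frechet_derivative_at)
  then show ?thesis
    using D Suc by (auto simp: Ck_on_const differentiable_def)
qed

text \<open>Any explicit derivative \<open>f'\<close> can stand in for
  \<open>frechet_derivative\<close>: on an open set they agree near each point, which is all that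
  the next order of differentiation sees.\<close>

lemma Ck_on_SucI:
  assumes "open S" and D: "\<And>x. x \<in> S \<Longrightarrow> (f has_derivative f' x) (at x)"
    and "\<And>v. Ck_on k S (\<lambda>x. f' x v)"
  shows "Ck_on (Suc k) S f"
proof -
  have "f' x v = frechet_derivative f (at x) v" if "x \<in> S" for x v
    by (simp flip: frechet_derivative_at[OF D[OF that]])
  then have "Ck_on k S (\<lambda>x. frechet_derivative f (at x) v)" for v
    by (rule Ck_on_cong[OF assms(1), THEN iffD1, OF _ assms(3)])
  then show ?thesis
    using D by (auto simp: differentiable_def)
qed

lemma Ck_on_Suc_has_derivative:
  "Ck_on (Suc k) S f \<Longrightarrow> x \<in> S \<Longrightarrow> (f has_derivative frechet_derivative f (at x)) (at x)"
  by (simp flip: frechet_derivative_works)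

lemma Ck_on_linear_compose:
  assumes "bounded_linear L" "open S"
  shows "Ck_on k S f \<Longrightarrow> Ck_on k S (\<lambda>x. L (f x))"
proof (induction k arbitrary: f)
  case 0
  then show ?case
    using assms(1) bounded_linear.continuous_on by auto
next
  case (Suc k)
  show ?case
    by (rule Ck_on_SucI[OF assms(2) bounded_linear.has_derivative[OF assms(1) Ck_on_Suc_has_derivative[OF Suc.prems]]])
      (use Suc in auto)
qed

lemma Ck_on_add:
  assumes "open S"
  shows "Ck_on k S f \<Longrightarrow> Ck_on k S g \<Longrightarrow> Ck_on k S (\<lambda>x. f x + g x)"
proof (induction k arbitrary: f g)
  case 0
  then show ?case
    by (simp add: continuous_on_add)
next
  case (Suc k)
  show ?case
    by (rule Ck_on_SucI[OF assms has_derivative_add[OF Ck_on_Suc_has_derivative[OF Suc.prems(1)] Ck_on_Suc_has_derivative[OF Suc.prems(2)]]])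
      (use Suc in auto)
qed

lemma Ck_on_sum:
  assumes "open S" "\<And>i. i \<in> I \<Longrightarrow> Ck_on k S (f i)"
  shows "Ck_on k S (\<lambda>x. \<Sum>i\<in>I. f i x)"
  using assms(2)
proof (induction I rule: infinite_finite_induct)
  case (insert i I)
  then show ?case
    using Ck_on_add[OF assms(1), of k "f i" "\<lambda>x. sum (\<lambda>i. f i x) I"] by simp
qed (auto simp: Ck_on_const)

text \<open>The product rule leaves one factor undifferentiated, so the induction also uses that
  \<open>Ck_on (Suc k)\<close> implies \<open>Ck_on k\<close>.\<close>

lemma Ck_on_bilinear:
  assumes "bounded_bilinear B" "open S"
  shows "Ck_on k S f \<Longrightarrow> Ck_on k S g \<Longrightarrow> Ck_on k S (\<lambda>x. B (f x) (g x))"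
proof (induction k arbitrary: f g)
  case 0
  then show ?case
    using assms(1) by (simp add: bounded_bilinear.continuous_on)
next
  case (Suc k)
  show ?case
    by (rule Ck_on_SucI[OF assms(2) bounded_bilinear.FDERIV[OF assms(1)
          Ck_on_Suc_has_derivative[OF Suc.prems(1)] Ck_on_Suc_has_derivative[OF Suc.prems(2)]]])
      (use Suc Ck_on_Suc_imp[of k S f] Ck_on_Suc_imp[of k S g] in \<open>auto intro!: Ck_on_add[OF assms(2)]\<close>)
qed

text \<open>By the chain rule the derivative is a linear map that varies with \<open>x\<close>,
  applied to a vector that varies with \<open>x\<close>. Expanding that vector in the basis of the
  middle space turns it into a sum of products, to which the induction hypothesis applies.\<close>

lemma Ck_on_compose:
  fixes f :: "'b::euclidean_space \<Rightarrow> 'c::real_normed_vector" and g :: "'a::real_normed_vector \<Rightarrow> 'b"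
  assumes "open S" "g ` S \<subseteq> T"
  shows "Ck_on k T f \<Longrightarrow> Ck_on k S g \<Longrightarrow> Ck_on k S (\<lambda>x. f (g x))"
proof (induction k arbitrary: f)
  case 0
  then show ?case
    using assms(2) continuous_on_compose2 by auto
next
  case (Suc k)
  show ?case
  proof (rule Ck_on_SucI[OF assms(1)])
    fix x
    assume x: "x \<in> S"
    then have "(f has_derivative frechet_derivative f (at (g x))) (at (g x))"
      using assms(2) by (intro Ck_on_Suc_has_derivative[OF Suc.prems(1)]) auto
    note f = this
    have eq: "frechet_derivative f (at (g x)) w = (\<Sum>b\<in>Basis. (w \<bullet> b) *\<^sub>R frechet_derivative f (at (g x)) b)" for w
    proof -
      have "frechet_derivative f (at (g x)) w = frechet_derivative f (at (g x)) (\<Sum>b\<in>Basis. (w \<bullet> b) *\<^sub>R b)"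
        by (simp add: euclidean_representation)
      then show ?thesis
        using has_derivative_linear[OF f] by (simp add: linear_sum linear_scale)
    qed
    show "((\<lambda>x. f (g x)) has_derivative (\<lambda>v. \<Sum>b\<in>Basis.
        (frechet_derivative g (at x) v \<bullet> b) *\<^sub>R frechet_derivative f (at (g x)) b)) (at x)"
      unfolding eq[symmetric] by (rule has_derivative_compose[OF Ck_on_Suc_has_derivative[OF Suc.prems(2) x] f])
  next
    fix v
    show "Ck_on k S (\<lambda>x. \<Sum>b\<in>Basis. (frechet_derivative g (at x) v \<bullet> b) *\<^sub>R frechet_derivative f (at (g x)) b)"
    proof (intro Ck_on_sum Ck_on_bilinear[OF bounded_bilinear_scaleR] assms(1))
      fix b :: 'b
      show "Ck_on k S (\<lambda>x. frechet_derivative g (at x) v \<bullet> b)"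
        using Ck_on_linear_compose[OF bounded_linear_inner_left assms(1), of k "\<lambda>x. frechet_derivative g (at x) v" b]
          Suc.prems(2) by simp
      show "Ck_on k S (\<lambda>x. frechet_derivative f (at (g x)) b)"
        using Suc.IH[of "\<lambda>y. frechet_derivative f (at y) b"] Suc.prems Ck_on_Suc_imp by auto
    qed
  qed
qed

lemma smooth_on_subset: "smooth_on S f \<Longrightarrow> T \<subseteq> S \<Longrightarrow> smooth_on T f"
  by (meson Ck_on_subset smooth_on_def)

lemma smooth_on_cong: "open S \<Longrightarrow> (\<And>x. x \<in> S \<Longrightarrow> f x = g x) \<Longrightarrow> smooth_on S f \<longleftrightarrow> smooth_on S g"
  unfolding smooth_on_def using Ck_on_cong by blast

lemma smooth_on_local:
  assumes "\<And>x. x \<in> S \<Longrightarrow> \<exists>U. open U \<and> x \<in> U \<and> smooth_on U f"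
  shows "smooth_on S f"
  unfolding smooth_on_def using assms Ck_on_local unfolding smooth_on_def by meson

lemma smooth_on_const: "smooth_on S (\<lambda>x. c)"
  by (simp add: smooth_on_def Ck_on_const)

lemma smooth_on_bounded_linear: "bounded_linear L \<Longrightarrow> smooth_on S L"
  by (simp add: smooth_on_def Ck_on_bounded_linear)

lemma smooth_on_linear_compose:
  "bounded_linear L \<Longrightarrow> open S \<Longrightarrow> smooth_on S f \<Longrightarrow> smooth_on S (\<lambda>x. L (f x))"
  by (simp add: smooth_on_def Ck_on_linear_compose)

lemma smooth_on_add:
  "open S \<Longrightarrow> smooth_on S f \<Longrightarrow> smooth_on S g \<Longrightarrow> smooth_on S (\<lambda>x. f x + g x)"
  by (simp add: smooth_on_def Ck_on_add)

lemma smooth_on_sum: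
  "open S \<Longrightarrow> (\<And>i. i \<in> I \<Longrightarrow> smooth_on S (f i)) \<Longrightarrow> smooth_on S (\<lambda>x. \<Sum>i\<in>I. f i x)"
  by (simp add: smooth_on_def Ck_on_sum)

lemma smooth_on_bilinear:
  "bounded_bilinear B \<Longrightarrow> open S \<Longrightarrow> smooth_on S f \<Longrightarrow> smooth_on S g \<Longrightarrow> smooth_on S (\<lambda>x. B (f x) (g x))"
  by (simp add: smooth_on_def Ck_on_bilinear)

lemma smooth_on_compose:
  fixes f :: "'b::euclidean_space \<Rightarrow> 'c::real_normed_vector" and g :: "'a::real_normed_vector \<Rightarrow> 'b"
  assumes "open S" "g ` S \<subseteq> T" "smooth_on T f" "smooth_on S g"
  shows "smooth_on S (\<lambda>x. f (g x))"
  using assms by (simp add: smooth_on_def Ck_on_compose)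

lemma smooth_on_ident: "smooth_on S (\<lambda>x. x)"
  by (simp add: smooth_on_bounded_linear bounded_linear_ident)

lemma smooth_on_Pair:
  assumes "open S" "smooth_on S f" "smooth_on S g"
  shows "smooth_on S (\<lambda>x. (f x, g x))"
proof -
  have "smooth_on S (\<lambda>x. (f x, 0) + (0, g x))"
    using assms by (intro smooth_on_add smooth_on_linear_compose[of "\<lambda>x. (x, 0)"] smooth_on_linear_compose[of "\<lambda>x. (0, x)"])
      (auto intro: bounded_linear_intros bounded_linear_Pair bounded_linear_ident bounded_linear_zero)
  then show ?thesis
    by simp
qed

lemma smooth_on_continuous: "smooth_on S f \<Longrightarrow> continuous_on S f"
  unfolding smooth_on_def by (metis Ck_on.simps(1))

lemma smooth_on_differentiable: "smooth_on S f \<Longrightarrow> x \<in> S \<Longrightarrow> f differentiable (at x)"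
  unfolding smooth_on_def by (metis Ck_on.simps(2))

lemma smooth_on_has_derivative:
  "smooth_on S f \<Longrightarrow> x \<in> S \<Longrightarrow> (f has_derivative frechet_derivative f (at x)) (at x)"
  using smooth_on_differentiable frechet_derivative_works by blast

lemma smooth_on_frechet_derivative:
  "smooth_on S f \<Longrightarrow> smooth_on S (\<lambda>x. frechet_derivative f (at x) v)"
  unfolding smooth_on_def by (metis Ck_on.simps(2))

subsection \<open>Symmetry of second derivatives\<close>

lemma smooth_on_directional_DERIV:
  fixes f :: "'a::real_normed_vector \<Rightarrow> real"
  assumes f: "smooth_on S f" and S: "q + s *\<^sub>R x \<in> S"
  shows "((\<lambda>s. f (q + s *\<^sub>R x)) has_real_derivative frechet_derivative f (at (q + s *\<^sub>R x)) x) (at s)"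
proof -
  have "((\<lambda>s. q + s *\<^sub>R x) has_derivative (\<lambda>r. r *\<^sub>R x)) (at s)"
    by (auto intro!: derivative_eq_intros)
  from has_derivative_compose[OF this smooth_on_has_derivative[OF f S]] show ?thesis
    by (rule has_derivative_imp_has_field_derivative)
      (simp add: linear_scale[OF linear_frechet_derivative[OF smooth_on_differentiable[OF f S]]])
qed

text \<open>The second difference over a parallelogram is symmetric in \<open>x\<close> and
  \<open>y\<close>, whereas the right-hand side differentiates along \<open>x\<close> first. The
  mean value theorem is used in \<open>s\<close> for the difference in the direction
  \<open>y\<close>, and then in \<open>t\<close>.\<close>

lemma mixed_difference_MVT:
  fixes f :: "'a::real_normed_vector \<Rightarrow> real"
  assumes f: "smooth_on S f" and "h > 0"
    and S: "\<And>s t. 0 \<le> s \<Longrightarrow> s \<le> h \<Longrightarrow> 0 \<le> t \<Longrightarrow> t \<le> h \<Longrightarrow> p + s *\<^sub>R x + t *\<^sub>R y \<in> S"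
  shows "\<exists>s t. 0 \<le> s \<and> s \<le> h \<and> 0 \<le> t \<and> t \<le> h \<and>
    f (p + h *\<^sub>R x + h *\<^sub>R y) - f (p + h *\<^sub>R x) - f (p + h *\<^sub>R y) + f p
    = h * h * frechet_derivative (\<lambda>q. frechet_derivative f (at q) x) (at (p + s *\<^sub>R x + t *\<^sub>R y)) y"
proof -
  define fx where "fx = (\<lambda>q. frechet_derivative f (at q) x)"
  have fx: "smooth_on S fx"
    unfolding fx_def by (intro smooth_on_frechet_derivative f)
  define \<phi> where "\<phi> s = f (p + s *\<^sub>R x + h *\<^sub>R y) - f (p + s *\<^sub>R x)" for s
  have D1: "((\<lambda>s. f (p + s *\<^sub>R x + t *\<^sub>R y)) has_real_derivative fx (p + s *\<^sub>R x + t *\<^sub>R y)) (at s)"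
    if "0 \<le> s" "s \<le> h" "0 \<le> t" "t \<le> h" for s t
    using smooth_on_directional_DERIV[OF f, of "p + t *\<^sub>R y" s x] S[OF that] by (simp add: fx_def ac_simps)
  have D2: "((\<lambda>t. fx (p + s *\<^sub>R x + t *\<^sub>R y)) has_real_derivative frechet_derivative fx (at (p + s *\<^sub>R x + t *\<^sub>R y)) y) (at t)"
    if "0 \<le> s" "s \<le> h" "0 \<le> t" "t \<le> h" for s t
    by (rule smooth_on_directional_DERIV[OF fx S[OF that]])
  have "(\<phi> has_real_derivative fx (p + s *\<^sub>R x + h *\<^sub>R y) - fx (p + s *\<^sub>R x)) (at s)" if "0 \<le> s" "s \<le> h" for s
    unfolding \<phi>_def using D1[of s h] D1[of s 0] that \<open>h > 0\<close> by (intro DERIV_diff) auto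
  then obtain s where s: "0 < s" "s < h"
    "\<phi> h - \<phi> 0 = (h - 0) * (fx (p + s *\<^sub>R x + h *\<^sub>R y) - fx (p + s *\<^sub>R x))"
    using MVT2[of 0 h \<phi> "\<lambda>s. fx (p + s *\<^sub>R x + h *\<^sub>R y) - fx (p + s *\<^sub>R x)"] \<open>h > 0\<close> by blast
  obtain t where t: "0 < t" "t < h"
    "fx (p + s *\<^sub>R x + h *\<^sub>R y) - fx (p + s *\<^sub>R x + 0 *\<^sub>R y) = (h - 0) * frechet_derivative fx (at (p + s *\<^sub>R x + t *\<^sub>R y)) y"
    using MVT2[of 0 h "\<lambda>t. fx (p + s *\<^sub>R x + t *\<^sub>R y)" "\<lambda>t. frechet_derivative fx (at (p + s *\<^sub>R x + t *\<^sub>R y)) y"]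
      D2[of s] \<open>h > 0\<close> s by auto
  have "\<phi> h - \<phi> 0 = h * (h * frechet_derivative fx (at (p + s *\<^sub>R x + t *\<^sub>R y)) y)"
    using s(3) t(3) by simp
  then show ?thesis
    unfolding fx_def[symmetric] using s t
    by (intro exI[of _ s] exI[of _ t]) (simp add: \<phi>_def algebra_simps)
qed

text \<open>One and the same second difference equals \<open>h * h\<close> times either mixed
  derivative, each at some point near \<open>p\<close>. Both are continuous, so their values at
  \<open>p\<close> differ by at most any \<open>e > 0\<close>.\<close>

lemma second_derivative_symmetric:
  fixes f :: "'a::real_normed_vector \<Rightarrow> real"
  assumes f: "smooth_on S f" and "open S" "p \<in> S"
  shows "frechet_derivative (\<lambda>q. frechet_derivative f (at q) x) (at p) y
       = frechet_derivative (\<lambda>q. frechet_derivative f (at q) y) (at p) x" (is "?F p = ?G p")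
proof -
  have "continuous_on S ?F" "continuous_on S ?G"
    by (intro smooth_on_continuous smooth_on_frechet_derivative f)+
  then have cont: "isCont ?F p" "isCont ?G p"
    using assms(2,3) continuous_on_eq_continuous_at by blast+
  have "\<bar>?F p - ?G p\<bar> \<le> e" if "e > 0" for e
  proof -
    obtain d0 where d0: "d0 > 0" "ball p d0 \<subseteq> S"
      using assms(2,3) openE by blast
    obtain d1 where d1: "d1 > 0" "\<And>q. dist q p < d1 \<Longrightarrow> dist (?F q) (?F p) < e/2"
      using cont(1) \<open>e > 0\<close> unfolding continuous_at_eps_delta by (meson half_gt_zero)
    obtain d2 where d2: "d2 > 0" "\<And>q. dist q p < d2 \<Longrightarrow> dist (?G q) (?G p) < e/2"
      using cont(2) \<open>e > 0\<close> unfolding continuous_at_eps_delta by (meson half_gt_zero)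
    define d where "d = min d0 (min d1 d2)"
    have "d > 0"
      using d0 d1 d2 by (simp add: d_def)
    \<comment> \<open>This size keeps the whole parallelogram within distance \<open>d\<close> of
      \<open>p\<close>; the \<open>+ 1\<close> keeps the denominator positive when \<open>x\<close>
      and \<open>y\<close> vanish.\<close>
    define h where "h = d / (norm x + norm y + 1)"
    have np: "norm x + norm y + 1 > 0"
      by (smt (verit) norm_ge_zero)
    have "h > 0"
      using \<open>d > 0\<close> np by (simp add: h_def)
    have close: "dist (p + s *\<^sub>R x + t *\<^sub>R y) p < d" if "0 \<le> s" "s \<le> h" "0 \<le> t" "t \<le> h" for s t
    proof -
      have "dist (p + s *\<^sub>R x + t *\<^sub>R y) p = norm (s *\<^sub>R x + t *\<^sub>R y)"
        by (simp add: dist_norm algebra_simps)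
      also have "\<dots> \<le> norm (s *\<^sub>R x) + norm (t *\<^sub>R y)"
        by (rule norm_triangle_ineq)
      also have "\<dots> \<le> h * norm x + h * norm y"
        using that by (simp add: add_mono mult_right_mono)
      also have "\<dots> < h * (norm x + norm y + 1)"
        using \<open>h > 0\<close> by (simp add: algebra_simps)
      also have "\<dots> = d"
        using np by (simp add: h_def)
      finally show ?thesis .
    qed
    then have inS: "p + s *\<^sub>R x + t *\<^sub>R y \<in> S" if "0 \<le> s" "s \<le> h" "0 \<le> t" "t \<le> h" for s t
      using d0(2) that by (force simp: d_def dist_commute)
    obtain s t where st: "0 \<le> s" "s \<le> h" "0 \<le> t" "t \<le> h"
      "f (p + h *\<^sub>R x + h *\<^sub>R y) - f (p + h *\<^sub>R x) - f (p + h *\<^sub>R y) + f p = h * h * ?F (p + s *\<^sub>R x + t *\<^sub>R y)"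
      using mixed_difference_MVT[OF f \<open>h > 0\<close> inS] by blast
    have inS': "p + s *\<^sub>R y + t *\<^sub>R x \<in> S" if "0 \<le> s" "s \<le> h" "0 \<le> t" "t \<le> h" for s t
      using inS[of t s] that by (simp add: ac_simps)
    obtain s' t' where st': "0 \<le> s'" "s' \<le> h" "0 \<le> t'" "t' \<le> h"
      "f (p + h *\<^sub>R y + h *\<^sub>R x) - f (p + h *\<^sub>R y) - f (p + h *\<^sub>R x) + f p = h * h * ?G (p + s' *\<^sub>R y + t' *\<^sub>R x)"
      using mixed_difference_MVT[OF f \<open>h > 0\<close> inS'] by blast
    have "h * h * ?F (p + s *\<^sub>R x + t *\<^sub>R y) = h * h * ?G (p + s' *\<^sub>R y + t' *\<^sub>R x)"
      proof -
      have "p + h *\<^sub>R y + h *\<^sub>R x = p + h *\<^sub>R x + h *\<^sub>R y"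
        by simp
      with st'(5) have "f (p + h *\<^sub>R x + h *\<^sub>R y) - f (p + h *\<^sub>R y) - f (p + h *\<^sub>R x) + f p
          = h * h * ?G (p + s' *\<^sub>R y + t' *\<^sub>R x)"
        by (simp only:)
      with st(5) show ?thesis
        by linarith
    qed
    then have "?F (p + s *\<^sub>R x + t *\<^sub>R y) = ?G (p + s' *\<^sub>R y + t' *\<^sub>R x)"
      using \<open>h > 0\<close> by simp
    moreover have "dist (?F (p + s *\<^sub>R x + t *\<^sub>R y)) (?F p) < e/2"
      using close[OF st(1-4)] by (intro d1) (simp add: d_def)
    moreover have "dist (?G (p + s' *\<^sub>R y + t' *\<^sub>R x)) (?G p) < e/2"
      using close[OF st'(3,4,1,2)] by (intro d2) (simp add: d_def ac_simps)
    ultimately show ?thesis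
      unfolding dist_real_def abs_less_iff abs_le_iff by linarith
  qed
  then have "\<bar>?F p - ?G p\<bar> \<le> 0"
    by (rule field_le_epsilon) simp
  then show ?thesis
    by simp
qed

subsection \<open>A smooth function with small support\<close>

text \<open>These functions are closed under differentiation.\<close>

definition exp_cutoff :: "real poly \<Rightarrow> real \<Rightarrow> real" where
  "exp_cutoff p t = (if t > 0 then poly p (1 / t) * exp (- (1 / t)) else 0)"

lemma poly_times_exp_tendsto_0: "((\<lambda>x. poly p x * exp (- x)) \<longlongrightarrow> 0) at_top" for p :: "real poly"
proof -
  have "((\<lambda>x. \<Sum>i\<le>degree p. coeff p i * (x ^ i / exp x)) \<longlongrightarrow> (\<Sum>i\<le>degree p. coeff p i * 0)) at_top"
    by (intro tendsto_intros tendsto_power_div_exp_0)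
  moreover have "(\<Sum>i\<le>degree p. coeff p i * (x ^ i / exp x)) = poly p x * exp (- x)" for x
    by (simp add: poly_altdef exp_minus divide_inverse sum_distrib_right mult.assoc)
  ultimately show ?thesis
    by simp
qed

lemma exp_cutoff_tendsto_0: "(exp_cutoff p \<longlongrightarrow> 0) (at 0)"
proof -
  have "eventually (\<lambda>t. exp_cutoff p t = 0) (at_left 0)"
    by (auto simp: eventually_at_filter exp_cutoff_def)
  then have "(exp_cutoff p \<longlongrightarrow> 0) (at_left 0)"
    by (simp add: tendsto_eventually)
  moreover have "(exp_cutoff p \<longlongrightarrow> 0) (at_right 0)"
  proof -
    have "((\<lambda>t. poly p (inverse t) * exp (- inverse t)) \<longlongrightarrow> 0) (at_right 0)"
      using filterlim_compose[OF poly_times_exp_tendsto_0 filterlim_inverse_at_top_right] .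
    moreover have "eventually (\<lambda>t. poly p (inverse t) * exp (- inverse t) = exp_cutoff p t) (at_right 0)"
      by (auto simp: eventually_at_filter exp_cutoff_def inverse_eq_divide)
    ultimately show ?thesis
      using Lim_transform_eventually by blast
  qed
  ultimately show ?thesis
    by (simp add: filterlim_split_at_real)
qed

text \<open>The derivative of \<open>1 / t\<close> contributes the factor
  \<open>1 / t\<^sup>2\<close>, which is the monomial of degree two evaluated at
  \<open>1 / t\<close>; the factor \<open>p - pderiv p\<close> collects the derivatives of the
  exponential and of the polynomial.\<close>

lemma exp_cutoff_DERIV:
  "(exp_cutoff p has_real_derivative exp_cutoff (monom 1 2 * (p - pderiv p)) t) (at t)"
proof -
  consider "t > 0" | "t < 0" | "t = 0"
    by linarith
  then show ?thesis
  proof cases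
    case 1
    have "((\<lambda>t. poly p (1 / t) * exp (- (1 / t))) has_real_derivative
        poly (pderiv p) (1 / t) * (- (1 / t\<^sup>2)) * exp (- (1 / t)) + exp (- (1 / t)) * (1 / t\<^sup>2) * poly p (1 / t)) (at t)"
      using 1 by (auto intro!: derivative_eq_intros DERIV_chain2[OF poly_DERIV] simp: power2_eq_square)
    moreover have "poly (pderiv p) (1 / t) * (- (1 / t\<^sup>2)) * exp (- (1 / t)) + exp (- (1 / t)) * (1 / t\<^sup>2) * poly p (1 / t)
        = exp_cutoff (monom 1 2 * (p - pderiv p)) t"
      using 1 by (simp add: exp_cutoff_def poly_monom power_divide) (simp add: field_simps)
    ultimately have "((\<lambda>t. poly p (1 / t) * exp (- (1 / t))) has_real_derivative
        exp_cutoff (monom 1 2 * (p - pderiv p)) t) (at t)"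
      by (simp only:)
    then show ?thesis
      by (rule has_field_derivative_transform_within_open[of _ _ _ "{0<..}"]) (use 1 in \<open>auto simp: exp_cutoff_def\<close>)
  next
    case 2
    have "((\<lambda>s. 0) has_real_derivative exp_cutoff (monom 1 2 * (p - pderiv p)) t) (at t)"
      using 2 by (simp add: exp_cutoff_def)
    then show ?thesis
      by (rule has_field_derivative_transform_within_open[of _ _ _ "{..<0}"]) (use 2 in \<open>auto simp: exp_cutoff_def\<close>)
  next
    case 3
    have "((\<lambda>h. (exp_cutoff p (0 + h) - exp_cutoff p 0) / h) \<longlongrightarrow> 0) (at 0)"
    proof -
      \<comment> \<open>Dividing by \<open>h\<close> multiplies the polynomial by its variable, so
        the difference quotient at \<open>0\<close> is again a cutoff function and tends to
        \<open>0\<close>.\<close>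
      have "(exp_cutoff p (0 + h) - exp_cutoff p 0) / h = exp_cutoff (monom 1 1 * p) h" for h
        by (simp add: exp_cutoff_def poly_monom)
      then show ?thesis
        by (simp add: exp_cutoff_tendsto_0)
    qed
    then show ?thesis
      using 3 by (simp add: DERIV_def exp_cutoff_def)
  qed
qed

lemma smooth_on_exp_cutoff: "smooth_on UNIV (exp_cutoff p)"
proof -
  have "Ck_on k UNIV (exp_cutoff p)" for k
  proof (induction k arbitrary: p)
    case 0
    then show ?case
      using DERIV_isCont[OF exp_cutoff_DERIV] by (auto intro!: continuous_at_imp_continuous_on)
  next
    case (Suc k)
    have D: "(exp_cutoff p has_derivative (*) (exp_cutoff (monom 1 2 * (p - pderiv p)) t)) (at t)" for t
      using exp_cutoff_DERIV has_field_derivative_def by blast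
    then have "frechet_derivative (exp_cutoff p) (at t) v = v * exp_cutoff (monom 1 2 * (p - pderiv p)) t" for t v
      by (simp flip: frechet_derivative_at[OF D])
    moreover have "Ck_on k UNIV (\<lambda>t. v * exp_cutoff (monom 1 2 * (p - pderiv p)) t)" for v
      using Ck_on_linear_compose[OF bounded_linear_mult_right open_UNIV Suc.IH] .
    moreover have "exp_cutoff p differentiable (at t)" for t
      using D unfolding differentiable_def by blast
    ultimately show ?case
      by simp
  qed
  then show ?thesis
    by (simp add: smooth_on_def)
qed

text \<open>Here \<open>1\<close> is the constant polynomial: up to normalisation this is
  \<open>exp (- (1 / (r\<^sup>2 - v \<bullet> v)))\<close> inside the ball of radius
  \<open>r\<close> and zero outside.\<close>

definition bump :: "real \<Rightarrow> 'e::euclidean_space \<Rightarrow> real" where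
  "bump r v = exp_cutoff 1 (r\<^sup>2 - v \<bullet> v) / exp_cutoff 1 (r\<^sup>2)"

lemma smooth_on_bump: "smooth_on UNIV (bump r)"
proof -
  have "smooth_on UNIV (\<lambda>v::'a. r\<^sup>2 + - (v \<bullet> v))"
    by (intro smooth_on_add smooth_on_const smooth_on_linear_compose[OF bounded_linear_minus[OF bounded_linear_ident]]
        smooth_on_bilinear[OF bounded_bilinear_inner] smooth_on_ident open_UNIV)
  then have "smooth_on UNIV (\<lambda>v::'a. exp_cutoff 1 (r\<^sup>2 + - (v \<bullet> v)))"
    by (rule smooth_on_compose[OF open_UNIV subset_UNIV smooth_on_exp_cutoff])
  then have "smooth_on UNIV (\<lambda>v::'a. exp_cutoff 1 (r\<^sup>2 + - (v \<bullet> v)) / exp_cutoff 1 (r\<^sup>2))"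
    by (rule smooth_on_linear_compose[OF bounded_linear_divide open_UNIV])
  then show ?thesis
    by (simp add: bump_def[abs_def])
qed

lemma bump_0: "r > 0 \<Longrightarrow> bump r 0 = 1"
  by (simp add: bump_def exp_cutoff_def)

lemma bump_outside:
  assumes "r \<ge> 0" "norm v \<ge> r"
  shows "bump r v = 0"
proof -
  have "r\<^sup>2 \<le> v \<bullet> v"
    using power_mono[OF assms(2,1), of 2] by (simp only: dot_square_norm)
  then show ?thesis
    by (simp add: bump_def exp_cutoff_def)
qed

section \<open>Partial derivatives of maps on a product\<close>

lemma smooth_on_partial_snd:
  fixes f :: "'a::euclidean_space \<times> 'b::euclidean_space \<Rightarrow> 'c::real_normed_vector"
  assumes "smooth_on W f" "(u, v) \<in> W"
  shows "((\<lambda>v. f (u, v)) has_derivative (\<lambda>y. frechet_derivative f (at (u, v)) (0, y))) (at v)"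
    and "frechet_derivative (\<lambda>v. f (u, v)) (at v) y = frechet_derivative f (at (u, v)) (0, y)"
proof -
  have "((\<lambda>v. (u, v)) has_derivative (\<lambda>y. (0, y))) (at v)"
    by (auto intro!: derivative_eq_intros)
  then show D: "((\<lambda>v. f (u, v)) has_derivative (\<lambda>y. frechet_derivative f (at (u, v)) (0, y))) (at v)"
    using smooth_on_has_derivative[OF assms] has_derivative_compose by blast
  show "frechet_derivative (\<lambda>v. f (u, v)) (at v) y = frechet_derivative f (at (u, v)) (0, y)"
    by (simp flip: frechet_derivative_at[OF D])
qed

lemma smooth_on_partial_fst:
  fixes f :: "'a::euclidean_space \<times> 'b::euclidean_space \<Rightarrow> 'c::real_normed_vector"
  assumes "smooth_on W f" "(u, v) \<in> W"
  shows "((\<lambda>u. f (u, v)) has_derivative (\<lambda>x. frechet_derivative f (at (u, v)) (x, 0))) (at u)"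
    and "frechet_derivative (\<lambda>u. f (u, v)) (at u) x = frechet_derivative f (at (u, v)) (x, 0)"
proof -
  have "((\<lambda>u. (u, v)) has_derivative (\<lambda>x. (x, 0))) (at u)"
    by (auto intro!: derivative_eq_intros)
  then show D: "((\<lambda>u. f (u, v)) has_derivative (\<lambda>x. frechet_derivative f (at (u, v)) (x, 0))) (at u)"
    using smooth_on_has_derivative[OF assms] has_derivative_compose by blast
  show "frechet_derivative (\<lambda>u. f (u, v)) (at u) x = frechet_derivative f (at (u, v)) (x, 0)"
    by (simp flip: frechet_derivative_at[OF D])
qed

text \<open>The point \<open>s u\<close> may move with \<open>u\<close>. A constant \<open>s\<close>
  serves derivatives at the unit; a moving one serves the left-invariant coframe, a derivative at
  the base point itself.\<close>

lemma smooth_on_partial_along: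
  fixes f :: "'a::euclidean_space \<times> 'b::euclidean_space \<Rightarrow> 'c::real_normed_vector"
  assumes f: "smooth_on W f" and S: "open S" "smooth_on S s" "\<And>u. u \<in> S \<Longrightarrow> (u, s u) \<in> W"
  shows "smooth_on S (\<lambda>u. frechet_derivative (\<lambda>v. f (u, v)) (at (s u)) y)"
proof -
  have "smooth_on S (\<lambda>u. frechet_derivative f (at (u, s u)) (0, y))"
    by (rule smooth_on_compose[where g = "\<lambda>u. (u, s u)", OF S(1) _ smooth_on_frechet_derivative[OF f]])
      (use S in \<open>auto intro: smooth_on_Pair smooth_on_ident\<close>)
  then show ?thesis
    using smooth_on_partial_snd(2)[OF f S(3)] by (subst smooth_on_cong[OF S(1)]) auto
qed

text \<open>Both sides are second derivatives of \<open>f\<close> on the product, along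
  \<open>(x, 0)\<close> and \<open>(0, y)\<close> in either order.\<close>

lemma mixed_partials_commute:
  fixes f :: "'a::euclidean_space \<times> 'b::euclidean_space \<Rightarrow> real"
  assumes f: "smooth_on W f" and W: "open W" "(u0, v0) \<in> W"
  shows "frechet_derivative (\<lambda>u. frechet_derivative (\<lambda>v. f (u, v)) (at v0) y) (at u0) x
       = frechet_derivative (\<lambda>v. frechet_derivative (\<lambda>u. f (u, v)) (at u0) x) (at v0) y"
proof -
  have fy: "smooth_on W (\<lambda>z. frechet_derivative f (at z) (0, y))"
    and fx: "smooth_on W (\<lambda>z. frechet_derivative f (at z) (x, 0))"
    by (intro smooth_on_frechet_derivative f)+
  \<comment> \<open>The inner partial derivatives have to be identified with total ones at all
    nearby points, not only at \<open>(u0, v0)\<close>, before they are differentiated again; hence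
    a box inside \<open>W\<close>.\<close>
  obtain A B where AB: "open A" "open B" "u0 \<in> A" "v0 \<in> B" "A \<times> B \<subseteq> W"
    using open_prod_elim[OF W] by (metis mem_Sigma_iff)
  have "frechet_derivative (\<lambda>u. frechet_derivative (\<lambda>v. f (u, v)) (at v0) y) (at u0) x
      = frechet_derivative (\<lambda>u. frechet_derivative f (at (u, v0)) (0, y)) (at u0) x"
  proof -
    have "((\<lambda>u. frechet_derivative f (at (u, v0)) (0, y)) differentiable at u0)"
      using smooth_on_partial_fst(1)[OF fy W(2)] by (auto simp: differentiable_def)
    moreover have "frechet_derivative f (at (u, v0)) (0, y) = frechet_derivative (\<lambda>v. f (u, v)) (at v0) y" if "u \<in> A" for u
      using smooth_on_partial_snd(2)[OF f] AB that by (metis mem_Sigma_iff subsetD)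
    ultimately have "frechet_derivative (\<lambda>u. frechet_derivative f (at (u, v0)) (0, y)) (at u0)
        = frechet_derivative (\<lambda>u. frechet_derivative (\<lambda>v. f (u, v)) (at v0) y) (at u0)"
      by (intro frechet_derivative_transform_within_open[OF _ AB(1,3)])
    then show ?thesis
      by simp
  qed
  also have "\<dots> = frechet_derivative (\<lambda>z. frechet_derivative f (at z) (0, y)) (at (u0, v0)) (x, 0)"
    by (rule smooth_on_partial_fst(2)[OF fy W(2)])
  also have "\<dots> = frechet_derivative (\<lambda>z. frechet_derivative f (at z) (x, 0)) (at (u0, v0)) (0, y)"
    by (rule second_derivative_symmetric[OF f W])
  also have "\<dots> = frechet_derivative (\<lambda>v. frechet_derivative f (at (u0, v)) (x, 0)) (at v0) y"
    by (rule smooth_on_partial_snd(2)[OF fx W(2), symmetric])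
  also have "\<dots> = frechet_derivative (\<lambda>v. frechet_derivative (\<lambda>u. f (u, v)) (at u0) x) (at v0) y"
  proof -
    have "((\<lambda>v. frechet_derivative f (at (u0, v)) (x, 0)) differentiable at v0)"
      using smooth_on_partial_snd(1)[OF fx W(2)] by (auto simp: differentiable_def)
    moreover have "frechet_derivative f (at (u0, v)) (x, 0) = frechet_derivative (\<lambda>u. f (u, v)) (at u0) x" if "v \<in> B" for v
      using smooth_on_partial_fst(2)[OF f] AB that by (metis mem_Sigma_iff subsetD)
    ultimately have "frechet_derivative (\<lambda>v. frechet_derivative f (at (u0, v)) (x, 0)) (at v0)
        = frechet_derivative (\<lambda>v. frechet_derivative (\<lambda>u. f (u, v)) (at u0) x) (at v0)"
      by (intro frechet_derivative_transform_within_open[OF _ AB(2,4)])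
    then show ?thesis
      by simp
  qed
  finally show ?thesis .
qed

section \<open>Smooth maps between manifolds\<close>

lemma inv_crd_crd [simp]: "is_chart c \<Longrightarrow> p \<in> dom c \<Longrightarrow> inv_crd c (crd c p) = p"
  unfolding is_chart_def homeomorphism_def by blast+

lemma crd_inv_crd [simp]: "is_chart c \<Longrightarrow> u \<in> img c \<Longrightarrow> crd c (inv_crd c u) = u"
  unfolding is_chart_def homeomorphism_def by blast+

lemma inv_crd_in_dom [simp]: "is_chart c \<Longrightarrow> u \<in> img c \<Longrightarrow> inv_crd c u \<in> dom c"
  unfolding is_chart_def homeomorphism_def by blast+

lemma crd_in_img [simp]: "p \<in> dom c \<Longrightarrow> crd c p \<in> img c"
  by (auto simp: img_def)

lemma is_chart_open: "is_chart c \<Longrightarrow> open (dom c)" "is_chart c \<Longrightarrow> open (img c)"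
  unfolding is_chart_def homeomorphism_def by blast+

lemma continuous_on_crd: "is_chart c \<Longrightarrow> continuous_on (dom c) (crd c)"
  and continuous_on_inv_crd: "is_chart c \<Longrightarrow> continuous_on (img c) (inv_crd c)"
  unfolding is_chart_def homeomorphism_def by blast+

lemma open_crd_image:
  assumes "is_chart c" "open U" "U \<subseteq> dom c"
  shows "open (crd c ` U)"
proof -
  have "crd c ` U = img c \<inter> inv_crd c -` U"
    using assms(1,3) by (auto simp: image_iff) (metis crd_inv_crd)
  then show ?thesis
    using continuous_open_preimage[OF continuous_on_inv_crd is_chart_open(2)] assms by metis
qed

lemma dom_id_chart [simp]: "dom id_chart = UNIV"
  and crd_id_chart [simp]: "crd id_chart = id"
  and img_id_chart [simp]: "img id_chart = UNIV"
  and inv_crd_id_chart [simp]: "inv_crd id_chart = id"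
  by (auto simp: dom_def crd_def img_def inv_crd_def id_chart_def)

lemma is_chart_id [simp]: "is_chart id_chart"
  by (simp add: is_chart_def homeomorphism_def)

lemma dom_prod_chart [simp]: "dom (prod_chart c c') = dom c \<times> dom c'"
  and crd_prod_chart [simp]: "crd (prod_chart c c') = map_prod (crd c) (crd c')"
  and img_prod_chart [simp]: "img (prod_chart c c') = img c \<times> img c'"
  by (auto simp: dom_def crd_def img_def prod_chart_def)

lemma inv_crd_prod_chart [simp]:
  assumes "is_chart c" "is_chart c'" "u \<in> img c" "v \<in> img c'"
  shows "inv_crd (prod_chart c c') (u, v) = (inv_crd c u, inv_crd c' v)"
  unfolding inv_crd_def[of "prod_chart c c'"]
proof (rule inv_into_f_eq)
  show "inj_on (crd (prod_chart c c')) (dom (prod_chart c c'))"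
    using assms(1,2) by (auto simp: inj_on_def) (metis inv_crd_crd)+
qed (use assms in auto)

lemma is_chart_prod:
  assumes "is_chart c" "is_chart c'"
  shows "is_chart (prod_chart c c')"
proof -
  have "continuous_on (dom c \<times> dom c') (map_prod (crd c) (crd c'))"
    unfolding map_prod_def case_prod_beta
    by (intro continuous_on_Pair continuous_on_compose2[OF continuous_on_crd[OF assms(1)] continuous_on_fst]
        continuous_on_compose2[OF continuous_on_crd[OF assms(2)] continuous_on_snd] continuous_on_id) auto
  moreover have "continuous_on (img c \<times> img c') (\<lambda>z. (inv_crd c (fst z), inv_crd c' (snd z)))"
    by (intro continuous_on_Pair continuous_on_compose2[OF continuous_on_inv_crd[OF assms(1)] continuous_on_fst]
        continuous_on_compose2[OF continuous_on_inv_crd[OF assms(2)] continuous_on_snd] continuous_on_id) auto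
  then have "continuous_on (img c \<times> img c') (inv_crd (prod_chart c c'))"
    by (rule continuous_on_eq) (use assms in auto)
  moreover have "inv_crd (prod_chart c c') ` (img c \<times> img c') = dom c \<times> dom c'"
  proof (intro set_eqI iffI)
    fix p
    assume "p \<in> dom c \<times> dom c'"
    then have "p = inv_crd (prod_chart c c') (crd c (fst p), crd c' (snd p))"
      using assms by auto
    then show "p \<in> inv_crd (prod_chart c c') ` (img c \<times> img c')"
      using \<open>p \<in> dom c \<times> dom c'\<close> by (metis SigmaE crd_in_img fst_conv image_eqI mem_Sigma_iff snd_conv)
  qed (use assms in auto)
  ultimately show ?thesis
    using assms is_chart_open[OF assms(1)] is_chart_open[OF assms(2)]
    unfolding is_chart_def[of "prod_chart c c'"] homeomorphism_def
    by (auto simp: open_Times img_def[of "prod_chart c c'", symmetric, simplified])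
qed

lemma smooth_atlasD:
  assumes "smooth_atlas A"
  shows "c \<in> A \<Longrightarrow> is_chart c" "\<exists>c\<in>A. p \<in> dom c"
  using assms by (auto simp: smooth_atlas_def)

lemma smooth_transition:
  "smooth_atlas A \<Longrightarrow> c \<in> A \<Longrightarrow> c' \<in> A \<Longrightarrow> smooth_on (crd c ` (dom c \<inter> dom c')) (\<lambda>u. crd c' (inv_crd c u))"
  by (auto simp: smooth_atlas_def o_def)

lemma smooth_atlas_id [simp]: "smooth_atlas {id_chart}"
proof -
  have "smooth_on UNIV (id :: 'a \<Rightarrow> 'a)"
    using smooth_on_ident[of UNIV] by (simp add: id_def)
  then show ?thesis
    by (simp add: smooth_atlas_def)
qed

lemma prod_atlas_iff: "d \<in> prod_atlas A B \<longleftrightarrow> (\<exists>c\<in>A. \<exists>c'\<in>B. d = prod_chart c c')"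
  by (auto simp: prod_atlas_def)

lemma smooth_atlas_prod:
  assumes "smooth_atlas A" "smooth_atlas B"
  shows "smooth_atlas (prod_atlas A B)"
  unfolding smooth_atlas_def
proof (intro conjI ballI)
  fix d
  assume "d \<in> prod_atlas A B"
  then show "is_chart d"
    using assms by (auto simp: prod_atlas_iff intro: is_chart_prod smooth_atlasD)
next
  show "(\<Union>c\<in>prod_atlas A B. dom c) = UNIV"
  proof (intro set_eqI iffI UNIV_I)
    fix p :: "'a \<times> 'c"
    obtain c c' where "c \<in> A" "fst p \<in> dom c" "c' \<in> B" "snd p \<in> dom c'"
      using smooth_atlasD(2)[OF assms(1)] smooth_atlasD(2)[OF assms(2)] by metis
    then have "prod_chart c c' \<in> prod_atlas A B" "p \<in> dom (prod_chart c c')"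
      by (auto simp: prod_atlas_iff mem_Times_iff)
    then show "p \<in> (\<Union>c\<in>prod_atlas A B. dom c)"
      by blast
  qed
next
  fix d d'
  assume "d \<in> prod_atlas A B" "d' \<in> prod_atlas A B"
  then obtain c e c' e' where d: "c \<in> A" "e \<in> B" "d = prod_chart c e" "c' \<in> A" "e' \<in> B" "d' = prod_chart c' e'"
    by (auto simp: prod_atlas_iff)
  have ch: "is_chart c" "is_chart e" "is_chart c'" "is_chart e'"
    using d assms smooth_atlasD(1) by blast+
  let ?U = "crd c ` (dom c \<inter> dom c')" and ?V = "crd e ` (dom e \<inter> dom e')"
  have o: "open ?U" "open ?V"
    using ch by (auto intro!: open_crd_image open_Int is_chart_open)
  have sm: "smooth_on (?U \<times> ?V) (\<lambda>z. (crd c' (inv_crd c (fst z)), crd e' (inv_crd e (snd z))))"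
    by (intro smooth_on_Pair open_Times o
        smooth_on_compose[OF _ _ smooth_transition[OF assms(1) d(1,4)], where g = fst]
        smooth_on_compose[OF _ _ smooth_transition[OF assms(2) d(2,5)], where g = snd]
        smooth_on_bounded_linear bounded_linear_fst bounded_linear_snd) auto
  have eq: "crd d ` (dom d \<inter> dom d') = ?U \<times> ?V"
    using map_prod_surj_on[of "crd c" "dom c \<inter> dom c'" ?U "crd e" "dom e \<inter> dom e'" ?V] by (simp only: d crd_prod_chart dom_prod_chart Times_Int_Times)
  have pt: "(crd c' (inv_crd c (fst z)), crd e' (inv_crd e (snd z))) = (crd d' \<circ> inv_crd d) z" if "z \<in> ?U \<times> ?V" for z
    using that ch by (auto simp: d)
  show "smooth_on (crd d ` (dom d \<inter> dom d')) (crd d' \<circ> inv_crd d)"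
    unfolding eq by (rule smooth_on_cong[OF open_Times[OF o], THEN iffD1, OF pt sm])
qed

lemma smooth_mapD:
  assumes "smooth_map A B F" "c \<in> A" "c' \<in> B" "U \<subseteq> dom c" "F ` U \<subseteq> dom c'"
  shows "smooth_on (crd c ` U) (\<lambda>u. crd c' (F (inv_crd c u)))"
proof -
  have "smooth_on (crd c ` (dom c \<inter> F -` dom c')) (\<lambda>u. crd c' (F (inv_crd c u)))"
    using assms(1-3) by (auto simp: smooth_map_def o_def)
  then show ?thesis
    by (rule smooth_on_subset) (use assms(4,5) in blast)
qed

lemma smooth_map_open_preimage: "smooth_map A B F \<Longrightarrow> open U \<Longrightarrow> open (F -` U)"
  by (auto simp: smooth_map_def intro: open_vimage)

definition smooth_near where
  "smooth_near A B F p \<longleftrightarrow> (\<exists>c\<in>A. \<exists>c'\<in>B. \<exists>U. open U \<and> p \<in> U \<and> U \<subseteq> dom c \<and> F ` U \<subseteq> dom c' \<and>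
    smooth_on (crd c ` U) (\<lambda>u. crd c' (F (inv_crd c u))))"

lemma smooth_nearI:
  assumes "c \<in> A" "c' \<in> B" "open U" "p \<in> U" "U \<subseteq> dom c" "\<And>q. q \<in> U \<Longrightarrow> F q \<in> dom c'"
    "smooth_on (crd c ` U) (\<lambda>u. crd c' (F (inv_crd c u)))"
  shows "smooth_near A B F p"
  using assms unfolding smooth_near_def by blast

text \<open>One pair of charts around each point suffices: on an overlap the representative in any
  other pair arises by composing with the smooth transition maps on both sides.\<close>

lemma smooth_mapI:
  assumes A: "smooth_atlas A" and B: "smooth_atlas B" and loc: "\<And>p. smooth_near A B F p"
  shows "smooth_map A B F"
  unfolding smooth_map_def
proof (intro conjI ballI)
  have "\<exists>U. open U \<and> p \<in> U \<and> continuous_on U F" for p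
  proof -
    obtain c c' U where c: "c \<in> A" "c' \<in> B" "open U" "p \<in> U" "U \<subseteq> dom c" "F ` U \<subseteq> dom c'"
      "smooth_on (crd c ` U) (\<lambda>u. crd c' (F (inv_crd c u)))"
      using loc unfolding smooth_near_def by meson
    have ch: "is_chart c" "is_chart c'"
      using c A B smooth_atlasD by blast+
    have "continuous_on U (\<lambda>q. crd c' (F (inv_crd c (crd c q))))"
      by (rule continuous_on_compose2[OF smooth_on_continuous[OF c(7)] continuous_on_subset[OF continuous_on_crd[OF ch(1)] c(5)]]) auto
    then have "continuous_on U (\<lambda>q. inv_crd c' (crd c' (F (inv_crd c (crd c q)))))"
      by (rule continuous_on_compose2[OF continuous_on_inv_crd[OF ch(2)]])
        (use c(5,6) ch in \<open>auto simp: subset_iff image_subset_iff\<close>)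
    then have "continuous_on U F"
      by (rule continuous_on_eq) (use c(5,6) ch in \<open>auto simp: subset_iff image_subset_iff\<close>)
    then show ?thesis
      using c(3,4) by blast
  qed
  then obtain U where "open (U p)" "p \<in> U p" "continuous_on (U p) F" for p
    by metis
  moreover from this have "(\<Union>p. U p) = UNIV"
    by blast
  ultimately show cont: "continuous_on UNIV F"
    using continuous_on_open_UN[of UNIV U F] by simp
  fix d d'
  assume d: "d \<in> A" "d' \<in> B"
  have chd: "is_chart d" "is_chart d'"
    using d A B smooth_atlasD by blast+
  show "smooth_on (crd d ` (dom d \<inter> F -` dom d')) (crd d' \<circ> F \<circ> inv_crd d)"
  proof (rule smooth_on_local)
    fix x
    assume "x \<in> crd d ` (dom d \<inter> F -` dom d')"
    then obtain p where p: "p \<in> dom d" "F p \<in> dom d'" "x = crd d p"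
      by blast
    obtain c c' U where c: "c \<in> A" "c' \<in> B" "open U" "p \<in> U" "U \<subseteq> dom c" "F ` U \<subseteq> dom c'"
      "smooth_on (crd c ` U) (\<lambda>u. crd c' (F (inv_crd c u)))"
      using loc unfolding smooth_near_def by meson
    have ch: "is_chart c" "is_chart c'"
      using c A B smooth_atlasD by blast+
    define V where "V = U \<inter> dom d \<inter> F -` dom d'"
    have V: "open V" "p \<in> V" "V \<subseteq> dom d" "V \<subseteq> dom c" "F ` V \<subseteq> dom c' \<inter> dom d'"
      using c p cont chd by (auto simp: V_def intro!: open_Int is_chart_open open_vimage)
    have o: "open (crd d ` V)"
      using V chd by (intro open_crd_image)
    have 1: "smooth_on (crd d ` V) (\<lambda>u. crd c (inv_crd d u))"
      using smooth_transition[OF A d(1) c(1)] V by (auto intro: smooth_on_subset)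
    have 2: "smooth_on (crd d ` V) (\<lambda>u. crd c' (F (inv_crd c (crd c (inv_crd d u)))))"
      by (rule smooth_on_compose[OF o _ c(7) 1]) (use chd V_def V in auto)
    have 3: "smooth_on (crd d ` V) (\<lambda>u. crd d' (inv_crd c' (crd c' (F (inv_crd c (crd c (inv_crd d u)))))))"
      by (rule smooth_on_compose[OF o _ smooth_transition[OF B c(2) d(2)] 2])
        (use chd ch V in \<open>auto simp: subset_iff image_subset_iff\<close>)
    have "smooth_on (crd d ` V) (crd d' \<circ> F \<circ> inv_crd d)"
    proof (subst smooth_on_cong[OF o])
      show "(crd d' \<circ> F \<circ> inv_crd d) x = crd d' (inv_crd c' (crd c' (F (inv_crd c (crd c (inv_crd d x))))))"
        if "x \<in> crd d ` V" for x
        using that chd ch V by (auto simp: image_subset_iff subset_iff)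
    qed (fact 3)
    then show "\<exists>U. open U \<and> x \<in> U \<and> smooth_on U (crd d' \<circ> F \<circ> inv_crd d)"
      using o p V(2) by blast
  qed
qed

lemma smooth_map_compose:
  assumes A: "smooth_atlas A" and B: "smooth_atlas B" and C: "smooth_atlas C"
    and F: "smooth_map A B F" and H: "smooth_map B C H"
  shows "smooth_map A C (\<lambda>x. H (F x))"
proof (rule smooth_mapI[OF A C])
  fix p
  obtain c c' c'' where c: "c \<in> A" "p \<in> dom c" "c' \<in> B" "F p \<in> dom c'" "c'' \<in> C" "H (F p) \<in> dom c''"
    using smooth_atlasD(2) A B C by metis
  have ch: "is_chart c" "is_chart c'" "is_chart c''"
    using c A B C smooth_atlasD by blast+
  define V where "V = dom c' \<inter> H -` dom c''"
  define U where "U = dom c \<inter> F -` V"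
  have o: "open U" "open V"
    using ch F H by (auto simp: U_def V_def intro!: is_chart_open smooth_map_open_preimage)
  have o': "open (crd c ` U)"
    using o ch by (intro open_crd_image) (auto simp: U_def)
  have 1: "smooth_on (crd c ` U) (\<lambda>u. crd c' (F (inv_crd c u)))"
    using c by (intro smooth_mapD[OF F]) (auto simp: U_def V_def)
  have 2: "smooth_on (crd c' ` V) (\<lambda>u. crd c'' (H (inv_crd c' u)))"
    using c by (intro smooth_mapD[OF H]) (auto simp: V_def)
  have 3: "smooth_on (crd c ` U) (\<lambda>u. crd c'' (H (inv_crd c' (crd c' (F (inv_crd c u))))))"
    by (rule smooth_on_compose[OF o' _ 2 1]) (use ch in \<open>auto simp: U_def V_def\<close>)
  have "smooth_on (crd c ` U) (\<lambda>u. crd c'' (H (F (inv_crd c u))))"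
    by (rule smooth_on_cong[OF o', THEN iffD1, OF _ 3]) (use ch in \<open>auto simp: U_def V_def\<close>)
  moreover have "p \<in> U"
    using c by (auto simp: U_def V_def)
  ultimately show "smooth_near A C (\<lambda>x. H (F x)) p"
    using c o by (intro smooth_nearI[of c A c'' C U]) (auto simp: U_def V_def)
qed

lemma smooth_map_Pair:
  assumes A: "smooth_atlas A" and B: "smooth_atlas B" and C: "smooth_atlas C"
    and F: "smooth_map A B F" and H: "smooth_map A C H"
  shows "smooth_map A (prod_atlas B C) (\<lambda>x. (F x, H x))"
proof (rule smooth_mapI[OF A smooth_atlas_prod[OF B C]])
  fix p
  obtain c c' c'' where c: "c \<in> A" "p \<in> dom c" "c' \<in> B" "F p \<in> dom c'" "c'' \<in> C" "H p \<in> dom c''"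
    using smooth_atlasD(2) A B C by metis
  have ch: "is_chart c" "is_chart c'" "is_chart c''"
    using c A B C smooth_atlasD by blast+
  define U where "U = dom c \<inter> F -` dom c' \<inter> H -` dom c''"
  have o: "open U"
    using ch F H by (auto simp: U_def intro!: is_chart_open smooth_map_open_preimage)
  have "smooth_on (crd c ` U) (\<lambda>u. (crd c' (F (inv_crd c u)), crd c'' (H (inv_crd c u))))"
    using c o ch by (intro smooth_on_Pair open_crd_image smooth_mapD[OF F] smooth_mapD[OF H]) (auto simp: U_def)
  then show "smooth_near A (prod_atlas B C) (\<lambda>x. (F x, H x)) p"
    using c o by (intro smooth_nearI[of c A "prod_chart c' c''" _ U]) (auto simp: U_def prod_atlas_iff)
qed

lemma smooth_map_ident:
  assumes "smooth_atlas A"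
  shows "smooth_map A A (\<lambda>x. x)"
proof (rule smooth_mapI[OF assms assms])
  fix p
  obtain c where c: "c \<in> A" "p \<in> dom c"
    using smooth_atlasD(2)[OF assms] by blast
  have ch: "is_chart c"
    using c assms smooth_atlasD by blast
  have "smooth_on (crd c ` dom c) (\<lambda>u. crd c (inv_crd c u))"
    by (rule smooth_on_cong[OF open_crd_image[OF ch is_chart_open(1)[OF ch] subset_refl], THEN iffD1, OF _ smooth_on_ident])
      (use ch in auto)
  then show "smooth_near A A (\<lambda>x. x) p"
    using c is_chart_open(1)[OF ch] by (intro smooth_nearI[of c A c A "dom c"]) auto
qed

lemma smooth_map_const:
  assumes "smooth_atlas A" "smooth_atlas B"
  shows "smooth_map A B (\<lambda>x. q)"
proof (rule smooth_mapI[OF assms])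
  fix p
  obtain c c' where c: "c \<in> A" "p \<in> dom c" "c' \<in> B" "q \<in> dom c'"
    using smooth_atlasD(2) assms by metis
  have "open (dom c)"
    using c assms smooth_atlasD(1) is_chart_open(1) by blast
  then show "smooth_near A B (\<lambda>x. q) p"
    using c by (intro smooth_nearI[of c A c' B "dom c"]) (auto intro: smooth_on_const)
qed

lemma smooth_map_fst:
  assumes A: "smooth_atlas A" and B: "smooth_atlas B"
  shows "smooth_map (prod_atlas A B) A fst"
proof (rule smooth_mapI[OF smooth_atlas_prod[OF assms] A])
  fix p
  obtain c c' where c: "c \<in> A" "fst p \<in> dom c" "c' \<in> B" "snd p \<in> dom c'"
    using smooth_atlasD(2) assms by metis
  have ch: "is_chart c" "is_chart c'"
    using c assms smooth_atlasD by blast+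
  have "smooth_on (img c \<times> img c') (\<lambda>u. crd c (fst (inv_crd (prod_chart c c') u)))"
    by (rule smooth_on_cong[OF open_Times[OF is_chart_open(2)[OF ch(1)] is_chart_open(2)[OF ch(2)]], THEN iffD1,
          OF _ smooth_on_bounded_linear[OF bounded_linear_fst]]) (use ch in auto)
  then have "smooth_on (crd (prod_chart c c') ` (dom c \<times> dom c')) (\<lambda>u. crd c (fst (inv_crd (prod_chart c c') u)))"
    by (metis dom_prod_chart img_def img_prod_chart)
  then show "smooth_near (prod_atlas A B) A fst p"
    using c ch by (intro smooth_nearI[of "prod_chart c c'" _ c A "dom c \<times> dom c'"])
      (auto simp: prod_atlas_iff mem_Times_iff intro!: open_Times is_chart_open)
qed

lemma smooth_map_snd:
  assumes A: "smooth_atlas A" and B: "smooth_atlas B"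
  shows "smooth_map (prod_atlas A B) B snd"
proof (rule smooth_mapI[OF smooth_atlas_prod[OF assms] B])
  fix p
  obtain c c' where c: "c \<in> A" "fst p \<in> dom c" "c' \<in> B" "snd p \<in> dom c'"
    using smooth_atlasD(2) assms by metis
  have ch: "is_chart c" "is_chart c'"
    using c assms smooth_atlasD by blast+
  have "smooth_on (img c \<times> img c') (\<lambda>u. crd c' (snd (inv_crd (prod_chart c c') u)))"
    by (rule smooth_on_cong[OF open_Times[OF is_chart_open(2)[OF ch(1)] is_chart_open(2)[OF ch(2)]], THEN iffD1,
          OF _ smooth_on_bounded_linear[OF bounded_linear_snd]]) (use ch in auto)
  then have "smooth_on (crd (prod_chart c c') ` (dom c \<times> dom c')) (\<lambda>u. crd c' (snd (inv_crd (prod_chart c c') u)))"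
    by (metis dom_prod_chart img_def img_prod_chart)
  then show "smooth_near (prod_atlas A B) B snd p"
    using c ch by (intro smooth_nearI[of "prod_chart c c'" _ c' B "dom c \<times> dom c'"])
      (auto simp: prod_atlas_iff mem_Times_iff intro!: open_Times is_chart_open)
qed

section \<open>Maps with values in a Euclidean space, and local representatives on products\<close>

lemma smooth_map_euclidean_iff:
  assumes A: "smooth_atlas A"
  shows "smooth_map A {id_chart} f \<longleftrightarrow> (\<forall>c\<in>A. smooth_on (img c) (\<lambda>u. f (inv_crd c u)))"
proof
  assume "smooth_map A {id_chart} f"
  then show "\<forall>c\<in>A. smooth_on (img c) (\<lambda>u. f (inv_crd c u))"
    using smooth_mapD[of A "{id_chart}" f _ id_chart "dom _"] by (fastforce simp: img_def)
next
  assume R: "\<forall>c\<in>A. smooth_on (img c) (\<lambda>u. f (inv_crd c u))"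
  show "smooth_map A {id_chart} f"
  proof (rule smooth_mapI[OF A smooth_atlas_id])
    fix p
    obtain c where c: "c \<in> A" "p \<in> dom c"
      using smooth_atlasD(2)[OF A] by blast
    then show "smooth_near A {id_chart} f p"
      using R smooth_atlasD(1)[OF A c(1)]
      by (intro smooth_nearI[of c A id_chart _ "dom c"]) (auto simp: is_chart_open simp flip: img_def)
  qed
qed

lemma smooth_map_euclidean:
  "smooth_map {id_chart} {id_chart} f \<longleftrightarrow> smooth_on UNIV f"
  by (simp add: smooth_map_euclidean_iff)

lemma open_img: "smooth_atlas A \<Longrightarrow> c \<in> A \<Longrightarrow> open (img c)"
  using smooth_atlasD(1) is_chart_open(2) by blast

lemma smooth_map_linear:
  assumes A: "smooth_atlas A" and L: "bounded_linear L" "smooth_map A {id_chart} f"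
  shows "smooth_map A {id_chart} (\<lambda>x. L (f x))"
  using assms(2-) open_img[OF A] unfolding smooth_map_euclidean_iff[OF A]
  by (intro ballI, intro smooth_on_linear_compose[of L]) auto

lemma smooth_map_bilinear:
  assumes A: "smooth_atlas A" and B: "bounded_bilinear B" "smooth_map A {id_chart} f" "smooth_map A {id_chart} g"
  shows "smooth_map A {id_chart} (\<lambda>x. B (f x) (g x))"
  using assms(2-) open_img[OF A] unfolding smooth_map_euclidean_iff[OF A]
  by (intro ballI, intro smooth_on_bilinear[of B]) auto

lemma smooth_map_add:
  assumes A: "smooth_atlas A" and "smooth_map A {id_chart} f" "smooth_map A {id_chart} g"
  shows "smooth_map A {id_chart} (\<lambda>x. f x + g x)"
  using assms(2-) open_img[OF A] unfolding smooth_map_euclidean_iff[OF A]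
  by (intro ballI, intro smooth_on_add) auto

lemma smooth_map_sum:
  assumes A: "smooth_atlas A" and "\<And>i. i \<in> I \<Longrightarrow> smooth_map A {id_chart} (f i)"
  shows "smooth_map A {id_chart} (\<lambda>x. \<Sum>i\<in>I. f i x)"
  using assms(2-) open_img[OF A] unfolding smooth_map_euclidean_iff[OF A]
  by (intro ballI, intro smooth_on_sum) auto

text \<open>Written with the two chart inverses side by side instead of \<open>prod_chart\<close>,
  so that the lemmas on partial derivatives apply directly. \<open>W\<close> is open as the image of
  an open set under the product chart.\<close>

lemma smooth_map_prod_rep:
  assumes A: "smooth_atlas A" and B: "smooth_atlas B" and C: "smooth_atlas C"
    and F: "smooth_map (prod_atlas A B) C F" and c: "c \<in> A" "d \<in> B" "e \<in> C"
  defines "W \<equiv> {z \<in> img c \<times> img d. F (inv_crd c (fst z), inv_crd d (snd z)) \<in> dom e}"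
  shows "open W" "smooth_on W (\<lambda>z. crd e (F (inv_crd c (fst z), inv_crd d (snd z))))"
proof -
  have ch: "is_chart c" "is_chart d" "is_chart e"
    using c A B C smooth_atlasD by blast+
  define U where "U = (dom c \<times> dom d) \<inter> F -` dom e"
  have "open U"
    using ch F by (auto simp: U_def intro!: open_Int open_Times is_chart_open smooth_map_open_preimage)
  have W: "W = crd (prod_chart c d) ` U"
  proof (intro set_eqI iffI)
    fix z
    assume "z \<in> W"
    then have "z = crd (prod_chart c d) (inv_crd c (fst z), inv_crd d (snd z))"
      "(inv_crd c (fst z), inv_crd d (snd z)) \<in> U"
      using ch by (auto simp: W_def U_def)
    then show "z \<in> crd (prod_chart c d) ` U"
      by blast
  qed (use ch in \<open>auto simp: W_def U_def\<close>)
  show "open W"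
    unfolding W using \<open>open U\<close> by (intro open_crd_image is_chart_prod ch) (auto simp: U_def)
  have "smooth_on W (\<lambda>z. crd e (F (inv_crd (prod_chart c d) z)))"
    unfolding W using c by (intro smooth_mapD[OF F]) (auto simp: U_def prod_atlas_iff)
  then show "smooth_on W (\<lambda>z. crd e (F (inv_crd c (fst z), inv_crd d (snd z))))"
    by (rule smooth_on_cong[OF \<open>open W\<close>, THEN iffD1, rotated]) (use ch in \<open>auto simp: W_def\<close>)
qed

lemma smooth_map_partial:
  assumes A: "smooth_atlas A" and B: "smooth_atlas B"
    and F: "smooth_map (prod_atlas A B) {id_chart} F" and d: "d \<in> B" "v \<in> img d"
  shows "smooth_map A {id_chart} (\<lambda>p. frechet_derivative (\<lambda>v. F (p, inv_crd d v)) (at v) y)"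
  unfolding smooth_map_euclidean_iff[OF A]
proof
  fix c
  assume c: "c \<in> A"
  have ch: "is_chart c" "is_chart d"
    using c d A B smooth_atlasD by blast+
  have "smooth_on (img c \<times> img d) (\<lambda>z. F (inv_crd c (fst z), inv_crd d (snd z)))"
    using smooth_map_prod_rep(2)[OF A B smooth_atlas_id F c d(1), of id_chart] by (auto simp: Times_eq_image_sum)
  from smooth_on_partial_along[OF this is_chart_open(2)[OF ch(1)] smooth_on_const[of _ v]]
  show "smooth_on (img c) (\<lambda>u. frechet_derivative (\<lambda>v. F (inv_crd c u, inv_crd d v)) (at v) y)"
    using d by simp
qed

section \<open>Differentials of maps read in charts\<close>

definition chart_deriv :: "('m, 'e::euclidean_space) chart \<Rightarrow> ('n, 'f::euclidean_space) chart \<Rightarrow> ('m \<Rightarrow> 'n) \<Rightarrow> 'm \<Rightarrow> 'e \<Rightarrow> 'f" where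
  "chart_deriv c c' F p = frechet_derivative (\<lambda>u. crd c' (F (inv_crd c u))) (at (crd c p))"

lemma smooth_map_rep_at:
  assumes A: "smooth_atlas A" and B: "smooth_atlas B" and F: "smooth_map A B F"
    and c: "c \<in> A" "c' \<in> B" "p \<in> dom c" "F p \<in> dom c'"
  obtains U where "open U" "crd c p \<in> U" "U \<subseteq> img c" "\<And>u. u \<in> U \<Longrightarrow> F (inv_crd c u) \<in> dom c'"
    "smooth_on U (\<lambda>u. crd c' (F (inv_crd c u)))"
proof
  have ch: "is_chart c" "is_chart c'"
    using c A B smooth_atlasD by blast+
  let ?V = "dom c \<inter> F -` dom c'"
  show "open (crd c ` ?V)"
    using ch F by (intro open_crd_image open_Int is_chart_open smooth_map_open_preimage) auto
  show "crd c p \<in> crd c ` ?V" "crd c ` ?V \<subseteq> img c"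
    using c by (auto simp: img_def)
  show "F (inv_crd c u) \<in> dom c'" if "u \<in> crd c ` ?V" for u
    using that ch by auto
  show "smooth_on (crd c ` ?V) (\<lambda>u. crd c' (F (inv_crd c u)))"
    using c by (intro smooth_mapD[OF F]) auto
qed

lemma chart_deriv_works:
  assumes "smooth_atlas A" "smooth_atlas B" "smooth_map A B F" "c \<in> A" "c' \<in> B" "p \<in> dom c" "F p \<in> dom c'"
  shows "((\<lambda>u. crd c' (F (inv_crd c u))) has_derivative chart_deriv c c' F p) (at (crd c p))"
  using smooth_map_rep_at[OF assms] smooth_on_has_derivative unfolding chart_deriv_def by metis

lemma linear_chart_deriv:
  assumes "smooth_atlas A" "smooth_atlas B" "smooth_map A B F" "c \<in> A" "c' \<in> B" "p \<in> dom c" "F p \<in> dom c'"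
  shows "linear (chart_deriv c c' F p)"
  using has_derivative_linear[OF chart_deriv_works[OF assms]] .

lemma chart_deriv_compose:
  assumes A: "smooth_atlas A" and B: "smooth_atlas B" and C: "smooth_atlas C"
    and F: "smooth_map A B F" and H: "smooth_map B C H"
    and c: "c \<in> A" "c' \<in> B" "c'' \<in> C" "p \<in> dom c" "F p \<in> dom c'" "H (F p) \<in> dom c''"
  shows "chart_deriv c c'' (\<lambda>x. H (F x)) p v = chart_deriv c' c'' H (F p) (chart_deriv c c' F p v)"
proof -
  have ch: "is_chart c" "is_chart c'"
    using c A B smooth_atlasD by blast+
  obtain U where U: "open U" "crd c p \<in> U" "U \<subseteq> img c" "\<And>u. u \<in> U \<Longrightarrow> F (inv_crd c u) \<in> dom c'"
    using smooth_map_rep_at[OF A B F c(1,2,4,5)] by metis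
  have 1: "((\<lambda>u. crd c' (F (inv_crd c u))) has_derivative chart_deriv c c' F p) (at (crd c p))"
    by (rule chart_deriv_works[OF A B F c(1,2,4,5)])
  have 2: "((\<lambda>w. crd c'' (H (inv_crd c' w))) has_derivative chart_deriv c' c'' H (F p)) (at (crd c' (F p)))"
    by (rule chart_deriv_works[OF B C H c(2,3,5,6)])
  have "((\<lambda>u. crd c'' (H (inv_crd c' (crd c' (F (inv_crd c u)))))) has_derivative
      (\<lambda>v. chart_deriv c' c'' H (F p) (chart_deriv c c' F p v))) (at (crd c p))"
    by (rule has_derivative_compose[OF 1]) (use 2 ch c in simp)
  then have "((\<lambda>u. crd c'' (H (F (inv_crd c u)))) has_derivative
      (\<lambda>v. chart_deriv c' c'' H (F p) (chart_deriv c c' F p v))) (at (crd c p))"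
    by (rule has_derivative_transform_within_open[OF _ U(1,2)]) (use U(4) ch in simp)
  then show ?thesis
    unfolding chart_deriv_def[of c c''] by (simp flip: frechet_derivative_at)
qed

lemma chart_deriv_ident:
  assumes "is_chart c" "p \<in> dom c"
  shows "chart_deriv c c (\<lambda>x. x) p v = v"
proof -
  have "((\<lambda>u. crd c (inv_crd c u)) has_derivative (\<lambda>v. v)) (at (crd c p))"
    by (rule has_derivative_transform_within_open[OF has_derivative_ident is_chart_open(2)[OF assms(1)]])
      (use assms in auto)
  then show ?thesis
    unfolding chart_deriv_def by (simp flip: frechet_derivative_at)
qed

lemma chart_deriv_prod:
  assumes A: "smooth_atlas A" and B: "smooth_atlas B" and C: "smooth_atlas C"
    and F: "smooth_map (prod_atlas A B) C F"
    and c: "c \<in> A" "d \<in> B" "e \<in> C" "p \<in> dom c" "q \<in> dom d" "F (p, q) \<in> dom e"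
  shows "chart_deriv (prod_chart c d) e F (p, q) (x, y)
       = chart_deriv c e (\<lambda>p. F (p, q)) p x + chart_deriv d e (\<lambda>q. F (p, q)) q y"
proof -
  have ch: "is_chart c" "is_chart d"
    using c A B smooth_atlasD by blast+
  define W where "W = {z \<in> img c \<times> img d. F (inv_crd c (fst z), inv_crd d (snd z)) \<in> dom e}"
  define f where "f z = crd e (F (inv_crd c (fst z), inv_crd d (snd z)))" for z
  have W: "open W" "smooth_on W f"
    unfolding W_def f_def by (rule smooth_map_prod_rep[OF A B C F c(1,2,3)])+
  have pq: "(crd c p, crd d q) \<in> W"
    using c ch by (simp add: W_def)
  have D: "(f has_derivative frechet_derivative f (at (crd c p, crd d q))) (at (crd c p, crd d q))"
    by (rule smooth_on_has_derivative[OF W(2) pq])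
  have "((\<lambda>z. crd e (F (inv_crd (prod_chart c d) z))) has_derivative
      frechet_derivative f (at (crd c p, crd d q))) (at (crd c p, crd d q))"
    by (rule has_derivative_transform_within_open[OF D W(1) pq]) (use ch in \<open>auto simp: W_def f_def\<close>)
  then have "chart_deriv (prod_chart c d) e F (p, q) (x, y) = frechet_derivative f (at (crd c p, crd d q)) (x, y)"
    unfolding chart_deriv_def by (simp flip: frechet_derivative_at)
  also have "\<dots> = frechet_derivative f (at (crd c p, crd d q)) (x, 0) + frechet_derivative f (at (crd c p, crd d q)) (0, y)"
    by (simp flip: linear_add[OF has_derivative_linear[OF D]])
  also have "\<dots> = chart_deriv c e (\<lambda>p. F (p, q)) p x + chart_deriv d e (\<lambda>q. F (p, q)) q y"
    unfolding smooth_on_partial_fst(2)[OF W(2) pq, symmetric] smooth_on_partial_snd(2)[OF W(2) pq, symmetric]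
    using ch c by (simp add: chart_deriv_def f_def)
  finally show ?thesis .
qed

lemma smooth_map_chart_deriv_snd:
  assumes A: "smooth_atlas A" and B: "smooth_atlas B"
    and F: "smooth_map (prod_atlas A B) {id_chart} F" and d: "d \<in> B" "q \<in> dom d"
  shows "smooth_map A {id_chart} (\<lambda>p. chart_deriv d id_chart (\<lambda>q. F (p, q)) q y)"
  using smooth_map_partial[OF A B F d(1), of "crd d q" y] d by (simp add: chart_deriv_def)

lemma smooth_on_chart_deriv_snd:
  assumes A: "smooth_atlas A" and B: "smooth_atlas B" and C: "smooth_atlas C"
    and F: "smooth_map (prod_atlas A B) C F" and c: "c \<in> A" "d \<in> B" "e \<in> C"
    and s: "smooth_on (img c) (\<lambda>u. crd d (s (inv_crd c u)))"
    and "\<And>p. p \<in> dom c \<Longrightarrow> s p \<in> dom d \<and> F (p, s p) \<in> dom e"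
  shows "smooth_on (img c) (\<lambda>u. chart_deriv d e (\<lambda>q. F (inv_crd c u, q)) (s (inv_crd c u)) y)"
proof -
  have ch: "is_chart c" "is_chart d"
    using c A B smooth_atlasD by blast+
  from smooth_on_partial_along[OF smooth_map_prod_rep(2)[OF A B C F c] is_chart_open(2)[OF ch(1)] s]
  show ?thesis
    using assms(9) ch by (simp add: chart_deriv_def)
qed

text \<open>This is the form in which the symmetry of second derivatives is used on manifolds: left
  against right translation on the group, and base against fibre on the tangent bundle.\<close>

lemma chart_deriv_commute:
  assumes A: "smooth_atlas A" and B: "smooth_atlas B"
    and F: "smooth_map (prod_atlas A B) {id_chart} F" and c: "c \<in> A" "d \<in> B" "p \<in> dom c" "q \<in> dom d"
  shows "chart_deriv c id_chart (\<lambda>p. chart_deriv d id_chart (\<lambda>q. F (p, q) :: real) q y) p x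
       = chart_deriv d id_chart (\<lambda>q. chart_deriv c id_chart (\<lambda>p. F (p, q)) p x) q y"
proof -
  have ch: "is_chart c" "is_chart d"
    using c A B smooth_atlasD by blast+
  have W: "open (img c \<times> img d)" "(crd c p, crd d q) \<in> img c \<times> img d"
    using ch c by (auto intro: open_Times is_chart_open)
  have "smooth_on (img c \<times> img d) (\<lambda>z. F (inv_crd c (fst z), inv_crd d (snd z)))"
    using smooth_map_prod_rep(2)[OF A B smooth_atlas_id F c(1,2), of id_chart] by (auto simp: Times_eq_image_sum)
  from mixed_partials_commute[OF this W]
  show ?thesis
    by (simp add: chart_deriv_def)
qed

lemma smooth_map_slice_fst:
  assumes "smooth_atlas A" "smooth_atlas B" "smooth_atlas C" "smooth_map (prod_atlas A B) C F"
  shows "smooth_map A C (\<lambda>p. F (p, q))"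
  using smooth_map_compose[OF assms(1) smooth_atlas_prod[OF assms(1,2)] assms(3)
      smooth_map_Pair[OF assms(1,1,2) smooth_map_ident[OF assms(1)] smooth_map_const[OF assms(1,2)]] assms(4)] .

lemma smooth_map_slice_snd:
  assumes "smooth_atlas A" "smooth_atlas B" "smooth_atlas C" "smooth_map (prod_atlas A B) C F"
  shows "smooth_map B C (\<lambda>q. F (p, q))"
  using smooth_map_compose[OF assms(2) smooth_atlas_prod[OF assms(1,2)] assms(3)
      smooth_map_Pair[OF assms(2,1,2) smooth_map_const[OF assms(2,1)] smooth_map_ident[OF assms(2)]] assms(4)] .

text \<open>\<open>near_one\<close> recentres the base chart at \<open>0\<close>; this turns
  derivatives at \<open>0\<close> into chart derivatives at the unit.\<close>

lemma frechet_derivative_shift: "frechet_derivative (\<lambda>v. f (c + v)) (at 0) = frechet_derivative f (at c)"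
  for f :: "'a::real_normed_vector \<Rightarrow> 'b::real_normed_vector"
proof -
  have "((\<lambda>v. f (c + v)) has_derivative f') (at 0) \<longleftrightarrow> (f has_derivative f') (at c)" for f'
  proof
    assume a: "((\<lambda>v. f (c + v)) has_derivative f') (at 0)"
    have "((\<lambda>x. x - c) has_derivative (\<lambda>v. v)) (at c)"
      by (auto intro!: derivative_eq_intros)
    from has_derivative_compose[OF this, of "\<lambda>v. f (c + v)" f'] a
    show "(f has_derivative f') (at c)"
      by simp
  next
    assume a: "(f has_derivative f') (at c)"
    have "((\<lambda>v. c + v) has_derivative (\<lambda>v. v)) (at 0)"
      by (auto intro!: derivative_eq_intros)
    from has_derivative_compose[OF this, of f f'] a
    show "((\<lambda>v. f (c + v)) has_derivative f') (at 0)"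
      by simp
  qed
  then show ?thesis
    by (simp add: frechet_derivative_def)
qed

lemma blinfun_eq_sum_Basis: "blinfun_apply \<phi> x = (\<Sum>b\<in>Basis. (x \<bullet> b) * blinfun_apply \<phi> b)" for \<phi> :: "'e::euclidean_space \<Rightarrow>\<^sub>L real"
proof -
  have "blinfun_apply \<phi> x = blinfun_apply \<phi> (\<Sum>b\<in>Basis. (x \<bullet> b) *\<^sub>R b)"
    by (simp add: euclidean_representation)
  then show ?thesis
    by (simp add: blinfun.sum_right blinfun.scaleR_right del: euclidean_representation)
qed

lemma blinfun_Basis_expansion: "\<phi> = (\<Sum>b\<in>Basis. blinfun_apply \<phi> b *\<^sub>R blinfun_inner_left b)"
  for \<phi> :: "'e::euclidean_space \<Rightarrow>\<^sub>L real"
  by (rule blinfun_eqI)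
    (subst blinfun_eq_sum_Basis, simp add: blinfun.sum_left blinfun.scaleR_left blinfun_inner_left.rep_eq mult.commute inner_commute)

section \<open>Calculus on Lie groups\<close>

locale Lie_group =
  fixes K :: "('g::{t2_space,second_countable_topology}, 'e::euclidean_space) lie_group_data"
  assumes lie_group: "lie_group K"
begin

abbreviation mul (infixl "\<cdot>" 70) where "a \<cdot> b \<equiv> mult K a b"
abbreviation "inverse_of \<equiv> ginv K"
abbreviation "L x f g \<equiv> left_field K x f g"
abbreviation "bc \<equiv> base_chart K"

lemma atlas: "smooth_atlas (atlas K)" and base_chart: "bc \<in> atlas K" and one_in_base: "one K \<in> dom bc"
  and mul_assoc: "(a \<cdot> b) \<cdot> c = a \<cdot> (b \<cdot> c)" and mul_one [simp]: "one K \<cdot> a = a" "a \<cdot> one K = a"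
  and mul_inverse [simp]: "inverse_of a \<cdot> a = one K" "a \<cdot> inverse_of a = one K"
  using lie_group unfolding lie_group_def by blast+

lemma mul_inverse_cancel [simp]: "inverse_of a \<cdot> (a \<cdot> b) = b" "a \<cdot> (inverse_of a \<cdot> b) = b"
  by (simp_all flip: mul_assoc)

lemma inverse_unique: "a \<cdot> b = one K \<Longrightarrow> b = inverse_of a"
  by (metis mul_inverse_cancel(1) mul_one(2))

lemma inverse_one [simp]: "inverse_of (one K) = one K"
  using inverse_unique[of "one K" "one K"] by simp

lemma inverse_inverse [simp]: "inverse_of (inverse_of a) = a"
  using inverse_unique[of "inverse_of a" a] by simp

lemma inverse_mul: "inverse_of (a \<cdot> b) = inverse_of b \<cdot> inverse_of a"
  using inverse_unique[of "a \<cdot> b" "inverse_of b \<cdot> inverse_of a"] by (simp add: mul_assoc)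

lemma base: "is_chart bc"
  using atlas base_chart smooth_atlasD(1) by blast

lemma smooth_mul:
  assumes "smooth_atlas M" "smooth_map M (atlas K) f" "smooth_map M (atlas K) h"
  shows "smooth_map M (atlas K) (\<lambda>x. f x \<cdot> h x)"
proof -
  have "smooth_map (prod_atlas (atlas K) (atlas K)) (atlas K) (\<lambda>(a, b). a \<cdot> b)"
    using lie_group by (simp add: lie_group_def)
  from smooth_map_compose[OF assms(1) smooth_atlas_prod[OF atlas atlas] atlas
      smooth_map_Pair[OF assms(1) atlas atlas assms(2,3)] this]
  show ?thesis
    by simp
qed

lemma smooth_inverse:
  assumes "smooth_atlas M" "smooth_map M (atlas K) f"
  shows "smooth_map M (atlas K) (\<lambda>x. inverse_of (f x))"
proof -
  have "smooth_map (atlas K) (atlas K) inverse_of"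
    using lie_group by (simp add: lie_group_def)
  from smooth_map_compose[OF assms(1) atlas atlas assms(2) this]
  show ?thesis .
qed

lemmas smooth_ident = smooth_map_ident[OF atlas]
lemmas atlas2 = smooth_atlas_prod[OF atlas atlas]
lemmas smooth_fst = smooth_map_fst[OF atlas atlas]
lemmas smooth_snd = smooth_map_snd[OF atlas atlas]

lemma smooth_translate: "smooth_map (atlas K) (atlas K) (\<lambda>h. g \<cdot> h)" "smooth_map (atlas K) (atlas K) (\<lambda>h. h \<cdot> g)"
  by (intro smooth_mul atlas smooth_map_const smooth_ident)+

lemma Cinf_iff: "f \<in> Cinf K \<longleftrightarrow> smooth_map (atlas K) {id_chart} f"
  by (simp add: Cinf_def)

lemma Cinf_const [simp]: "(\<lambda>g. r) \<in> Cinf K"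
  by (simp add: Cinf_iff smooth_map_const[OF atlas])

lemma Cinf_add: "f \<in> Cinf K \<Longrightarrow> h \<in> Cinf K \<Longrightarrow> (\<lambda>g. f g + h g) \<in> Cinf K"
  by (simp add: Cinf_iff smooth_map_add[OF atlas])

lemma Cinf_mult: "f \<in> Cinf K \<Longrightarrow> h \<in> Cinf K \<Longrightarrow> (\<lambda>g. f g * h g) \<in> Cinf K"
  by (simp add: Cinf_iff smooth_map_bilinear[OF atlas bounded_bilinear_mult])

lemma Cinf_minus: "f \<in> Cinf K \<Longrightarrow> (\<lambda>g. - f g) \<in> Cinf K"
  using Cinf_mult[of "\<lambda>_. -1" f] by simp

lemma Cinf_diff: "f \<in> Cinf K \<Longrightarrow> h \<in> Cinf K \<Longrightarrow> (\<lambda>g. f g - h g) \<in> Cinf K"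
  using Cinf_add[OF _ Cinf_minus] by simp

lemma Cinf_sum: "(\<And>i. i \<in> I \<Longrightarrow> f i \<in> Cinf K) \<Longrightarrow> (\<lambda>g. \<Sum>i\<in>I. f i g) \<in> Cinf K"
  by (simp add: Cinf_iff smooth_map_sum[OF atlas])

lemma Cinf_translate: "f \<in> Cinf K \<Longrightarrow> (\<lambda>h. f (g \<cdot> h)) \<in> Cinf K" "f \<in> Cinf K \<Longrightarrow> (\<lambda>h. f (h \<cdot> g)) \<in> Cinf K"
  unfolding Cinf_iff by (rule smooth_map_compose[OF atlas atlas smooth_atlas_id smooth_translate(1)], assumption)
    (rule smooth_map_compose[OF atlas atlas smooth_atlas_id smooth_translate(2)], assumption)

text \<open>Translating \<open>f\<close> by \<open>g\<close> moves every computation to the unit,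
  where the single chart \<open>bc\<close> is available.\<close>

lemma left_diff_eq: "left_diff K f g = Blinfun (chart_deriv bc id_chart (\<lambda>h. f (g \<cdot> h)) (one K))"
  unfolding left_diff_def near_one_def chart_deriv_def
  by (subst frechet_derivative_shift[where f = "\<lambda>u. f (g \<cdot> inv_crd bc u)"]) simp

lemma left_diff_apply:
  assumes "f \<in> Cinf K"
  shows "blinfun_apply (left_diff K f g) = chart_deriv bc id_chart (\<lambda>h. f (g \<cdot> h)) (one K)"
proof -
  have "linear (chart_deriv bc id_chart (\<lambda>h. f (g \<cdot> h)) (one K))"
    using Cinf_translate(1)[OF assms] one_in_base base_chart
    by (intro linear_chart_deriv[OF atlas smooth_atlas_id]) (auto simp: Cinf_iff)
  then show ?thesis
    by (simp add: left_diff_eq bounded_linear_Blinfun_apply linear_conv_bounded_linear)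
qed

lemma L_eq: "f \<in> Cinf K \<Longrightarrow> L x f g = chart_deriv bc id_chart (\<lambda>h. f (g \<cdot> h)) (one K) x"
  by (simp add: left_field_def left_diff_apply)

lemma left_diff_has_derivative:
  assumes "f \<in> Cinf K"
  shows "((\<lambda>u. f (g \<cdot> inv_crd bc u)) has_derivative blinfun_apply (left_diff K f g)) (at (crd bc (one K)))"
  using chart_deriv_works[OF atlas smooth_atlas_id Cinf_translate(1)[OF assms, unfolded Cinf_iff] base_chart _ one_in_base, of id_chart]
  by (simp add: left_diff_apply[OF assms])

lemma left_diff_unique:
  assumes "((\<lambda>u. f (g \<cdot> inv_crd bc u)) has_derivative \<phi>) (at (crd bc (one K)))"
  shows "left_diff K f g = Blinfun \<phi>"
  unfolding left_diff_eq chart_deriv_def using frechet_derivative_at[OF assms] by simp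

lemma left_diff_translate: "left_diff K (\<lambda>k. f (g \<cdot> k)) h = left_diff K f (g \<cdot> h)"
  by (simp add: left_diff_eq mul_assoc)

lemma L_translate: "L x (\<lambda>k. f (g \<cdot> k)) h = L x f (g \<cdot> h)"
  by (simp add: left_field_def left_diff_translate)

text \<open>\<open>L x f g\<close> is a partial derivative, at \<open>h = one K\<close>, of the
  function \<open>f (g \<cdot> h)\<close>, which is smooth in both variables jointly.\<close>

lemma L_Cinf: "f \<in> Cinf K \<Longrightarrow> (\<lambda>g. L x f g) \<in> Cinf K"
proof -
  assume f: "f \<in> Cinf K"
  have "smooth_map (prod_atlas (atlas K) (atlas K)) {id_chart} (\<lambda>p. f (fst p \<cdot> snd p))"
    using f by (intro smooth_map_compose[OF atlas2 atlas smooth_atlas_id smooth_mul[OF atlas2 smooth_fst smooth_snd]])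
      (simp add: Cinf_iff)
  from smooth_map_chart_deriv_snd[OF atlas atlas this base_chart one_in_base]
  show ?thesis
    by (simp add: Cinf_iff L_eq[OF f])
qed

lemma left_diff_const [simp]: "left_diff K (\<lambda>g. r) g = 0"
  by (simp add: left_diff_def zero_blinfun_def)

lemma left_diff_add:
  assumes "f \<in> Cinf K" "h \<in> Cinf K"
  shows "left_diff K (\<lambda>g. f g + h g) g = left_diff K f g + left_diff K h g"
  using left_diff_unique[OF has_derivative_add[OF left_diff_has_derivative[OF assms(1)] left_diff_has_derivative[OF assms(2)]]]
  by (simp flip: plus_blinfun.rep_eq add: blinfun_apply_inverse)

lemma left_diff_mult:
  assumes "f \<in> Cinf K" "h \<in> Cinf K"
  shows "left_diff K (\<lambda>g. f g * h g) g = h g *\<^sub>R left_diff K f g + f g *\<^sub>R left_diff K h g"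
proof -
  have "((\<lambda>u. f (g \<cdot> inv_crd bc u) * h (g \<cdot> inv_crd bc u)) has_derivative
      blinfun_apply (h g *\<^sub>R left_diff K f g + f g *\<^sub>R left_diff K h g)) (at (crd bc (one K)))"
    by (rule has_derivative_eq_rhs[OF has_derivative_mult[OF left_diff_has_derivative[OF assms(1)] left_diff_has_derivative[OF assms(2)]]])
      (use base one_in_base in \<open>auto simp: fun_eq_iff blinfun.add_left blinfun.scaleR_left\<close>)
  from left_diff_unique[OF this] show ?thesis
    by (simp add: blinfun_apply_inverse)
qed

lemma left_diff_scale: "f \<in> Cinf K \<Longrightarrow> left_diff K (\<lambda>g. r * f g) g = r *\<^sub>R left_diff K f g"
  using left_diff_mult[of "\<lambda>g. r" f g] by simp

lemma left_diff_minus: "f \<in> Cinf K \<Longrightarrow> left_diff K (\<lambda>g. - f g) g = - left_diff K f g"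
  using left_diff_scale[of f "-1"] by simp

lemma left_diff_diff: "f \<in> Cinf K \<Longrightarrow> h \<in> Cinf K \<Longrightarrow> left_diff K (\<lambda>g. f g - h g) g = left_diff K f g - left_diff K h g"
  using left_diff_add[OF _ Cinf_minus, of f h] by (simp add: left_diff_minus)

lemma left_diff_sum:
  assumes "\<And>i. i \<in> I \<Longrightarrow> f i \<in> Cinf K"
  shows "left_diff K (\<lambda>g. \<Sum>i\<in>I. f i g) g = (\<Sum>i\<in>I. left_diff K (f i) g)"
  using assms
  by (induction I rule: infinite_finite_induct) (simp_all add: left_diff_add Cinf_sum)

lemma L_const [simp]: "L x (\<lambda>g. r) g = 0"
  by (simp add: left_field_def)

lemma L_add: "f \<in> Cinf K \<Longrightarrow> h \<in> Cinf K \<Longrightarrow> L x (\<lambda>g. f g + h g) g = L x f g + L x h g"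
  and L_diff: "f \<in> Cinf K \<Longrightarrow> h \<in> Cinf K \<Longrightarrow> L x (\<lambda>g. f g - h g) g = L x f g - L x h g"
  and L_mult: "f \<in> Cinf K \<Longrightarrow> h \<in> Cinf K \<Longrightarrow> L x (\<lambda>g. f g * h g) g = L x f g * h g + f g * L x h g"
  and L_scale: "f \<in> Cinf K \<Longrightarrow> L x (\<lambda>g. r * f g) g = r * L x f g"
  by (simp_all add: left_field_def left_diff_add left_diff_diff left_diff_mult left_diff_scale
      blinfun.add_left blinfun.diff_left blinfun.scaleR_left)

lemma L_sum: "(\<And>i. i \<in> I \<Longrightarrow> f i \<in> Cinf K) \<Longrightarrow> L x (\<lambda>g. \<Sum>i\<in>I. f i g) g = (\<Sum>i\<in>I. L x (f i) g)"
  by (simp add: left_field_def left_diff_sum blinfun.sum_left)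

lemma L_linear: "L (x + y) f g = L x f g + L y f g" "L (r *\<^sub>R x) f g = r * L x f g" "L (x - y) f g = L x f g - L y f g"
  "L (- x) f g = - L x f g" "L 0 f g = 0"
  by (simp_all add: left_field_def blinfun.add_right blinfun.scaleR_right blinfun.diff_right blinfun.minus_right)

lemma L_Basis: "L x f g = (\<Sum>b\<in>Basis. (x \<bullet> b) * L b f g)"
  unfolding left_field_def by (rule blinfun_eq_sum_Basis)

subsection \<open>Functions with prescribed differential\<close>

text \<open>Near the unit take the linear function \<open>\<phi>\<close> in the base chart, cut it
  off by a bump function, extend it by zero and translate the result to \<open>g\<close>.\<close>

lemma exists_left_diff: "\<exists>f\<in>Cinf K. left_diff K f g = \<phi>"
proof -
  let ?e = "crd bc (one K)"
  have "open (img bc)" "?e \<in> img bc"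
    using is_chart_open(2)[OF base] one_in_base by auto
  then obtain r where r: "r > 0" "cball ?e r \<subseteq> img bc"
    using open_contains_cball by blast
  define w where "w u = bump r (u - ?e) * blinfun_apply \<phi> (u - ?e)" for u
  define f where "f h = (if h \<in> dom bc then w (crd bc h) else 0)" for h
  have sub: "smooth_on UNIV (\<lambda>u. u - ?e)"
    using smooth_on_add[OF open_UNIV smooth_on_ident smooth_on_const[of UNIV "- ?e"]] by simp
  have w: "smooth_on UNIV w"
    unfolding w_def
    by (rule smooth_on_bilinear[OF bounded_bilinear_mult open_UNIV
          smooth_on_compose[OF open_UNIV subset_UNIV smooth_on_bump sub]
          smooth_on_linear_compose[OF blinfun.bounded_linear_right open_UNIV sub]])
  \<comment> \<open>Compactness of the closed ball passes to \<open>C\<close>, which is therefore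
    closed in the Hausdorff space. This makes the extension by zero smooth also at boundary points
    of the chart domain.\<close>
  define C where "C = inv_crd bc ` cball ?e r"
  have "compact C"
    unfolding C_def
    by (rule compact_continuous_image[OF continuous_on_subset[OF continuous_on_inv_crd[OF base] r(2)] compact_cball])
  then have "closed C"
    by (rule compact_imp_closed)
  have f0: "f h = 0" if "h \<notin> C" for h
  proof (cases "h \<in> dom bc")
    case True
    then have "crd bc h \<notin> cball ?e r"
      using that base unfolding C_def by (metis image_eqI inv_crd_crd)
    then have "norm (crd bc h - ?e) \<ge> r"
      by (simp add: dist_norm norm_minus_commute)
    then show ?thesis
      using r(1) by (simp add: f_def w_def bump_outside)
  qed (simp add: f_def)
  have f: "f \<in> Cinf K"
    unfolding Cinf_iff
  proof (rule smooth_mapI[OF atlas smooth_atlas_id])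
    fix p
    show "smooth_near (atlas K) {id_chart} f p"
    proof (cases "p \<in> dom bc")
      case True
      have "smooth_on (img bc) (\<lambda>u. f (inv_crd bc u))"
        by (rule smooth_on_cong[OF is_chart_open(2)[OF base], THEN iffD1, OF _ smooth_on_subset[OF w subset_UNIV]])
          (use base in \<open>simp add: f_def\<close>)
      then show ?thesis
        using True base_chart is_chart_open(1)[OF base]
        by (intro smooth_nearI[of bc _ id_chart _ "dom bc"]) (auto simp flip: img_def)
    next
      case False
      obtain c where c: "c \<in> atlas K" "p \<in> dom c"
        using smooth_atlasD(2)[OF atlas] by blast
      have ch: "is_chart c"
        using c atlas smooth_atlasD(1) by blast
      define U where "U = dom c - C"
      have "p \<notin> C"
        using False r(2) base inv_crd_in_dom unfolding C_def by blast
      then have U: "open U" "p \<in> U" "U \<subseteq> dom c"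
        using \<open>closed C\<close> is_chart_open(1)[OF ch] c by (auto simp: U_def)
      have "smooth_on (crd c ` U) (\<lambda>u. f (inv_crd c u))"
        by (rule smooth_on_cong[OF open_crd_image[OF ch U(1,3)], THEN iffD1, OF _ smooth_on_const[of _ 0]])
          (use ch f0 in \<open>auto simp: U_def\<close>)
      then show ?thesis
        using c U by (intro smooth_nearI[of c _ id_chart _ U]) auto
    qed
  qed
  \<comment> \<open>The linear factor vanishes at the centre, so the derivative of the bump drops
    out; the bump has the value one there, so exactly \<open>\<phi>\<close> remains.\<close>
  have Dw: "(w has_derivative blinfun_apply \<phi>) (at ?e)"
  proof -
    have 1: "((\<lambda>u. bump r (u - ?e)) has_derivative frechet_derivative (\<lambda>u. bump r (u - ?e)) (at ?e)) (at ?e)"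
      by (rule smooth_on_has_derivative[OF smooth_on_compose[OF open_UNIV subset_UNIV smooth_on_bump sub]]) simp
    have 2: "((\<lambda>u. blinfun_apply \<phi> (u - ?e)) has_derivative blinfun_apply \<phi>) (at ?e)"
      by (auto intro!: derivative_eq_intros)
    show ?thesis
      unfolding w_def by (rule has_derivative_eq_rhs[OF has_derivative_mult[OF 1 2]]) (simp add: bump_0 r(1))
  qed
  have "((\<lambda>u. f (inv_crd bc u)) has_derivative blinfun_apply \<phi>) (at ?e)"
    by (rule has_derivative_transform_within_open[OF Dw is_chart_open(2)[OF base]])
      (use base one_in_base in \<open>auto simp: f_def\<close>)
  then have "left_diff K f (one K) = \<phi>"
    using left_diff_unique[of f "one K" "blinfun_apply \<phi>"] by (simp add: blinfun_apply_inverse)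
  then have "left_diff K (\<lambda>h. f (inverse_of g \<cdot> h)) g = \<phi>"
    by (simp add: left_diff_translate)
  then show ?thesis
    using Cinf_translate(1)[OF f] by blast
qed

lemma L_separates: "(\<And>f. f \<in> Cinf K \<Longrightarrow> L x f g = L y f g) \<Longrightarrow> x = y"
proof -
  assume *: "\<And>f. f \<in> Cinf K \<Longrightarrow> L x f g = L y f g"
  have "blinfun_apply (blinfun_inner_left b) x = blinfun_apply (blinfun_inner_left b) y" for b
  proof -
    obtain f where "f \<in> Cinf K" "left_diff K f g = blinfun_inner_left b"
      using exists_left_diff by blast
    then show ?thesis
      using *[of f] by (simp add: left_field_def)
  qed
  then show "x = y"
    by (simp add: euclidean_eq_iff[of x] blinfun_inner_left.rep_eq)
qed

subsection \<open>The adjoint representation\<close>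

lemma smooth_conj: "smooth_map (atlas K) (atlas K) (\<lambda>h. g \<cdot> h \<cdot> inverse_of g)"
  by (intro smooth_mul atlas smooth_map_const smooth_ident)

lemma Ad_eq: "Ad K g = chart_deriv bc bc (\<lambda>h. g \<cdot> h \<cdot> inverse_of g) (one K)"
  unfolding Ad_def near_one_def chart_deriv_def
  by (subst frechet_derivative_shift[where f = "\<lambda>u. crd bc (g \<cdot> inv_crd bc u \<cdot> inverse_of g)"]) simp

lemma linear_Ad: "linear (Ad K g)"
  unfolding Ad_eq using one_in_base base_chart by (intro linear_chart_deriv[OF atlas atlas smooth_conj]) auto

lemma Ad_expand: "Ad K g y = (\<Sum>b\<in>Basis. (y \<bullet> b) *\<^sub>R Ad K g b)"
proof -
  have "Ad K g y = Ad K g (\<Sum>b\<in>Basis. (y \<bullet> b) *\<^sub>R b)"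
    by (simp add: euclidean_representation)
  then show ?thesis
    by (simp add: linear_sum[OF linear_Ad] linear_scale[OF linear_Ad] del: euclidean_representation)
qed

lemma Ad_one [simp]: "Ad K (one K) x = x"
  using chart_deriv_ident[OF base one_in_base] by (simp add: Ad_eq)

lemma Ad_mul: "Ad K (g \<cdot> h) x = Ad K g (Ad K h x)"
proof -
  have "chart_deriv bc bc (\<lambda>k. g \<cdot> (h \<cdot> k \<cdot> inverse_of h) \<cdot> inverse_of g) (one K) x = Ad K g (Ad K h x)"
    using chart_deriv_compose[OF atlas atlas atlas smooth_conj[of h] smooth_conj[of g] base_chart base_chart base_chart]
      one_in_base by (simp add: Ad_eq)
  then show ?thesis
    by (simp add: Ad_eq[of "g \<cdot> h"] inverse_mul mul_assoc)
qed

lemma Ad_inverse [simp]: "Ad K (inverse_of g) (Ad K g x) = x" "Ad K g (Ad K (inverse_of g) x) = x"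
  by (simp_all flip: Ad_mul)

lemma smooth_Ad: "smooth_map (atlas K) {id_chart} (\<lambda>g. Ad K g x)"
  unfolding smooth_map_euclidean_iff[OF atlas]
proof
  fix c
  assume c: "c \<in> atlas K"
  have "smooth_map (prod_atlas (atlas K) (atlas K)) (atlas K) (\<lambda>p. fst p \<cdot> snd p \<cdot> inverse_of (fst p))"
    by (intro smooth_mul smooth_inverse atlas2 smooth_fst smooth_snd)
  from smooth_on_chart_deriv_snd[OF atlas atlas atlas this c base_chart base_chart, of "\<lambda>_. one K"]
  show "smooth_on (img c) (\<lambda>u. Ad K (inv_crd c u) x)"
    using one_in_base by (simp add: Ad_eq smooth_on_const)
qed

lemma Ad_Cinf: "(\<lambda>g. Ad K g x \<bullet> y) \<in> Cinf K"
  unfolding Cinf_iff by (rule smooth_map_linear[OF atlas bounded_linear_inner_left smooth_Ad])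

lemma Ad_inverse_Cinf: "(\<lambda>g. Ad K (inverse_of g) x \<bullet> y) \<in> Cinf K"
  unfolding Cinf_iff
  by (rule smooth_map_compose[OF atlas atlas smooth_atlas_id smooth_inverse[OF atlas smooth_ident] Ad_Cinf[unfolded Cinf_iff]])

text \<open>Moving \<open>k\<close> to the right, \<open>g \<cdot> k \<cdot> x\<close> equals
  \<open>g \<cdot> (k \<cdot> x \<cdot> inverse_of k) \<cdot> k\<close>; a left-invariant direction
  behind \<open>k\<close> becomes its adjoint image in front of \<open>k\<close>.\<close>

lemma L_mul_right:
  assumes f: "f \<in> Cinf K"
  shows "L y f (g \<cdot> k) = L (Ad K k y) (\<lambda>h. f (h \<cdot> k)) g"
proof -
  have "smooth_map (atlas K) {id_chart} (\<lambda>h. f (g \<cdot> h \<cdot> k))"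
    using Cinf_translate(1)[OF Cinf_translate(2)[OF f]] by (simp add: Cinf_iff)
  from chart_deriv_compose[OF atlas atlas smooth_atlas_id smooth_conj[of k] this base_chart base_chart _ one_in_base, of id_chart y]
  have "chart_deriv bc id_chart (\<lambda>x. f (g \<cdot> (k \<cdot> x \<cdot> inverse_of k) \<cdot> k)) (one K) y
      = chart_deriv bc id_chart (\<lambda>h. f (g \<cdot> h \<cdot> k)) (one K) (Ad K k y)"
    using one_in_base by (simp add: Ad_eq)
  then show ?thesis
    by (simp add: L_eq[OF f] L_eq[OF Cinf_translate(2)[OF f]] mul_assoc)
qed

text \<open>\<open>adj x\<close> is the differential of \<open>Ad\<close> at the unit along \<open>x\<close>, that is \<open>[x, _]\<close>.\<close>

definition adj :: "'e \<Rightarrow> 'e \<Rightarrow> 'e" where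
  "adj x y = (\<Sum>b\<in>Basis. L x (\<lambda>g. Ad K g y \<bullet> b) (one K) *\<^sub>R b)"

lemma L_Ad: "L x (\<lambda>g. Ad K g y \<bullet> z) (one K) = adj x y \<bullet> z"
proof -
  have "L x (\<lambda>g. Ad K g y \<bullet> z) (one K) = L x (\<lambda>g. \<Sum>b\<in>Basis. (z \<bullet> b) * (Ad K g y \<bullet> b)) (one K)"
    by (subst euclidean_inner) (simp add: mult.commute)
  also have "\<dots> = (\<Sum>b\<in>Basis. (z \<bullet> b) * L x (\<lambda>g. Ad K g y \<bullet> b) (one K))"
    by (subst L_sum) (simp_all add: L_scale Ad_Cinf Cinf_mult)
  also have "\<dots> = adj x y \<bullet> z"
    unfolding adj_def inner_sum_left inner_scaleR_left by (intro sum.cong refl) (metis inner_commute mult.commute)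
  finally show ?thesis .
qed

text \<open>Obtained by differentiating the constant \<open>Ad K g (Ad K (inverse_of g) y)\<close>,
  expanded in the basis, so that the differential of the inversion is never computed.\<close>

lemma L_Ad_inverse: "L x (\<lambda>g. Ad K (inverse_of g) y \<bullet> z) (one K) = - (adj x y \<bullet> z)"
proof -
  have "y \<bullet> z = (\<Sum>b\<in>Basis. (Ad K (inverse_of g) y \<bullet> b) * (Ad K g b \<bullet> z))" for g
  proof -
    have "y = (\<Sum>b\<in>Basis. (Ad K (inverse_of g) y \<bullet> b) *\<^sub>R Ad K g b)"
      by (simp flip: Ad_expand)
    then show ?thesis
      by (metis (no_types, lifting) inner_scaleR_left inner_sum_left sum.cong)
  qed
  then have "0 = L x (\<lambda>g. \<Sum>b\<in>Basis. (Ad K (inverse_of g) y \<bullet> b) * (Ad K g b \<bullet> z)) (one K)"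
    by (metis (no_types, lifting) L_const ext)
  also have "\<dots> = (\<Sum>b\<in>Basis. L x (\<lambda>g. Ad K (inverse_of g) y \<bullet> b) (one K) * (b \<bullet> z) + (y \<bullet> b) * (adj x b \<bullet> z))"
    by (subst L_sum) (simp_all add: Cinf_mult Ad_Cinf Ad_inverse_Cinf L_mult L_Ad)
  also have "\<dots> = L x (\<lambda>g. Ad K (inverse_of g) y \<bullet> z) (one K) + (\<Sum>b\<in>Basis. (y \<bullet> b) * (adj x b \<bullet> z))"
  proof -
    have "(\<lambda>g. Ad K (inverse_of g) y \<bullet> z) = (\<lambda>g. \<Sum>b\<in>Basis. (Ad K (inverse_of g) y \<bullet> b) * (b \<bullet> z))"
      by (subst euclidean_inner) (simp add: inner_commute)
    then show ?thesis
      by (simp add: sum.distrib L_sum Cinf_mult Ad_inverse_Cinf L_mult)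
  qed
  also have "(\<Sum>b\<in>Basis. (y \<bullet> b) * (adj x b \<bullet> z)) = adj x y \<bullet> z"
  proof -
    have "Ad K g y \<bullet> z = (\<Sum>b\<in>Basis. (y \<bullet> b) * (Ad K g b \<bullet> z))" for g
      by (subst Ad_expand) (simp add: inner_sum_left)
    then have "adj x y \<bullet> z = L x (\<lambda>g. \<Sum>b\<in>Basis. (y \<bullet> b) * (Ad K g b \<bullet> z)) (one K)"
      by (simp flip: L_Ad)
    then show ?thesis
      by (simp add: L_sum Cinf_mult Ad_Cinf L_scale L_Ad)
  qed
  finally show ?thesis
    by simp
qed

text \<open>In \<open>f (g \<cdot> h \<cdot> k)\<close> the variables \<open>h\<close> and
  \<open>k\<close> are independent, so derivatives at the unit may be taken in either order. One
  order is the left field of a right translate, the other an iterated left field.\<close>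

lemma L_commute_right:
  assumes f: "f \<in> Cinf K"
  shows "(\<lambda>k. L y (\<lambda>h. f (h \<cdot> k)) g) \<in> Cinf K"
    and "L x (\<lambda>k. L y (\<lambda>h. f (h \<cdot> k)) g) (one K) = L y (\<lambda>h. L x f h) g"
proof -
  have sm: "smooth_map (prod_atlas (atlas K) (atlas K)) {id_chart} (\<lambda>p. f (g \<cdot> snd p \<cdot> fst p))"
    using f by (intro smooth_map_compose[OF atlas2 atlas smooth_atlas_id smooth_mul[OF atlas2 smooth_mul[OF atlas2 _ smooth_snd] smooth_fst]]
        smooth_map_const[OF atlas2 atlas]) (simp add: Cinf_iff)
  have eq: "L y (\<lambda>h. f (h \<cdot> k)) g = chart_deriv bc id_chart (\<lambda>h. f (g \<cdot> h \<cdot> k)) (one K) y" for k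
    by (rule L_eq[OF Cinf_translate(2)[OF f]])
  show cinf: "(\<lambda>k. L y (\<lambda>h. f (h \<cdot> k)) g) \<in> Cinf K"
    using smooth_map_chart_deriv_snd[OF atlas atlas sm base_chart one_in_base] by (simp add: Cinf_iff eq)
  have "L x (\<lambda>k. L y (\<lambda>h. f (h \<cdot> k)) g) (one K)
      = chart_deriv bc id_chart (\<lambda>k. chart_deriv bc id_chart (\<lambda>h. f (g \<cdot> h \<cdot> k)) (one K) y) (one K) x"
    using L_eq[OF cinf] by (simp add: eq)
  also have "\<dots> = chart_deriv bc id_chart (\<lambda>h. chart_deriv bc id_chart (\<lambda>k. f (g \<cdot> h \<cdot> k)) (one K) x) (one K) y"
    using chart_deriv_commute[OF atlas atlas sm base_chart base_chart one_in_base one_in_base] by simp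
  also have "\<dots> = L y (\<lambda>h. L x f h) g"
    unfolding L_eq[OF L_Cinf[OF f], of y x g] by (simp add: L_eq[OF f])
  finally show "L x (\<lambda>k. L y (\<lambda>h. f (h \<cdot> k)) g) (one K) = L y (\<lambda>h. L x f h) g" .
qed

text \<open>By \<open>L_mul_right\<close>, \<open>L y f (g \<cdot> k)\<close> is the derivative of a
  right translate of \<open>f\<close> along \<open>Ad K k y\<close>. The product rule in
  \<open>k\<close> gives one term from \<open>Ad\<close>, which is \<open>adj x y\<close>, and one
  from the right translate, which is the iterated derivative in the other order. Thus
  \<open>adj\<close> is the bracket of left-invariant fields.\<close>

lemma L_commutator:
  assumes f: "f \<in> Cinf K"
  shows "L x (\<lambda>h. L y f h) g - L y (\<lambda>h. L x f h) g = L (adj x y) f g"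
proof -
  have "L x (\<lambda>h. L y f h) g = L x (\<lambda>k. L y f (g \<cdot> k)) (one K)"
    by (simp add: L_translate)
  also have "\<dots> = L x (\<lambda>k. \<Sum>b\<in>Basis. (Ad K k y \<bullet> b) * L b (\<lambda>h. f (h \<cdot> k)) g) (one K)"
    by (subst L_mul_right[OF f], subst L_Basis) simp
  also have "\<dots> = (\<Sum>b\<in>Basis. (adj x y \<bullet> b) * L b f g + (y \<bullet> b) * L b (\<lambda>h. L x f h) g)"
    by (subst L_sum) (simp_all add: Cinf_mult Ad_Cinf L_commute_right[OF f] L_mult L_Ad)
  also have "\<dots> = L (adj x y) f g + L y (\<lambda>h. L x f h) g"
    by (subst (3 4) L_Basis) (simp add: sum.distrib)
  finally show ?thesis
    by simp
qed

text \<open>Read off from the commutator of fields, since fields separate vectors; it also carries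
  the linearity of \<open>adj\<close> over to the second argument.\<close>

lemma adj_antisym: "adj x y = - adj y x"
proof (rule L_separates)
  fix f
  assume "f \<in> Cinf K"
  from L_commutator[OF this, of x y "one K"] L_commutator[OF this, of y x "one K"]
  show "L (adj x y) f (one K) = L (- adj y x) f (one K)"
    by (simp add: L_linear)
qed

lemma linear_adj: "linear (\<lambda>x. adj x y)" "linear (adj x)"
proof -
  show 1: "linear (\<lambda>x. adj x y)" for y
    by (rule linearI) (simp_all add: adj_def L_linear scaleR_left_distrib sum.distrib scaleR_sum_right)
  have "adj x = (\<lambda>y. - adj y x)"
    using adj_antisym by blast
  then show "linear (adj x)"
    using linear_compose_neg[OF 1] by metis
qed

end

section \<open>Point derivations and covector fields\<close>

lemma linear_blinfun_expansion:
  fixes l :: "('e::euclidean_space \<Rightarrow>\<^sub>L real) \<Rightarrow> 'c::real_vector"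
  assumes "linear l"
  shows "l \<phi> = (\<Sum>b\<in>Basis. blinfun_apply \<phi> b *\<^sub>R l (blinfun_inner_left b))"
  by (subst blinfun_Basis_expansion[of \<phi>]) (simp add: linear_sum[OF assms] linear_scale[OF assms])

lemma bilinear_blinfun_expansion:
  fixes M :: "('e::euclidean_space \<Rightarrow>\<^sub>L real) \<Rightarrow> ('f::euclidean_space \<Rightarrow>\<^sub>L real) \<Rightarrow> 'c::real_vector"
  assumes "bilinear M"
  shows "M \<phi> \<psi> = (\<Sum>i\<in>Basis. \<Sum>j\<in>Basis. (blinfun_apply \<phi> i * blinfun_apply \<psi> j) *\<^sub>R M (blinfun_inner_left i) (blinfun_inner_left j))"
proof -
  have l: "linear (\<lambda>x. M x y)" "linear (M x)" for x y
    using assms by (auto simp: bilinear_def)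
  show ?thesis
    by (subst linear_blinfun_expansion[OF l(1)], subst linear_blinfun_expansion[OF l(2)]) (simp add: scaleR_sum_right)
qed

text \<open>Kept abstract because the same product rules are used on the group and on its tangent
  group, for left-invariant, Hamiltonian and dressing fields and for vertical and horizontal
  derivatives.\<close>

locale function_algebra =
  fixes C :: "('m \<Rightarrow> real) set"
  assumes const_closed: "(\<lambda>p. r) \<in> C"
    and add_closed: "f \<in> C \<Longrightarrow> h \<in> C \<Longrightarrow> (\<lambda>p. f p + h p) \<in> C"
    and mult_closed: "f \<in> C \<Longrightarrow> h \<in> C \<Longrightarrow> (\<lambda>p. f p * h p) \<in> C"
begin

lemma sum_closed: "(\<And>i. i \<in> I \<Longrightarrow> f i \<in> C) \<Longrightarrow> (\<lambda>p. \<Sum>i\<in>I. f i p) \<in> C"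
  by (induction I rule: infinite_finite_induct) (auto intro: add_closed const_closed)

lemma minus_closed: "f \<in> C \<Longrightarrow> (\<lambda>p. - f p) \<in> C"
  using mult_closed[OF const_closed, of f "-1"] by simp

lemma diff_closed: "f \<in> C \<Longrightarrow> h \<in> C \<Longrightarrow> (\<lambda>p. f p - h p) \<in> C"
  using add_closed[OF _ minus_closed] by simp

definition covector_fields :: "('m \<Rightarrow> 'e::euclidean_space \<Rightarrow>\<^sub>L real) set" where
  "covector_fields = {s. \<forall>x. (\<lambda>p. blinfun_apply (s p) x) \<in> C}"

lemma covector_fieldsD: "s \<in> covector_fields \<Longrightarrow> (\<lambda>p. blinfun_apply (s p) x) \<in> C"
  by (simp add: covector_fields_def)

lemma covector_fieldsI:
  fixes s :: "'m \<Rightarrow> 'e::euclidean_space \<Rightarrow>\<^sub>L real"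
  assumes "\<And>b. b \<in> Basis \<Longrightarrow> (\<lambda>p. blinfun_apply (s p) b) \<in> C"
  shows "s \<in> covector_fields"
proof -
  have "(\<lambda>p. \<Sum>b\<in>Basis. (x \<bullet> b) * blinfun_apply (s p) b) \<in> C" for x
    by (intro sum_closed mult_closed const_closed assms)
  then show ?thesis
    by (simp add: covector_fields_def flip: blinfun_eq_sum_Basis)
qed

lemma covector_fields_const: "(\<lambda>p. \<phi>) \<in> covector_fields"
  by (simp add: covector_fields_def const_closed)

lemma covector_fields_add: "s \<in> covector_fields \<Longrightarrow> t \<in> covector_fields \<Longrightarrow> (\<lambda>p. s p + t p) \<in> covector_fields"
  by (simp add: covector_fields_def blinfun.add_left add_closed)

lemma covector_fields_scale: "f \<in> C \<Longrightarrow> s \<in> covector_fields \<Longrightarrow> (\<lambda>p. f p *\<^sub>R s p) \<in> covector_fields"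
  by (simp add: covector_fields_def blinfun.scaleR_left mult_closed)

lemma covector_fields_sum: "(\<And>i. i \<in> I \<Longrightarrow> s i \<in> covector_fields) \<Longrightarrow> (\<lambda>p. \<Sum>i\<in>I. s i p) \<in> covector_fields"
  by (simp add: covector_fields_def blinfun.sum_left sum_closed)

lemma linear_field_closed:
  fixes E :: "'m \<Rightarrow> ('e::euclidean_space \<Rightarrow>\<^sub>L real) \<Rightarrow> real"
  assumes "\<And>p. linear (E p)" "\<And>\<phi>. (\<lambda>p. E p \<phi>) \<in> C" "s \<in> covector_fields"
  shows "(\<lambda>p. E p (s p)) \<in> C"
proof -
  have "(\<lambda>p. \<Sum>b\<in>Basis. blinfun_apply (s p) b * E p (blinfun_inner_left b)) \<in> C"
    by (intro sum_closed mult_closed covector_fieldsD assms)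
  then show ?thesis
    by (subst linear_blinfun_expansion[OF assms(1)]) simp
qed

lemma bilinear_field_closed:
  fixes E :: "'m \<Rightarrow> ('e::euclidean_space \<Rightarrow>\<^sub>L real) \<Rightarrow> ('f::euclidean_space \<Rightarrow>\<^sub>L real) \<Rightarrow> real"
  assumes E: "\<And>p. bilinear (E p)" "\<And>\<phi> \<psi>. (\<lambda>p. E p \<phi> \<psi>) \<in> C" and st: "s \<in> covector_fields" "t \<in> covector_fields"
  shows "(\<lambda>p. E p (s p) (t p)) \<in> C"
  by (rule linear_field_closed[where E = "\<lambda>p \<phi>. E p \<phi> (t p)"])
    (use E st in \<open>auto simp: bilinear_def intro: linear_field_closed\<close>)

lemma bilinear_closed:
  fixes M :: "('e::euclidean_space \<Rightarrow>\<^sub>L real) \<Rightarrow> ('f::euclidean_space \<Rightarrow>\<^sub>L real) \<Rightarrow> real"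
  assumes "bilinear M" "s \<in> covector_fields" "t \<in> covector_fields"
  shows "(\<lambda>p. M (s p) (t p)) \<in> C"
  by (rule bilinear_field_closed[OF assms(1) const_closed assms(2,3)])

lemma covector_fields_bilinear:
  fixes M :: "('e::euclidean_space \<Rightarrow>\<^sub>L real) \<Rightarrow> ('f::euclidean_space \<Rightarrow>\<^sub>L real) \<Rightarrow> ('h::euclidean_space \<Rightarrow>\<^sub>L real)"
  assumes "bilinear M" "s \<in> covector_fields" "t \<in> covector_fields"
  shows "(\<lambda>p. M (s p) (t p)) \<in> covector_fields"
proof (rule covector_fieldsI)
  fix b
  have "bilinear (\<lambda>\<phi> \<psi>. blinfun_apply (M \<phi> \<psi>) b)"
    using assms(1) by (auto simp: bilinear_def linear_iff blinfun.add_left blinfun.scaleR_left)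
  from bilinear_closed[OF this assms(2,3)] show "(\<lambda>p. blinfun_apply (M (s p) (t p)) b) \<in> C" .
qed

text \<open>A tangent vector at \<open>p\<close> in algebraic form. Real homogeneity comes from the
  Leibniz rule with a constant factor.\<close>

definition point_derivation :: "'m \<Rightarrow> (('m \<Rightarrow> real) \<Rightarrow> real) \<Rightarrow> bool" where
  "point_derivation p \<delta> \<longleftrightarrow> (\<forall>r. \<delta> (\<lambda>p. r) = 0) \<and>
    (\<forall>f\<in>C. \<forall>h\<in>C. \<delta> (\<lambda>p. f p + h p) = \<delta> f + \<delta> h \<and> \<delta> (\<lambda>p. f p * h p) = \<delta> f * h p + f p * \<delta> h)"

lemma point_derivationD:
  assumes "point_derivation p \<delta>"
  shows "\<delta> (\<lambda>p. r) = 0" "f \<in> C \<Longrightarrow> h \<in> C \<Longrightarrow> \<delta> (\<lambda>p. f p + h p) = \<delta> f + \<delta> h"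
    "f \<in> C \<Longrightarrow> h \<in> C \<Longrightarrow> \<delta> (\<lambda>p. f p * h p) = \<delta> f * h p + f p * \<delta> h"
    "f \<in> C \<Longrightarrow> \<delta> (\<lambda>p. r * f p) = r * \<delta> f"
    "f \<in> C \<Longrightarrow> \<delta> (\<lambda>p. f p * r) = \<delta> f * r"
    "f \<in> C \<Longrightarrow> \<delta> (\<lambda>p. - f p) = - \<delta> f"
    "f \<in> C \<Longrightarrow> h \<in> C \<Longrightarrow> \<delta> (\<lambda>p. f p - h p) = \<delta> f - \<delta> h"
proof -
  show 1: "\<delta> (\<lambda>p. r) = 0" "f \<in> C \<Longrightarrow> h \<in> C \<Longrightarrow> \<delta> (\<lambda>p. f p + h p) = \<delta> f + \<delta> h"
    "f \<in> C \<Longrightarrow> h \<in> C \<Longrightarrow> \<delta> (\<lambda>p. f p * h p) = \<delta> f * h p + f p * \<delta> h" for f h r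
    using assms by (auto simp: point_derivation_def)
  show 2: "f \<in> C \<Longrightarrow> \<delta> (\<lambda>p. r * f p) = r * \<delta> f" "f \<in> C \<Longrightarrow> \<delta> (\<lambda>p. f p * r) = \<delta> f * r" for f r
    using 1(3)[OF const_closed, of f r] 1(3)[OF _ const_closed, of f r] by (simp_all add: 1(1))
  show 3: "f \<in> C \<Longrightarrow> \<delta> (\<lambda>p. - f p) = - \<delta> f" for f
    using 2(1)[of f "-1"] by simp
  show "f \<in> C \<Longrightarrow> h \<in> C \<Longrightarrow> \<delta> (\<lambda>p. f p - h p) = \<delta> f - \<delta> h"
    using 1(2)[of f "\<lambda>p. - h p"] by (simp add: minus_closed 3)
qed

lemma point_derivation_sum:
  assumes "point_derivation p \<delta>" "\<And>i. i \<in> I \<Longrightarrow> f i \<in> C"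
  shows "\<delta> (\<lambda>p. \<Sum>i\<in>I. f i p) = (\<Sum>i\<in>I. \<delta> (f i))"
  using assms(2)
  by (induction I rule: infinite_finite_induct)
    (simp_all add: point_derivationD[OF assms(1)] sum_closed)

definition covector_deriv :: "(('m \<Rightarrow> real) \<Rightarrow> real) \<Rightarrow> ('m \<Rightarrow> 'e::euclidean_space \<Rightarrow>\<^sub>L real) \<Rightarrow> 'e \<Rightarrow>\<^sub>L real" where
  "covector_deriv \<delta> s = (\<Sum>b\<in>Basis. \<delta> (\<lambda>p. blinfun_apply (s p) b) *\<^sub>R blinfun_inner_left b)"

lemma covector_deriv_apply:
  assumes "point_derivation p \<delta>" "s \<in> covector_fields"
  shows "covector_deriv \<delta> s x = \<delta> (\<lambda>p. blinfun_apply (s p) x)"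
proof -
  have "\<delta> (\<lambda>p. blinfun_apply (s p) x) = \<delta> (\<lambda>p. \<Sum>b\<in>Basis. (x \<bullet> b) * blinfun_apply (s p) b)"
    by (subst blinfun_eq_sum_Basis) simp
  also have "\<dots> = (\<Sum>b\<in>Basis. (x \<bullet> b) * \<delta> (\<lambda>p. blinfun_apply (s p) b))"
    using assms(2) by (subst point_derivation_sum[OF assms(1)])
      (auto simp: point_derivationD[OF assms(1)] covector_fieldsD mult_closed const_closed)
  finally show ?thesis
    by (simp add: covector_deriv_def blinfun.sum_left blinfun.scaleR_left blinfun_inner_left.rep_eq inner_commute mult.commute)
qed

text \<open>A product rule for a varying functional applied to a varying covector: one term
  differentiates the covector with the functional frozen at \<open>p\<close>, the other freezes the
  covector at \<open>s p\<close>. The basis expansion reduces it to the Leibniz rule for real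
  functions.\<close>

lemma point_derivation_linear_field:
  fixes E :: "'m \<Rightarrow> ('e::euclidean_space \<Rightarrow>\<^sub>L real) \<Rightarrow> real"
  assumes \<delta>: "point_derivation p \<delta>" and E: "\<And>p. linear (E p)" "\<And>\<phi>. (\<lambda>p. E p \<phi>) \<in> C" and s: "s \<in> covector_fields"
  shows "\<delta> (\<lambda>q. E q (s q)) = E p (covector_deriv \<delta> s) + \<delta> (\<lambda>q. E q (s p))"
proof -
  let ?e = "\<lambda>b q. E q (blinfun_inner_left b)"
  have eq: "E q \<phi> = (\<Sum>b\<in>Basis. blinfun_apply \<phi> b * ?e b q)" for q \<phi>
    by (subst linear_blinfun_expansion[OF E(1)]) simp
  have "\<delta> (\<lambda>q. E q (s q)) = (\<Sum>b\<in>Basis. \<delta> (\<lambda>q. blinfun_apply (s q) b) * ?e b p + blinfun_apply (s p) b * \<delta> (?e b))"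
    by (subst eq, subst point_derivation_sum[OF \<delta>]) (simp_all add: mult_closed covector_fieldsD[OF s] E(2) point_derivationD[OF \<delta>])
  moreover have "\<delta> (\<lambda>q. E q (s p)) = (\<Sum>b\<in>Basis. blinfun_apply (s p) b * \<delta> (?e b))"
    by (subst eq, subst point_derivation_sum[OF \<delta>]) (simp_all add: mult_closed const_closed E(2) point_derivationD[OF \<delta>])
  ultimately show ?thesis
    by (simp add: eq[of p "covector_deriv \<delta> s"] covector_deriv_apply[OF \<delta> s] sum.distrib)
qed

lemma point_derivation_bilinear_field:
  fixes E :: "'m \<Rightarrow> ('e::euclidean_space \<Rightarrow>\<^sub>L real) \<Rightarrow> ('f::euclidean_space \<Rightarrow>\<^sub>L real) \<Rightarrow> real"
  assumes \<delta>: "point_derivation p \<delta>" and E: "\<And>p. bilinear (E p)" "\<And>\<phi> \<psi>. (\<lambda>p. E p \<phi> \<psi>) \<in> C"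
    and st: "s \<in> covector_fields" "t \<in> covector_fields"
  shows "\<delta> (\<lambda>q. E q (s q) (t q))
    = E p (covector_deriv \<delta> s) (t p) + E p (s p) (covector_deriv \<delta> t) + \<delta> (\<lambda>q. E q (s p) (t p))"
proof -
  have l: "linear (\<lambda>\<phi>. E q \<phi> \<psi>)" "linear (E q \<phi>)" for q \<phi> \<psi>
    using E(1) by (auto simp: bilinear_def)
  show ?thesis
    using point_derivation_linear_field[OF \<delta> l(1)[of _ "t _"] linear_field_closed[OF l(2) E(2) st(2)] st(1)]
      point_derivation_linear_field[OF \<delta> l(2) E(2) st(2)]
    by simp
qed

lemma point_derivation_bilinear:
  fixes M :: "('e::euclidean_space \<Rightarrow>\<^sub>L real) \<Rightarrow> ('f::euclidean_space \<Rightarrow>\<^sub>L real) \<Rightarrow> real"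
  assumes "point_derivation p \<delta>" "bilinear M" "s \<in> covector_fields" "t \<in> covector_fields"
  shows "\<delta> (\<lambda>p. M (s p) (t p)) = M (covector_deriv \<delta> s) (t p) + M (s p) (covector_deriv \<delta> t)"
  using point_derivation_bilinear_field[OF assms(1,2) const_closed assms(3,4)] by (simp add: point_derivationD(1)[OF assms(1)])

lemma covector_deriv_bilinear:
  fixes M :: "('e::euclidean_space \<Rightarrow>\<^sub>L real) \<Rightarrow> ('f::euclidean_space \<Rightarrow>\<^sub>L real) \<Rightarrow> ('h::euclidean_space \<Rightarrow>\<^sub>L real)"
  assumes \<delta>: "point_derivation p \<delta>" and M: "bilinear M"
    and st: "s \<in> covector_fields" "t \<in> covector_fields"
  shows "covector_deriv \<delta> (\<lambda>p. M (s p) (t p)) = M (covector_deriv \<delta> s) (t p) + M (s p) (covector_deriv \<delta> t)"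
proof (rule blinfun_eqI)
  fix x
  have "bilinear (\<lambda>\<phi> \<psi>. blinfun_apply (M \<phi> \<psi>) x)"
    using M by (auto simp: bilinear_def linear_iff blinfun.add_left blinfun.scaleR_left)
  from point_derivation_bilinear[OF \<delta> this st]
  show "covector_deriv \<delta> (\<lambda>p. M (s p) (t p)) x
      = blinfun_apply (M (covector_deriv \<delta> s) (t p) + M (s p) (covector_deriv \<delta> t)) x"
    by (simp add: covector_deriv_apply[OF \<delta>] covector_fields_bilinear[OF M st] blinfun.add_left)
qed

end

sublocale Lie_group \<subseteq> function_algebra "Cinf K"
  by unfold_locales (auto intro: Cinf_add Cinf_mult)

context Lie_group
begin

lemma point_derivation_L: "point_derivation g (\<lambda>f. L x f g)"
  by (simp add: point_derivation_def L_add L_mult)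

lemma left_diff_field: "f \<in> Cinf K \<Longrightarrow> left_diff K f \<in> covector_fields"
  using L_Cinf by (simp add: covector_fields_def left_field_def)

subsection \<open>One-forms in the left-invariant frame\<close>

text \<open>The left Maurer-Cartan form at \<open>g\<close>, with the tangent space at
  \<open>g\<close> read in the chart \<open>c\<close>; \<open>frame\<close> is its inverse.\<close>

definition coframe where "coframe c g = chart_deriv c bc (\<lambda>h. inverse_of g \<cdot> h) g"

definition frame where "frame c g = chart_deriv bc c (\<lambda>h. g \<cdot> h) (one K)"

definition form_of :: "('g \<Rightarrow> 'e \<Rightarrow>\<^sub>L real) \<Rightarrow> ('g, 'e) form" where
  "form_of t c g = (if c \<in> atlas K \<and> g \<in> dom c then Blinfun (\<lambda>v. blinfun_apply (t g) (coframe c g v)) else 0)"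

text \<open>The chart is an arbitrary choice among those containing \<open>g\<close>;
  \<open>coeff_apply\<close> shows, through the transformation rule of 1-forms, that the result does
  not depend on it.\<close>

definition coeff :: "('g, 'e) form \<Rightarrow> 'g \<Rightarrow> 'e \<Rightarrow>\<^sub>L real" where
  "coeff \<tau> g = (let c = SOME c. c \<in> atlas K \<and> g \<in> dom c in Blinfun (\<lambda>x. blinfun_apply (\<tau> c g) (frame c g x)))"

context
  fixes c g
  assumes c: "c \<in> atlas K" and g: "g \<in> dom c"
begin

lemma linear_coframe: "linear (coframe c g)" and linear_frame: "linear (frame c g)"
  unfolding coframe_def frame_def using c g base_chart one_in_base
  by (auto intro!: linear_chart_deriv[OF atlas atlas smooth_translate(1)])

lemma coframe_frame [simp]: "coframe c g (frame c g x) = x"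
  using chart_deriv_compose[OF atlas atlas atlas smooth_translate(1)[of g] smooth_translate(1)[of "inverse_of g"]
      base_chart c base_chart one_in_base, of x] g one_in_base chart_deriv_ident[OF base one_in_base]
  by (simp add: coframe_def frame_def)

lemma frame_coframe [simp]: "frame c g (coframe c g v) = v"
  using chart_deriv_compose[OF atlas atlas atlas smooth_translate(1)[of "inverse_of g"] smooth_translate(1)[of g]
      c base_chart c g, of v] g one_in_base chart_deriv_ident[OF smooth_atlasD(1)[OF atlas c] g]
  by (simp add: coframe_def frame_def)

lemma form_of_apply: "form_of t c g v = blinfun_apply (t g) (coframe c g v)"
proof -
  have "bounded_linear (\<lambda>v. blinfun_apply (t g) (coframe c g v))"
    using linear_coframe by (intro bounded_linear_compose[OF blinfun.bounded_linear_right]) (simp add: linear_conv_bounded_linear)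
  then show ?thesis
    using c g by (simp add: form_of_def bounded_linear_Blinfun_apply)
qed

lemma
  assumes "c' \<in> atlas K" "g \<in> dom c'"
  defines "T \<equiv> frechet_derivative (crd c' \<circ> inv_crd c) (at (crd c g))"
  shows coframe_change: "coframe c' g (T v) = coframe c g v"
    and frame_change: "T (frame c g x) = frame c' g x"
proof -
  have T: "T = chart_deriv c c' (\<lambda>h. h) g"
    by (simp add: T_def chart_deriv_def o_def)
  show "coframe c' g (T v) = coframe c g v"
    using chart_deriv_compose[OF atlas atlas atlas smooth_ident smooth_translate(1) c assms(1) base_chart g] assms g one_in_base
    by (simp add: T coframe_def)
  show "T (frame c g x) = frame c' g x"
    using chart_deriv_compose[OF atlas atlas atlas smooth_translate(1)[of g] smooth_ident base_chart c assms(1) one_in_base] assms g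
    by (simp add: T frame_def)
qed

end

lemma smooth_coframe:
  assumes c: "c \<in> atlas K"
  shows "smooth_on (img c) (\<lambda>u. coframe c (inv_crd c u) v)"
proof -
  have ch: "is_chart c"
    using smooth_atlasD(1)[OF atlas c] .
  have "smooth_map (prod_atlas (atlas K) (atlas K)) (atlas K) (\<lambda>p. inverse_of (fst p) \<cdot> snd p)"
    by (intro smooth_mul smooth_inverse atlas2 smooth_fst smooth_snd)
  moreover have "smooth_on (img c) (\<lambda>u. crd c (inv_crd c u))"
    by (rule smooth_on_cong[OF is_chart_open(2)[OF ch], THEN iffD1, OF _ smooth_on_ident]) (use ch in simp)
  ultimately show ?thesis
    using smooth_on_chart_deriv_snd[OF atlas atlas atlas _ c c base_chart, of "\<lambda>p. inverse_of (fst p) \<cdot> snd p" "\<lambda>p. p" v]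
      one_in_base by (simp add: coframe_def)
qed

lemma smooth_frame:
  assumes c: "c \<in> atlas K"
  shows "smooth_on (img c) (\<lambda>u. frame c (inv_crd c u) x)"
proof -
  have "smooth_map (prod_atlas (atlas K) (atlas K)) (atlas K) (\<lambda>p. fst p \<cdot> snd p)"
    by (intro smooth_mul atlas2 smooth_fst smooth_snd)
  then show ?thesis
    using smooth_on_chart_deriv_snd[OF atlas atlas atlas _ c base_chart c, of "\<lambda>p. fst p \<cdot> snd p" "\<lambda>_. one K" x]
      one_in_base by (simp add: frame_def smooth_on_const)
qed

lemma form_of_Omega1:
  assumes "t \<in> covector_fields"
  shows "form_of t \<in> Omega1 K"
  unfolding Omega1_def
proof (intro CollectI conjI ballI allI impI)
  show "form_of t c g = 0" if "c \<notin> atlas K \<or> g \<notin> dom c" for c g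
    using that by (auto simp: form_of_def)
next
  fix c c' g v
  assume "c \<in> atlas K" "c' \<in> atlas K" "g \<in> dom c \<inter> dom c'"
  then show "form_of t c g v =
      form_of t c' g (frechet_derivative (crd c' \<circ> inv_crd c) (at (crd c g)) v)"
    by (simp add: form_of_apply coframe_change)
next
  fix c v
  assume c: "c \<in> atlas K"
  then have ch: "is_chart c"
    using smooth_atlasD(1)[OF atlas] by blast
  have "smooth_on (img c) (\<lambda>u. \<Sum>b\<in>Basis. (coframe c (inv_crd c u) v \<bullet> b) * blinfun_apply (t (inv_crd c u)) b)"
  proof (intro smooth_on_sum smooth_on_bilinear[OF bounded_bilinear_mult] is_chart_open(2)[OF ch])
    fix b :: 'e
    show "smooth_on (img c) (\<lambda>u. coframe c (inv_crd c u) v \<bullet> b)"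
      by (rule smooth_on_linear_compose[OF bounded_linear_inner_left is_chart_open(2)[OF ch] smooth_coframe[OF c]])
    show "smooth_on (img c) (\<lambda>u. blinfun_apply (t (inv_crd c u)) b)"
      using covector_fieldsD[OF assms, of b] c by (simp add: Cinf_iff smooth_map_euclidean_iff[OF atlas])
  qed
  moreover have "(\<Sum>b\<in>Basis. (coframe c (inv_crd c u) v \<bullet> b) * blinfun_apply (t (inv_crd c u)) b)
      = form_of t c (inv_crd c u) v" if "u \<in> img c" for u
    using that c ch by (simp add: form_of_apply flip: blinfun_eq_sum_Basis)
  ultimately show "smooth_on (img c) (\<lambda>u. form_of t c (inv_crd c u) v)"
    by (rule smooth_on_cong[OF is_chart_open(2)[OF ch], THEN iffD1, rotated])
qed

lemma coeff_apply:
  assumes "\<tau> \<in> Omega1 K" "c \<in> atlas K" "g \<in> dom c"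
  shows "coeff \<tau> g x = blinfun_apply (\<tau> c g) (frame c g x)"
proof -
  define d where "d = (SOME c. c \<in> atlas K \<and> g \<in> dom c)"
  have d: "d \<in> atlas K \<and> g \<in> dom d"
    unfolding d_def by (rule someI[of "\<lambda>c. c \<in> atlas K \<and> g \<in> dom c" c]) (simp add: assms)
  have "bounded_linear (\<lambda>x. blinfun_apply (\<tau> d g) (frame d g x))"
    using linear_frame d by (intro bounded_linear_compose[OF blinfun.bounded_linear_right]) (simp add: linear_conv_bounded_linear)
  then have "coeff \<tau> g x = blinfun_apply (\<tau> d g) (frame d g x)"
    unfolding coeff_def Let_def d_def[symmetric] by (simp add: bounded_linear_Blinfun_apply)
  also have "\<dots> = blinfun_apply (\<tau> c g) (frechet_derivative (crd c \<circ> inv_crd d) (at (crd d g)) (frame d g x))"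
    using assms d unfolding Omega1_def by blast
  finally show ?thesis
    using d assms by (simp add: frame_change)
qed

text \<open>With \<open>coeff_form_of\<close> this identifies 1-forms with smooth functions into the
  dual Lie algebra. Inside the chart domains it says that \<open>frame\<close> and
  \<open>coframe\<close> are inverse; outside, both sides are zero by the convention on
  1-forms.\<close>

lemma form_of_coeff:
  assumes "\<tau> \<in> Omega1 K"
  shows "form_of (coeff \<tau>) = \<tau>"
proof (intro ext blinfun_eqI)
  fix c g v
  show "form_of (coeff \<tau>) c g v = blinfun_apply (\<tau> c g) v"
  proof (cases "c \<in> atlas K \<and> g \<in> dom c")
    case True
    then show ?thesis
      by (simp add: form_of_apply coeff_apply[OF assms, of c])
  next
    case False
    then have "\<tau> c g = 0"
      using assms unfolding Omega1_def by blast
    then show ?thesis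
      using False by (auto simp: form_of_def)
  qed
qed

lemma coeff_form_of:
  assumes "t \<in> covector_fields"
  shows "coeff (form_of t) = t"
proof (intro ext blinfun_eqI)
  fix g x
  obtain c where "c \<in> atlas K" "g \<in> dom c"
    using smooth_atlasD(2)[OF atlas] by blast
  then show "coeff (form_of t) g x = blinfun_apply (t g) x"
    by (simp add: coeff_apply[OF form_of_Omega1[OF assms], of c] form_of_apply)
qed

lemma coeff_field:
  assumes "\<tau> \<in> Omega1 K"
  shows "coeff \<tau> \<in> covector_fields"
proof -
  have "smooth_on (img c) (\<lambda>u. coeff \<tau> (inv_crd c u) x)" if c: "c \<in> atlas K" for c x
  proof -
    have ch: "is_chart c"
      using smooth_atlasD(1)[OF atlas c] .
    have "smooth_on (img c) (\<lambda>u. \<Sum>b\<in>Basis. (frame c (inv_crd c u) x \<bullet> b) * blinfun_apply (\<tau> c (inv_crd c u)) b)"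
    proof (intro smooth_on_sum smooth_on_bilinear[OF bounded_bilinear_mult] is_chart_open(2)[OF ch])
      fix b :: 'e
      show "smooth_on (img c) (\<lambda>u. frame c (inv_crd c u) x \<bullet> b)"
        by (rule smooth_on_linear_compose[OF bounded_linear_inner_left is_chart_open(2)[OF ch] smooth_frame[OF c]])
      show "smooth_on (img c) (\<lambda>u. blinfun_apply (\<tau> c (inv_crd c u)) b)"
        using assms c unfolding Omega1_def by blast
    qed
    moreover have "(\<Sum>b\<in>Basis. (frame c (inv_crd c u) x \<bullet> b) * blinfun_apply (\<tau> c (inv_crd c u)) b)
        = coeff \<tau> (inv_crd c u) x" if "u \<in> img c" for u
      using that c ch by (simp add: coeff_apply[OF assms c] flip: blinfun_eq_sum_Basis)
    ultimately show ?thesis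
      by (rule smooth_on_cong[OF is_chart_open(2)[OF ch], THEN iffD1, rotated])
  qed
  then show ?thesis
    by (simp add: covector_fields_def Cinf_iff smooth_map_euclidean_iff[OF atlas])
qed

lemma form_of_eqI:
  assumes "\<And>c g v. c \<in> atlas K \<Longrightarrow> g \<in> dom c \<Longrightarrow> blinfun_apply (\<tau> c g) v = blinfun_apply (t g) (coframe c g v)"
    and "\<And>c g. c \<notin> atlas K \<or> g \<notin> dom c \<Longrightarrow> \<tau> c g = 0"
  shows "\<tau> = form_of t"
proof (intro ext blinfun_eqI)
  fix c g v
  show "blinfun_apply (\<tau> c g) v = form_of t c g v"
  proof (cases "c \<in> atlas K \<and> g \<in> dom c")
    case True
    then show ?thesis
      by (simp add: assms(1) form_of_apply)
  next
    case False
    then have "\<tau> c g = 0" "form_of t c g = 0"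
      using assms(2) by (auto simp: form_of_def)
    then show ?thesis
      by simp
  qed
qed

text \<open>Write \<open>f\<close> as its left translate by \<open>g\<close> composed with left
  translation by \<open>inverse_of g\<close>; the chain rule then factors the differential through
  \<open>coframe\<close>.\<close>

lemma ext_d_eq:
  assumes f: "f \<in> Cinf K"
  shows "ext_d K f = form_of (left_diff K f)"
proof (rule form_of_eqI)
  fix c g v
  assume c: "c \<in> atlas K" "g \<in> dom c"
  have lin: "linear (chart_deriv c id_chart f g)"
    using f c by (intro linear_chart_deriv[OF atlas smooth_atlas_id]) (auto simp: Cinf_iff)
  have eq: "frechet_derivative (f \<circ> inv_crd c) (at (crd c g)) = chart_deriv c id_chart f g"
    by (simp add: chart_deriv_def o_def)
  have "chart_deriv c id_chart f g v = chart_deriv bc id_chart (\<lambda>h. f (g \<cdot> h)) (one K) (coframe c g v)"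
    using chart_deriv_compose[OF atlas atlas smooth_atlas_id smooth_translate(1)[of "inverse_of g"] Cinf_translate(1)[OF f, unfolded Cinf_iff]
        c(1) base_chart _ c(2), of id_chart g v] one_in_base by (simp add: coframe_def)
  then show "blinfun_apply (ext_d K f c g) v = left_diff K f g (coframe c g v)"
    using c lin by (simp add: ext_d_def eq bounded_linear_Blinfun_apply linear_conv_bounded_linear left_diff_apply[OF f])
qed (auto simp: ext_d_def)

lemma left_form_eq: "left_form K \<phi> = form_of (\<lambda>_. \<phi>)"
  by (simp add: left_form_def form_of_def coframe_def chart_deriv_def fun_eq_iff)

lemma form_of_cong: "(\<And>g. s g = t g) \<Longrightarrow> form_of s = form_of t"
  by (simp add: form_of_def fun_eq_iff)

lemma form_of_outside: "c \<notin> atlas K \<or> g \<notin> dom c \<Longrightarrow> form_of t c g = 0"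
  by (auto simp: form_of_def)

lemma form_add_form_of: "form_add (form_of s) (form_of t) = form_of (\<lambda>g. s g + t g)"
  by (rule form_of_eqI) (simp_all add: form_add_def form_of_apply blinfun.add_left form_of_outside)

lemma form_diff_form_of: "form_diff (form_of s) (form_of t) = form_of (\<lambda>g. s g - t g)"
  by (rule form_of_eqI) (simp_all add: form_diff_def form_of_apply blinfun.diff_left form_of_outside)

lemma form_mult_form_of: "form_mult a (form_of t) = form_of (\<lambda>g. a g *\<^sub>R t g)"
  by (rule form_of_eqI) (simp_all add: form_mult_def form_of_apply blinfun.scaleR_left form_of_outside)

lemma form_sum_form_of: "form_sum (\<lambda>i. form_of (t i)) I = form_of (\<lambda>g. \<Sum>i\<in>I. t i g)"
  by (rule form_of_eqI) (simp_all add: form_sum_def form_of_apply blinfun.sum_left form_of_outside)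

end

section \<open>Preconnections from pre-Lie structures\<close>

text \<open>A Lie group with a Poisson bracket; the relation between the two is left to the
  assumption \<open>L_br\<close> of the context below. The locale is instantiated both by the given
  group and by its tangent group.\<close>

locale Poisson_group = Lie_group K for K :: "('g::{t2_space,second_countable_topology}, 'e::euclidean_space) lie_group_data" +
  fixes br :: "'g bracket"
  assumes poisson: "poisson_bracket K br"
begin

lemma br_Cinf: "f \<in> Cinf K \<Longrightarrow> h \<in> Cinf K \<Longrightarrow> br f h \<in> Cinf K"
  using poisson unfolding poisson_bracket_def by blast

lemma br_add_scale_left: "f \<in> Cinf K \<Longrightarrow> h \<in> Cinf K \<Longrightarrow> k \<in> Cinf K \<Longrightarrow> br (\<lambda>g. r * f g + h g) k g = r * br f k g + br h k g"
  by (rule fun_cong[of _ "\<lambda>g. _ g"]) (use poisson in \<open>unfold poisson_bracket_def, blast\<close>)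

lemma br_antisym: "f \<in> Cinf K \<Longrightarrow> h \<in> Cinf K \<Longrightarrow> br f h g = - br h f g"
  by (rule fun_cong[of _ "\<lambda>g. _ g"]) (use poisson in \<open>unfold poisson_bracket_def, blast\<close>)

lemma br_mult_right: "f \<in> Cinf K \<Longrightarrow> h \<in> Cinf K \<Longrightarrow> k \<in> Cinf K \<Longrightarrow> br f (\<lambda>g. h g * k g) g = br f h g * k g + h g * br f k g"
  by (rule fun_cong[of _ "\<lambda>g. _ g"]) (use poisson in \<open>unfold poisson_bracket_def, blast\<close>)

lemma br_jacobi: "f \<in> Cinf K \<Longrightarrow> h \<in> Cinf K \<Longrightarrow> k \<in> Cinf K \<Longrightarrow> br f (br h k) g + br h (br k f) g + br k (br f h) g = 0"
  using poisson unfolding poisson_bracket_def by blast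

lemma br_add_scale_right: "f \<in> Cinf K \<Longrightarrow> h \<in> Cinf K \<Longrightarrow> k \<in> Cinf K \<Longrightarrow> br f (\<lambda>g. r * h g + k g) g = r * br f h g + br f k g"
  using br_add_scale_left[of h k f r g] Cinf_add[OF Cinf_mult[OF Cinf_const]]
  by (simp add: br_antisym[of f])

lemma point_derivation_br:
  assumes f: "f \<in> Cinf K"
  shows "point_derivation g (\<lambda>h. br f h g)"
  unfolding point_derivation_def
proof (intro conjI allI ballI)
  \<comment> \<open>Constants are central: the Leibniz rule for \<open>1 = 1 * 1\<close> gives twice
    the same bracket.\<close>
  have 1: "br f (\<lambda>g. 1) g = 0"
    using br_mult_right[OF f, of "\<lambda>_. 1" "\<lambda>_. 1" g] by simp
  have 0: "br f (\<lambda>g. 0) g = 0"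
    using br_mult_right[OF f, of "\<lambda>_. 0" "\<lambda>_. 0" g] by simp
  show "br f (\<lambda>p. r) g = 0" for r
    using br_add_scale_right[OF f, of "\<lambda>_. 1" "\<lambda>_. 0" r g] 0 1 by simp
  fix h k
  assume "h \<in> Cinf K" "k \<in> Cinf K"
  then show "br f (\<lambda>p. h p + k p) g = br f h g + br f k g"
    "br f (\<lambda>p. h p * k p) g = br f h g * k g + h g * br f k g"
    using br_add_scale_right[OF f, of h k 1 g] br_mult_right[OF f] by simp_all
qed

text \<open>The first assumption is the infinitesimal form of the multiplicativity of the bracket; \<open>lb\<close> is its
  linearization at the unit.\<close>

context
  fixes lb pl :: "('e \<Rightarrow>\<^sub>L real) \<Rightarrow> ('e \<Rightarrow>\<^sub>L real) \<Rightarrow> ('e \<Rightarrow>\<^sub>L real)"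
  assumes L_br: "\<And>f h x g. f \<in> Cinf K \<Longrightarrow> h \<in> Cinf K \<Longrightarrow>
      L x (br f h) g = br (\<lambda>g. L x f g) h g + br f (\<lambda>g. L x h g) g + lb (left_diff K f g) (left_diff K h g) x"
    and pl: "pre_lie_structure lb pl"
begin

lemma pl_bilinear: "bilinear pl"
  and pl_assoc: "pl (pl x y) z - pl (pl y x) z = pl x (pl y z) - pl y (pl x z)"
  and pl_commutator: "pl x y - pl y x = lb x y"
  using pl by (auto simp: pre_lie_structure_def)

lemmas pl_simps = bilinear_ladd[OF pl_bilinear] bilinear_radd[OF pl_bilinear] bilinear_lmul[OF pl_bilinear]
  bilinear_rmul[OF pl_bilinear] bilinear_lsub[OF pl_bilinear] bilinear_rsub[OF pl_bilinear]

abbreviation brc where "brc a s g \<equiv> covector_deriv (\<lambda>h. br a h g) s"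

text \<open>The left-covariant preconnection with \<open>\<Xi> = pl\<close>, acting on the
  coefficients of a 1-form in the left-invariant frame.\<close>

definition nabla :: "('g \<Rightarrow> real) \<Rightarrow> ('g \<Rightarrow> 'e \<Rightarrow>\<^sub>L real) \<Rightarrow> 'g \<Rightarrow> 'e \<Rightarrow>\<^sub>L real" where
  "nabla a t g = brc a t g + pl (left_diff K a g) (t g)"

lemma nabla_eq: "nabla a t = (\<lambda>g. brc a t g + pl (left_diff K a g) (t g))"
  by (simp add: nabla_def fun_eq_iff)

lemma brc_apply: "a \<in> Cinf K \<Longrightarrow> t \<in> covector_fields \<Longrightarrow> brc a t g x = br a (\<lambda>g. blinfun_apply (t g) x) g"
  by (rule covector_deriv_apply[OF point_derivation_br])

lemma brc_field: "a \<in> Cinf K \<Longrightarrow> t \<in> covector_fields \<Longrightarrow> brc a t \<in> covector_fields"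
  unfolding covector_fields_def by (simp add: brc_apply[unfolded covector_fields_def] br_Cinf)

lemma nabla_field: "a \<in> Cinf K \<Longrightarrow> t \<in> covector_fields \<Longrightarrow> nabla a t \<in> covector_fields"
  unfolding nabla_eq
  by (intro covector_fields_add brc_field covector_fields_bilinear[OF pl_bilinear] left_diff_field)

text \<open>In the antisymmetrised double derivative, the terms with one \<open>brc\<close> applied
  to \<open>t\<close> are symmetric in \<open>a\<close> and \<open>b\<close> and cancel. The pure
  bracket terms combine by the Jacobi identity, and those differentiating \<open>left_diff\<close>
  give the differential of \<open>br a b\<close> up to \<open>lb\<close>; the \<open>lb\<close> term
  is absorbed by the pre-Lie identity.\<close>

lemma nabla_flat:
  assumes a: "a \<in> Cinf K" and b: "b \<in> Cinf K" and t: "t \<in> covector_fields"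
  shows "nabla a (nabla b t) g - nabla b (nabla a t) g = nabla (br a b) t g"
proof -
  have plt: "(\<lambda>g. pl (left_diff K b g) (t g)) \<in> covector_fields" if "b \<in> Cinf K" for b
    by (intro covector_fields_bilinear[OF pl_bilinear] left_diff_field that t)
  have brc_add: "brc a (\<lambda>g. s g + s' g) g = brc a s g + brc a s' g"
    if "a \<in> Cinf K" "s \<in> covector_fields" "s' \<in> covector_fields" for a s s'
    using that by (intro blinfun_eqI)
      (simp add: brc_apply covector_fields_add blinfun.add_left point_derivationD(2)[OF point_derivation_br] covector_fieldsD)
  have nn: "nabla a (nabla b t) g = brc a (brc b t) g + pl (brc a (left_diff K b) g) (t g) + pl (left_diff K b g) (brc a t g)
      + pl (left_diff K a g) (brc b t g) + pl (left_diff K a g) (pl (left_diff K b g) (t g))"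
    if "a \<in> Cinf K" "b \<in> Cinf K" for a b
    unfolding nabla_def[of a] nabla_eq[of b]
    using that by (simp add: brc_add brc_field plt covector_deriv_bilinear[OF point_derivation_br pl_bilinear left_diff_field t] t pl_simps)
  have jac: "brc a (brc b t) g - brc b (brc a t) g = brc (br a b) t g"
  proof (rule blinfun_eqI)
    fix x
    let ?k = "\<lambda>g. blinfun_apply (t g) x"
    have k: "?k \<in> Cinf K"
      by (rule covector_fieldsD[OF t])
    have "br b (br ?k a) g = - br b (br a ?k) g"
    proof -
      have "br ?k a = (\<lambda>g. - br a ?k g)"
        using br_antisym[OF k a] by blast
      then show ?thesis
        by (simp add: point_derivationD(6)[OF point_derivation_br[OF b]] br_Cinf a k)
    qed
    then have "br a (br b ?k) g - br b (br a ?k) g = br (br a b) ?k g"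
      using br_jacobi[OF a b k, of g] br_antisym[OF k br_Cinf[OF a b], of g] by simp
    then show "blinfun_apply (brc a (brc b t) g - brc b (brc a t) g) x = brc (br a b) t g x"
      by (simp add: blinfun.diff_left brc_apply brc_field a b t br_Cinf)
  qed
  \<comment> \<open>The assumption \<open>L_br\<close>, read as a formula for the differential of a
    bracket.\<close>
  have dbr: "left_diff K (br a b) g = brc a (left_diff K b) g - brc b (left_diff K a) g + lb (left_diff K a g) (left_diff K b g)"
  proof (rule blinfun_eqI)
    fix x
    have "br (\<lambda>g. L x a g) b g = - br b (\<lambda>g. L x a g) g"
      by (intro br_antisym L_Cinf a b)
    then show "left_diff K (br a b) g x
        = blinfun_apply (brc a (left_diff K b) g - brc b (left_diff K a) g + lb (left_diff K a g) (left_diff K b g)) x"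
      using L_br[OF a b, of x g] by (simp add: blinfun.diff_left blinfun.add_left brc_apply left_diff_field a b flip: left_field_def)
  qed
  \<comment> \<open>The pre-Lie identity with the commutator replaced by the bracket: left
    multiplication represents the Lie algebra.\<close>
  have "pl (lb x y) z = pl x (pl y z) - pl y (pl x z)" for x y z
    using pl_assoc[of x y z] by (simp flip: pl_commutator add: pl_simps)
  then show ?thesis
    unfolding nn[OF a b] nn[OF b a] nabla_def[of "br a b"] dbr jac[symmetric]
    by (simp add: pl_simps)
qed

theorem left_covariant_flat_preconnection:
  "\<exists>\<gamma> :: ('g, 'e) preconn. preconnection K br \<gamma> \<and> poisson_compatible K br \<gamma> \<and> left_covariant K br \<gamma> \<and> flat_preconnection K br \<gamma>"
proof (intro exI conjI)
  \<comment> \<open>Passing through coefficients makes this a total function; on 1-forms it is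
    \<open>nabla\<close> transported by the bijection \<open>form_of\<close>.\<close>
  define \<gamma> :: "('g, 'e) preconn" where "\<gamma> a \<tau> = form_of (nabla a (coeff \<tau>))" for a \<tau>
  have \<gamma>: "\<gamma> a (form_of t) = form_of (nabla a t)" if "t \<in> covector_fields" for a t
    by (simp add: \<gamma>_def coeff_form_of that)
  have rep: "\<exists>t\<in>covector_fields. \<tau> = form_of t" if "\<tau> \<in> Omega1 K" for \<tau>
    using form_of_coeff[OF that] coeff_field[OF that] by metis
  have field_add: "(\<lambda>g. r *\<^sub>R s g + t g) \<in> covector_fields" if "s \<in> covector_fields" "t \<in> covector_fields" for s t r
    by (intro covector_fields_add covector_fields_scale Cinf_const that)
  show "preconnection K br \<gamma>"
    unfolding preconnection_def
  proof (intro conjI ballI allI)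
    fix a \<tau>
    assume a: "a \<in> Cinf K" and "\<tau> \<in> Omega1 K"
    then obtain t where t: "t \<in> covector_fields" and \<tau>: "\<tau> = form_of t"
      using rep by blast
    show "\<gamma> a \<tau> \<in> Omega1 K"
      unfolding \<tau> \<gamma>[OF t] by (intro form_of_Omega1 nabla_field a t)
    fix b
    assume b: "b \<in> Cinf K"
    show "\<gamma> (\<lambda>g. r * a g + b g) \<tau> = form_add (form_mult (\<lambda>_. r) (\<gamma> a \<tau>)) (\<gamma> b \<tau>)" for r
    proof -
      have "nabla (\<lambda>g. r * a g + b g) t g = r *\<^sub>R nabla a t g + nabla b t g" for g
        by (rule blinfun_eqI) (simp add: nabla_def brc_apply blinfun.add_left blinfun.scaleR_left left_diff_add left_diff_scale
          pl_simps a b t Cinf_add Cinf_mult br_add_scale_left covector_fieldsD, simp add: algebra_simps)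
      then show ?thesis
        by (auto simp: \<tau> \<gamma>[OF t] form_add_form_of form_mult_form_of intro!: form_of_cong)
    qed
    show "\<gamma> (\<lambda>g. a g * b g) \<tau> = form_add (form_mult b (\<gamma> a \<tau>)) (form_mult a (\<gamma> b \<tau>))"
    proof -
      have "br (\<lambda>g. a g * b g) k g = b g * br a k g + a g * br b k g" if "k \<in> Cinf K" for k g
        using br_mult_right[OF that a b, of g] br_antisym[OF that] a b Cinf_mult[OF a b] by (simp add: algebra_simps)
      then have "nabla (\<lambda>g. a g * b g) t g = b g *\<^sub>R nabla a t g + a g *\<^sub>R nabla b t g" for g
        by (intro blinfun_eqI) (simp add: nabla_def brc_apply blinfun.add_left blinfun.scaleR_left left_diff_mult
          pl_simps a b t Cinf_mult covector_fieldsD, simp add: algebra_simps)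
      then show ?thesis
        by (auto simp: \<tau> \<gamma>[OF t] form_add_form_of form_mult_form_of intro!: form_of_cong)
    qed
    show "\<gamma> a (form_mult b \<tau>) = form_add (form_mult b (\<gamma> a \<tau>)) (form_mult (br a b) \<tau>)"
    proof -
      have "nabla a (\<lambda>g. b g *\<^sub>R t g) g = b g *\<^sub>R nabla a t g + br a b g *\<^sub>R t g" for g
        by (intro blinfun_eqI) (simp add: nabla_def brc_apply blinfun.add_left blinfun.scaleR_left
          pl_simps a b t covector_fields_scale covector_fieldsD br_mult_right, simp add: algebra_simps)
      then show ?thesis
        by (auto simp: \<tau> \<gamma>[OF t] \<gamma> covector_fields_scale b t form_add_form_of form_mult_form_of intro!: form_of_cong)
    qed
  next
    fix a \<tau> \<sigma> r
    assume a: "a \<in> Cinf K" and "\<tau> \<in> Omega1 K" "\<sigma> \<in> Omega1 K"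
    then obtain t s where t: "t \<in> covector_fields" and \<tau>: "\<tau> = form_of t" and s: "s \<in> covector_fields" and \<sigma>: "\<sigma> = form_of s"
      using rep by metis
    have "nabla a (\<lambda>g. r *\<^sub>R t g + s g) g = r *\<^sub>R nabla a t g + nabla a s g" for g
      by (intro blinfun_eqI) (simp add: nabla_def brc_apply blinfun.add_left blinfun.scaleR_left
        pl_simps a s t field_add covector_fieldsD br_add_scale_right, simp add: algebra_simps)
    then show "\<gamma> a (form_add (form_mult (\<lambda>_. r) \<tau>) \<sigma>) = form_add (form_mult (\<lambda>_. r) (\<gamma> a \<tau>)) (\<gamma> a \<sigma>)"
      by (auto simp: \<tau> \<sigma> \<gamma> s t field_add form_add_form_of form_mult_form_of intro!: form_of_cong)
  qed
  show "poisson_compatible K br \<gamma>"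
    unfolding poisson_compatible_def
  proof (intro ballI)
    fix a b
    assume a: "a \<in> Cinf K" and b: "b \<in> Cinf K"
    have "left_diff K (br a b) g = nabla a (left_diff K b) g - nabla b (left_diff K a) g" for g
    proof (rule blinfun_eqI)
      fix x
      have "br (\<lambda>g. L x a g) b g = - br b (\<lambda>g. L x a g) g"
        by (intro br_antisym L_Cinf a b)
      then show "left_diff K (br a b) g x = blinfun_apply (nabla a (left_diff K b) g - nabla b (left_diff K a) g) x"
        using L_br[OF a b, of x g]
        by (simp add: nabla_def blinfun.diff_left blinfun.add_left brc_apply left_diff_field a b
            flip: left_field_def pl_commutator)
    qed
    then show "ext_d K (br a b) = form_diff (\<gamma> a (ext_d K b)) (\<gamma> b (ext_d K a))"
      by (auto simp: ext_d_eq a b br_Cinf \<gamma> left_diff_field form_diff_form_of intro!: form_of_cong)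
  qed
  show "flat_preconnection K br \<gamma>"
    unfolding flat_preconnection_def
  proof (intro ballI)
    fix a b \<tau>
    assume a: "a \<in> Cinf K" and b: "b \<in> Cinf K" and "\<tau> \<in> Omega1 K"
    then obtain t where t: "t \<in> covector_fields" and \<tau>: "\<tau> = form_of t"
      using rep by blast
    show "form_diff (\<gamma> a (\<gamma> b \<tau>)) (\<gamma> b (\<gamma> a \<tau>)) = \<gamma> (br a b) \<tau>"
      by (auto simp: \<tau> \<gamma> t nabla_field a b form_diff_form_of nabla_flat intro!: form_of_cong)
  qed
  show "left_covariant K br \<gamma>"
    unfolding left_covariant_def
  proof (intro exI conjI ballI allI impI)
    show "bilinear pl"
      by (rule pl_bilinear)
    fix a and u :: "'e \<Rightarrow> 'g \<Rightarrow> real"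
    assume a: "a \<in> Cinf K" and u: "\<forall>k\<in>Basis. u k \<in> Cinf K"
    define t where "t g = (\<Sum>k\<in>Basis. u k g *\<^sub>R (blinfun_inner_left k :: 'e \<Rightarrow>\<^sub>L real))" for g
    have t: "t \<in> covector_fields"
      unfolding t_def[abs_def] using u by (intro covector_fields_sum covector_fields_scale covector_fields_const) auto
    have tk: "blinfun_apply (t g) k = u k g" if "k \<in> Basis" for g k
      using that by (simp add: t_def blinfun.sum_left blinfun.scaleR_left blinfun_inner_left.rep_eq inner_Basis if_distrib cong: if_cong)
    have "nabla a t g = (\<Sum>k\<in>Basis. (br a (u k) g + (\<Sum>i\<in>Basis. \<Sum>j\<in>Basis.
        blinfun_apply (pl (blinfun_inner_left i) (blinfun_inner_left j)) k * L i a g * u j g)) *\<^sub>R blinfun_inner_left k)" for g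
    proof -
      have "nabla a t g k = br a (u k) g + (\<Sum>i\<in>Basis. \<Sum>j\<in>Basis.
        blinfun_apply (pl (blinfun_inner_left i) (blinfun_inner_left j)) k * L i a g * u j g)" if "k \<in> Basis" for k
        unfolding nabla_def
        by (subst bilinear_blinfun_expansion[OF pl_bilinear])
          (simp add: blinfun.add_left blinfun.sum_left blinfun.scaleR_left brc_apply a t tk that left_field_def mult.commute mult.left_commute)
      then show ?thesis
        by (subst blinfun_Basis_expansion) simp
    qed
    then show "\<gamma> a (form_sum (\<lambda>k. form_mult (u k) (left_form K (blinfun_inner_left k))) Basis) =
        form_sum (\<lambda>k. form_mult (\<lambda>g. br a (u k) g + (\<Sum>i\<in>Basis. \<Sum>j\<in>Basis.
          blinfun_apply (pl (blinfun_inner_left i) (blinfun_inner_left j)) k * L i a g * u j g))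
          (left_form K (blinfun_inner_left k))) Basis"
      using \<gamma>[OF t, of a] by (auto simp: left_form_eq form_mult_form_of form_sum_form_of t_def[abs_def] intro!: form_of_cong)
  qed
qed

end

end

section \<open>Poisson-Lie groups\<close>

locale Poisson_Lie_group = Poisson_group K br
  for K :: "('g::{t2_space,second_countable_topology}, 'e::euclidean_space) lie_group_data" and br +
  fixes D :: "'g \<Rightarrow> 'e tensor2"
  assumes poisson_lie: "poisson_lie_group K br" and bivector: "left_bivector K br D"
begin

lemma left_diff_L_apply: "left_diff K f g x = L x f g"
  by (simp add: left_field_def)

lemma D_bilinear: "bilinear (D g)" and D_antisym: "D g \<phi> \<psi> = - D g \<psi> \<phi>"
  and D_Cinf: "(\<lambda>g. D g \<phi> \<psi>) \<in> Cinf K"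
  and br_eq: "f \<in> Cinf K \<Longrightarrow> h \<in> Cinf K \<Longrightarrow> br f h g = D g (left_diff K f g) (left_diff K h g)"
  using bivector unfolding left_bivector_def by blast+

lemmas D_simps = bilinear_ladd[OF D_bilinear] bilinear_radd[OF D_bilinear] bilinear_lmul[OF D_bilinear]
  bilinear_rmul[OF D_bilinear] bilinear_lsub[OF D_bilinear] bilinear_rsub[OF D_bilinear]
  bilinear_lneg[OF D_bilinear] bilinear_rneg[OF D_bilinear] bilinear_lzero[OF D_bilinear] bilinear_rzero[OF D_bilinear]

abbreviation "lb \<equiv> dual_bracket K D"

lemma lb_eq: "lb \<phi> \<psi> = left_diff K (\<lambda>g. D g \<phi> \<psi>) (one K)"
  by (simp add: dual_bracket_def cobracket_def left_field_def blinfun_apply_inverse)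

lemma lb_apply: "lb \<phi> \<psi> x = L x (\<lambda>g. D g \<phi> \<psi>) (one K)"
  by (simp add: lb_eq left_field_def)

lemma lb_bilinear: "bilinear lb"
  unfolding bilinear_def
  by (intro conjI allI linearI) (simp_all add: lb_eq D_simps left_diff_add left_diff_scale D_Cinf)

lemma lb_antisym: "lb \<phi> \<psi> = - lb \<psi> \<phi>"
proof -
  have "(\<lambda>g. D g \<phi> \<psi>) = (\<lambda>g. - D g \<psi> \<phi>)"
    using D_antisym by blast
  then show ?thesis
    by (simp add: lb_eq left_diff_minus D_Cinf)
qed

lemmas lb_simps = bilinear_ladd[OF lb_bilinear] bilinear_radd[OF lb_bilinear] bilinear_lmul[OF lb_bilinear]
  bilinear_rmul[OF lb_bilinear] bilinear_lsub[OF lb_bilinear] bilinear_rsub[OF lb_bilinear]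
  bilinear_lneg[OF lb_bilinear] bilinear_rneg[OF lb_bilinear] bilinear_lzero[OF lb_bilinear] bilinear_rzero[OF lb_bilinear]

abbreviation "T \<phi> f g \<equiv> dressing K D \<phi> f g"

lemma T_eq: "T \<phi> f g = D g \<phi> (left_diff K f g)"
proof -
  have l: "linear (D g \<phi>)"
    using D_bilinear by (simp add: bilinear_def)
  have "D g \<phi> (left_diff K f g) = (\<Sum>b\<in>Basis. left_diff K f g b * D g \<phi> (blinfun_inner_left b))"
    by (subst linear_blinfun_expansion[OF l]) simp
  then show ?thesis
    by (simp add: dressing_def contract_left_def left_field_def blinfun.sum_right blinfun.scaleR_right mult.commute)
qed

lemma br_T: "f \<in> Cinf K \<Longrightarrow> h \<in> Cinf K \<Longrightarrow> br f h g = T (left_diff K f g) h g"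
  by (simp add: br_eq T_eq)

lemmas D_field_closed = bilinear_field_closed[OF D_bilinear D_Cinf]
lemmas point_derivation_D = point_derivation_bilinear_field[OF _ D_bilinear D_Cinf]

lemma point_derivation_T: "point_derivation g (\<lambda>f. T \<phi> f g)"
  by (simp add: point_derivation_def T_eq D_simps left_diff_add left_diff_mult algebra_simps)

text \<open>In the second factor, left translation by \<open>g\<close> is absorbed by the
  left-invariant differential at \<open>g \<cdot> k\<close>. In the first factor right translates by
  \<open>k\<close> remain, and these carry the second derivatives in \<open>L_br\<close>.\<close>

lemma br_multiplicative:
  assumes "f \<in> Cinf K" "h \<in> Cinf K"
  shows "br f h (g \<cdot> k) = D g (left_diff K (\<lambda>a. f (a \<cdot> k)) g) (left_diff K (\<lambda>a. h (a \<cdot> k)) g)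
    + D k (left_diff K f (g \<cdot> k)) (left_diff K h (g \<cdot> k))"
proof -
  let ?m = "\<lambda>(a, b). a \<cdot> b"
  have "br f h \<circ> ?m = prod_bracket br br (f \<circ> ?m) (h \<circ> ?m)"
    using poisson_lie assms by (simp add: poisson_lie_group_def Let_def)
  from fun_cong[OF this, of "(g, k)"] show ?thesis
    using assms by (simp add: prod_bracket_def br_eq Cinf_translate left_diff_translate)
qed

text \<open>At the pair of units multiplicativity says that this value equals twice itself.\<close>

lemma D_one: "D (one K) \<phi> \<psi> = 0"
proof -
  obtain f h where fh: "f \<in> Cinf K" "left_diff K f (one K) = \<phi>" "h \<in> Cinf K" "left_diff K h (one K) = \<psi>"
    using exists_left_diff[of "one K" \<phi>] exists_left_diff[of "one K" \<psi>] by blast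
  from br_multiplicative[OF fh(1,3), of "one K" "one K"] show ?thesis
    by (simp add: fh br_eq)
qed

text \<open>Differentiating the multiplicativity of the bracket at the unit in the second argument;
  the derivative of the first summand is computed by the symmetry of second derivatives.\<close>

lemma L_br:
  assumes f: "f \<in> Cinf K" and h: "h \<in> Cinf K"
  shows "L x (br f h) g = br (\<lambda>g. L x f g) h g + br f (\<lambda>g. L x h g) g + lb (left_diff K f g) (left_diff K h g) x"
proof -
  let ?\<delta> = "\<lambda>f. L x f (one K)"
  define s where "s f k = left_diff K (\<lambda>a. f (a \<cdot> k)) g" for f k
  define t where "t f k = left_diff K f (g \<cdot> k)" for f k
  have s: "s f \<in> covector_fields" and ds: "covector_deriv ?\<delta> (s f) = left_diff K (\<lambda>g. L x f g) g"
    if f: "f \<in> Cinf K" for f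
  proof -
    show *: "s f \<in> covector_fields"
      using L_commute_right(1)[OF f] by (simp add: covector_fields_def s_def left_field_def)
    show "covector_deriv ?\<delta> (s f) = left_diff K (\<lambda>g. L x f g) g"
      using L_commute_right(2)[OF f, where x = x and g = g]
      by (intro blinfun_eqI) (simp add: covector_deriv_apply[OF point_derivation_L *], simp add: s_def left_diff_L_apply)
  qed
  have t: "t f \<in> covector_fields" if f: "f \<in> Cinf K" for f
    using Cinf_translate(1)[OF L_Cinf[OF f], where g = g] by (simp add: covector_fields_def t_def left_field_def)
  have "L x (br f h) g = ?\<delta> (\<lambda>k. br f h (g \<cdot> k))"
    by (simp add: L_translate)
  also have "\<dots> = ?\<delta> (\<lambda>k. D g (s f k) (s h k) + D k (t f k) (t h k))"
    by (simp add: br_multiplicative[OF f h] s_def t_def)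
  also have "\<dots> = ?\<delta> (\<lambda>k. D g (s f k) (s h k)) + ?\<delta> (\<lambda>k. D k (t f k) (t h k))"
    by (intro L_add bilinear_closed[OF D_bilinear] D_field_closed s t f h)
  also have "?\<delta> (\<lambda>k. D g (s f k) (s h k)) = br (\<lambda>g. L x f g) h g + br f (\<lambda>g. L x h g) g"
    unfolding point_derivation_bilinear[OF point_derivation_L D_bilinear s[OF f] s[OF h]] ds[OF f] ds[OF h]
    by (simp add: f h br_eq L_Cinf s_def)
  \<comment> \<open>Since the bivector vanishes at the unit, the derivatives of its arguments drop
    out; the derivative of \<open>D\<close> itself is the cobracket.\<close>
  also have "?\<delta> (\<lambda>k. D k (t f k) (t h k)) = lb (left_diff K f g) (left_diff K h g) x"
    unfolding point_derivation_D[OF point_derivation_L t[OF f] t[OF h]]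
    by (simp add: D_one lb_apply t_def)
  finally show ?thesis .
qed

section \<open>Commutation rules for left-invariant and dressing fields\<close>

definition coad :: "'e \<Rightarrow> ('e \<Rightarrow>\<^sub>L real) \<Rightarrow> ('e \<Rightarrow>\<^sub>L real)" where
  "coad x \<phi> = Blinfun (\<lambda>y. blinfun_apply \<phi> (adj x y))"

text \<open>The transpose of \<open>adj x\<close>, without the minus sign of the usual coadjoint
  action.\<close>

lemma coad_apply [simp]: "coad x \<phi> y = blinfun_apply \<phi> (adj x y)"
proof -
  have "bounded_linear (\<lambda>y. blinfun_apply \<phi> (adj x y))"
    using linear_adj(2) by (intro bounded_linear_compose[OF blinfun.bounded_linear_right]) (simp add: linear_conv_bounded_linear)
  then show ?thesis
    by (simp add: coad_def bounded_linear_Blinfun_apply)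
qed

text \<open>This is \<open>L_commutator\<close> with the second direction left free: exchanging the
  two derivatives costs \<open>adj x y\<close>, which turns into a coadjoint term on the
  differential.\<close>

lemma left_diff_L:
  assumes f: "f \<in> Cinf K"
  shows "left_diff K (\<lambda>g. L x f g) g = covector_deriv (\<lambda>f. L x f g) (left_diff K f) - coad x (left_diff K f g)"
proof (rule blinfun_eqI)
  fix y
  show "left_diff K (\<lambda>g. L x f g) g y
      = blinfun_apply (covector_deriv (\<lambda>f. L x f g) (left_diff K f) - coad x (left_diff K f g)) y"
    using L_commutator[OF f, of x y g]
    by (simp add: blinfun.diff_left covector_deriv_apply[OF point_derivation_L left_diff_field[OF f]] flip: left_field_def)
qed

lemma covector_deriv_const: "point_derivation g \<delta> \<Longrightarrow> covector_deriv \<delta> (\<lambda>_. \<phi>) = 0"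
  by (simp add: covector_deriv_def point_derivationD(1))

lemma point_derivation_T_fun:
  assumes \<delta>: "point_derivation g \<delta>" and f: "f \<in> Cinf K"
  shows "\<delta> (\<lambda>k. T \<phi> f k) = D g \<phi> (covector_deriv \<delta> (left_diff K f)) + \<delta> (\<lambda>k. D k \<phi> (left_diff K f g))"
  using point_derivation_D[OF \<delta> covector_fields_const[of \<phi>] left_diff_field[OF f]]
  by (simp add: T_eq covector_deriv_const[OF \<delta>] D_simps)

text \<open>Collects all second derivatives of \<open>f\<close> in the first term, so that they can
  cancel when a bracket is differentiated in two ways.\<close>

lemma point_derivation_br_T:
  assumes \<delta>: "point_derivation g \<delta>" and f: "f \<in> Cinf K" and h: "h \<in> Cinf K"
  shows "\<delta> (br f h) = D g (covector_deriv \<delta> (left_diff K f)) (left_diff K h g) + \<delta> (\<lambda>k. T (left_diff K f g) h k)"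
proof -
  have "br f h = (\<lambda>k. D k (left_diff K f k) (left_diff K h k))"
    by (simp add: fun_eq_iff br_eq f h)
  then show ?thesis
    using point_derivation_D[OF \<delta> left_diff_field[OF f] left_diff_field[OF h]] point_derivation_T_fun[OF \<delta> h]
    by simp
qed

text \<open>Take \<open>F\<close> with differential \<open>\<phi>\<close> at \<open>g\<close> and
  compute \<open>L x (br F f) g\<close> by the product rule and by \<open>L_br\<close>. The second
  derivatives of \<open>F\<close> agree and cancel; their exchange by \<open>left_diff_L\<close>
  leaves the term with \<open>coad x \<phi>\<close>.\<close>

lemma L_T:
  assumes f: "f \<in> Cinf K"
  shows "L x (\<lambda>g. T \<phi> f g) g = T \<phi> (\<lambda>g. L x f g) g - T (coad x \<phi>) f g + lb \<phi> (left_diff K f g) x"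
proof -
  obtain F where F: "F \<in> Cinf K" "left_diff K F g = \<phi>"
    using exists_left_diff[of g \<phi>] by blast
  have "L x (br F f) g = D g (covector_deriv (\<lambda>f. L x f g) (left_diff K F)) (left_diff K f g) + L x (\<lambda>g. T \<phi> f g) g"
    using point_derivation_br_T[OF point_derivation_L F(1) f] by (simp add: F(2))
  moreover have "L x (br F f) g = D g (covector_deriv (\<lambda>f. L x f g) (left_diff K F) - coad x \<phi>) (left_diff K f g)
      + T \<phi> (\<lambda>g. L x f g) g + lb \<phi> (left_diff K f g) x"
    using L_br[OF F(1) f, of x g] by (simp add: br_eq L_Cinf F f left_diff_L[OF F(1)] T_eq)
  ultimately show ?thesis
    by (simp add: T_eq D_simps)
qed

text \<open>Follows from \<open>L_T\<close> for a function with differential \<open>\<psi>\<close>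
  at \<open>g\<close>: the second derivatives of that function cancel in the same manner, and the
  second coadjoint term appears.\<close>

lemma L_D: "L x (\<lambda>g. D g \<phi> \<psi>) g = lb \<phi> \<psi> x - D g (coad x \<phi>) \<psi> - D g \<phi> (coad x \<psi>)"
proof -
  obtain f where f: "f \<in> Cinf K" "left_diff K f g = \<psi>"
    using exists_left_diff[of g \<psi>] by blast
  have "L x (\<lambda>g. T \<phi> f g) g = D g \<phi> (covector_deriv (\<lambda>f. L x f g) (left_diff K f)) + L x (\<lambda>g. D g \<phi> \<psi>) g"
    using point_derivation_T_fun[OF point_derivation_L f(1)] by (simp add: f(2))
  then show ?thesis
    using L_T[OF f(1), of x \<phi> g] by (simp add: T_eq f(2) left_diff_L[OF f(1)] D_simps)
qed

text \<open>The Jacobi identity for functions with differentials \<open>\<phi>\<close> and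
  \<open>\<psi>\<close> at \<open>g\<close>. Their second derivatives, \<open>?f\<close> and
  \<open>?h\<close>, occur in the nested brackets and in the differential of \<open>br f h\<close>;
  after cancellation only \<open>lb \<phi> \<psi>\<close> survives. So the dressing fields represent
  the dual Lie algebra.\<close>

lemma T_commutator:
  assumes k: "k \<in> Cinf K"
  shows "T \<phi> (\<lambda>g. T \<psi> k g) g - T \<psi> (\<lambda>g. T \<phi> k g) g = T (lb \<phi> \<psi>) k g"
proof -
  obtain f h where fh: "f \<in> Cinf K" "left_diff K f g = \<phi>" "h \<in> Cinf K" "left_diff K h g = \<psi>"
    using exists_left_diff[of g \<phi>] exists_left_diff[of g \<psi>] by blast
  let ?f = "covector_deriv (\<lambda>p. T \<psi> p g) (left_diff K f)" and ?h = "covector_deriv (\<lambda>p. T \<phi> p g) (left_diff K h)"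
  have 1: "br f (br h k) g = D g ?h (left_diff K k g) + T \<phi> (\<lambda>g. T \<psi> k g) g"
    using point_derivation_br_T[OF point_derivation_T fh(3) k] by (simp add: br_T[OF fh(1)] br_Cinf fh k)
  have 2: "br h (br f k) g = D g ?f (left_diff K k g) + T \<psi> (\<lambda>g. T \<phi> k g) g"
    using point_derivation_br_T[OF point_derivation_T fh(1) k] by (simp add: br_T[OF fh(3)] br_Cinf fh k)
  have "left_diff K (br f h) g = ?h - ?f + lb \<phi> \<psi>"
  proof (rule blinfun_eqI)
    fix x
    have "br (\<lambda>g. L x f g) h g = - br h (\<lambda>g. L x f g) g"
      by (intro br_antisym L_Cinf fh)
    then show "left_diff K (br f h) g x = blinfun_apply (?h - ?f + lb \<phi> \<psi>) x"
      using L_br[OF fh(1,3), of x g] covector_deriv_apply[OF point_derivation_T[of g \<psi>] left_diff_field[OF fh(1)], of x]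
        covector_deriv_apply[OF point_derivation_T[of g \<phi>] left_diff_field[OF fh(3)], of x]
      by (simp add: blinfun.diff_left blinfun.add_left br_T L_Cinf fh flip: left_field_def)
  qed
  then have 3: "br (br f h) k g = D g (?h - ?f + lb \<phi> \<psi>) (left_diff K k g)"
    by (simp add: br_eq br_Cinf fh k)
  have "br h (br k f) g = - br h (br f k) g"
  proof -
    have "br k f = (\<lambda>g. - br f k g)"
      using br_antisym[OF k fh(1)] by blast
    then show ?thesis
      by (simp add: point_derivationD(6)[OF point_derivation_br[OF fh(3)]] br_Cinf fh k)
  qed
  then have "br f (br h k) g - br h (br f k) g = br (br f h) k g"
    using br_jacobi[OF fh(1,3) k, of g] br_antisym[OF k br_Cinf[OF fh(1,3)], of g] by simp
  then show ?thesis
    by (simp add: 1 2 3 T_eq D_simps)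
qed

text \<open>The commutator of two left-invariant fields, applied to \<open>D\<close> at the unit.
  The first derivative is known everywhere by \<open>L_D\<close>; differentiating it again, its
  constant term disappears and each \<open>D\<close> becomes \<open>lb\<close>.\<close>

lemma lb_cocycle:
  "lb \<phi> \<psi> (adj x u) = lb (coad x \<phi>) \<psi> u + lb \<phi> (coad x \<psi>) u
    - lb (coad u \<phi>) \<psi> x - lb \<phi> (coad u \<psi>) x"
proof -
  have LL: "L u (\<lambda>g. L x (\<lambda>g. D g \<phi> \<psi>) g) (one K) = - lb (coad x \<phi>) \<psi> u - lb \<phi> (coad x \<psi>) u" for u x
    unfolding L_D by (simp add: L_diff D_Cinf Cinf_diff lb_apply)
  have "L (adj x u) (\<lambda>g. D g \<phi> \<psi>) (one K) = L x (\<lambda>g. L u (\<lambda>g. D g \<phi> \<psi>) g) (one K) - L u (\<lambda>g. L x (\<lambda>g. D g \<phi> \<psi>) g) (one K)"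
    by (simp add: L_commutator[OF D_Cinf])
  then show ?thesis
    by (simp add: LL flip: lb_apply)
qed

end

section \<open>The tangent bundle as a Lie group\<close>

lemma chart_deriv_Pair:
  assumes A: "smooth_atlas A" and B: "smooth_atlas B" and C: "smooth_atlas C"
    and F: "smooth_map A B F" and H: "smooth_map A C H"
    and c: "c \<in> A" "d \<in> B" "e \<in> C" "p \<in> dom c" "F p \<in> dom d" "H p \<in> dom e"
  shows "chart_deriv c (prod_chart d e) (\<lambda>p. (F p, H p)) p x = (chart_deriv c d F p x, chart_deriv c e H p x)"
proof -
  have "((\<lambda>u. crd (prod_chart d e) (F (inv_crd c u), H (inv_crd c u))) has_derivative
      (\<lambda>x. (chart_deriv c d F p x, chart_deriv c e H p x))) (at (crd c p))"
    using has_derivative_Pair[OF chart_deriv_works[OF A B F c(1,2,4,5)] chart_deriv_works[OF A C H c(1,3,4,6)]]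
    by simp
  then show ?thesis
    unfolding chart_deriv_def[of c "prod_chart d e"] by (simp flip: frechet_derivative_at)
qed

lemma chart_deriv_linear_compose:
  assumes A: "smooth_atlas A" and F: "smooth_map A {id_chart} F" and c: "c \<in> A" "p \<in> dom c"
    and l: "bounded_linear l"
  shows "chart_deriv c id_chart (\<lambda>p. l (F p)) p x = l (chart_deriv c id_chart F p x)"
proof -
  have "((\<lambda>u. l (F (inv_crd c u))) has_derivative (\<lambda>x. l (chart_deriv c id_chart F p x))) (at (crd c p))"
    using bounded_linear.has_derivative[OF l chart_deriv_works[OF A smooth_atlas_id F c(1) _ c(2), of id_chart]] by simp
  then show ?thesis
    unfolding chart_deriv_def[of c id_chart "\<lambda>p. l (F p)"] by (simp flip: frechet_derivative_at)
qed

context Lie_group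
begin

abbreviation "TK \<equiv> tangent_group K"

lemma tangent_group_simps [simp]:
  "atlas TK = prod_atlas (atlas K) {id_chart}"
  "mult TK p q = (fst p \<cdot> fst q, Ad K (inverse_of (fst q)) (snd p) + snd q)"
  "one TK = (one K, 0)"
  "ginv TK p = (inverse_of (fst p), - Ad K (fst p) (snd p))"
  "base_chart TK = prod_chart bc id_chart"
  by (simp_all add: tangent_group_def split_beta)

text \<open>\<open>smooth_Ad\<close> treats a fixed vector; the basis expansion extends it to a
  vector that varies with the point.\<close>

lemma smooth_Ad_apply:
  assumes M: "smooth_atlas M" and f: "smooth_map M (atlas K) f" and h: "smooth_map M {id_chart} h"
  shows "smooth_map M {id_chart} (\<lambda>p. Ad K (f p) (h p))"
proof -
  have "Ad K (f p) (h p) = (\<Sum>b\<in>Basis. (h p \<bullet> b) *\<^sub>R Ad K (f p) b)" for p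
    by (rule Ad_expand)
  moreover have "smooth_map M {id_chart} (\<lambda>p. \<Sum>b\<in>Basis. (h p \<bullet> b) *\<^sub>R Ad K (f p) b)"
    by (rule smooth_map_sum[OF M], rule smooth_map_bilinear[OF M bounded_bilinear_scaleR])
      (rule smooth_map_linear[OF M bounded_linear_inner_left h],
        rule smooth_map_compose[OF M atlas smooth_atlas_id f smooth_Ad])
  ultimately show ?thesis
    by simp
qed

lemma tangent_atlas: "smooth_atlas (prod_atlas (atlas K) ({id_chart} :: ('e, 'e) chart set))"
  by (rule smooth_atlas_prod[OF atlas smooth_atlas_id])

lemmas smooth_base = smooth_map_fst[OF atlas smooth_atlas_id]
lemmas smooth_fibre = smooth_map_snd[OF atlas smooth_atlas_id]

lemma tangent_lie_group: "lie_group TK"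
proof -
  let ?A = "prod_atlas (atlas K) ({id_chart} :: ('e, 'e) chart set)"
  note AA = smooth_atlas_prod[OF tangent_atlas tangent_atlas]
  note s1 = smooth_map_fst[OF tangent_atlas tangent_atlas] and s2 = smooth_map_snd[OF tangent_atlas tangent_atlas]
  note g1 = smooth_map_compose[OF AA tangent_atlas atlas s1 smooth_base]
  note g2 = smooth_map_compose[OF AA tangent_atlas atlas s2 smooth_base]
  note x1 = smooth_map_compose[OF AA tangent_atlas smooth_atlas_id s1 smooth_fibre]
  note x2 = smooth_map_compose[OF AA tangent_atlas smooth_atlas_id s2 smooth_fibre]
  have mul: "smooth_map (prod_atlas ?A ?A) ?A (\<lambda>p. (fst (fst p) \<cdot> fst (snd p),
      Ad K (inverse_of (fst (snd p))) (snd (fst p)) + snd (snd p)))"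
    by (intro smooth_map_Pair[OF AA atlas smooth_atlas_id] smooth_mul[OF AA] smooth_map_add[OF AA] smooth_Ad_apply[OF AA]
        smooth_inverse[OF AA] g1 g2 x1 x2)
  have inv: "smooth_map ?A ?A (\<lambda>p. (inverse_of (fst p), - Ad K (fst p) (snd p)))"
    by (intro smooth_map_Pair[OF tangent_atlas atlas smooth_atlas_id] smooth_inverse[OF tangent_atlas]
        smooth_map_linear[OF tangent_atlas bounded_linear_minus[OF bounded_linear_ident]]
        smooth_Ad_apply[OF tangent_atlas] smooth_base smooth_fibre)
  show ?thesis
    unfolding lie_group_def tangent_group_simps
  proof (intro conjI allI)
    show "smooth_atlas ?A"
      by (rule tangent_atlas)
    show "prod_chart bc id_chart \<in> ?A"
      using base_chart by (auto simp: prod_atlas_iff)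
    show "(one K, 0) \<in> dom (prod_chart bc id_chart)"
      using one_in_base by simp
  next
    show "smooth_map (prod_atlas ?A ?A) ?A
      (\<lambda>(a, b). (fst a \<cdot> fst b, Ad K (inverse_of (fst b)) (snd a) + snd b))"
      using mul by (simp only: case_prod_unfold)
    show "smooth_map ?A ?A (\<lambda>p. (inverse_of (fst p), - Ad K (fst p) (snd p)))"
      by (rule inv)
  qed (simp_all add: mul_assoc inverse_mul Ad_mul linear_add[OF linear_Ad] linear_neg[OF linear_Ad] linear_0[OF linear_Ad])
qed

lemma Lie_group_tangent: "Lie_group TK"
  by (rule Lie_group.intro) (rule tangent_lie_group)

lemma tangent_function_algebra: "function_algebra (Cinf TK)"
  by (rule function_algebra.intro)
    (rule Lie_group.Cinf_const[OF Lie_group_tangent] Lie_group.Cinf_add[OF Lie_group_tangent]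
      Lie_group.Cinf_mult[OF Lie_group_tangent], assumption?, assumption?)+

end

section \<open>Calculus on the tangent bundle\<close>

text \<open>\<open>fibre_diff\<close> as a function of a point of the tangent bundle, so that it can
  be handled as a covector field.\<close>

definition vert :: "('g \<times> 'e::euclidean_space \<Rightarrow> real) \<Rightarrow> 'g \<times> 'e \<Rightarrow> 'e \<Rightarrow>\<^sub>L real" where
  "vert a p = fibre_diff a (fst p) (snd p)"

context Lie_group
begin

interpretation FT: function_algebra "Cinf TK"
  by (rule tangent_function_algebra)

text \<open>\<open>hor\<close> differentiates along \<open>G\<close> with the fibre coordinate fixed. This is not left-invariant on the
  tangent group: the correction is the term \<open>adj x (snd p)\<close> in \<open>tangent_left_diff\<close> below.\<close>

definition hor :: "('g \<times> 'e \<Rightarrow> real) \<Rightarrow> 'g \<times> 'e \<Rightarrow> 'e \<Rightarrow>\<^sub>L real" where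
  "hor a p = left_diff K (\<lambda>g. a (g, snd p)) (fst p)"

lemma tangent_Cinf_iff: "a \<in> Cinf TK \<longleftrightarrow> smooth_map (prod_atlas (atlas K) {id_chart}) {id_chart} a"
  by (simp add: Cinf_def)

lemma slice_base: "a \<in> Cinf TK \<Longrightarrow> (\<lambda>g. a (g, u)) \<in> Cinf K"
  unfolding tangent_Cinf_iff Cinf_iff by (rule smooth_map_slice_fst[OF atlas smooth_atlas_id smooth_atlas_id])

lemma slice_fibre: "a \<in> Cinf TK \<Longrightarrow> smooth_on UNIV (\<lambda>u. a (g, u))"
  unfolding tangent_Cinf_iff smooth_map_euclidean[symmetric]
  by (rule smooth_map_slice_snd[OF atlas smooth_atlas_id smooth_atlas_id])

lemma base_fun_Cinf: "f \<in> Cinf K \<Longrightarrow> (\<lambda>p. f (fst p)) \<in> Cinf TK"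
  unfolding tangent_Cinf_iff Cinf_iff by (rule smooth_map_compose[OF tangent_atlas atlas smooth_atlas_id smooth_base])

lemma fibre_fun_Cinf: "smooth_on UNIV f \<Longrightarrow> (\<lambda>p. f (snd p)) \<in> Cinf TK"
  unfolding tangent_Cinf_iff smooth_map_euclidean[symmetric]
  by (rule smooth_map_compose[OF tangent_atlas smooth_atlas_id smooth_atlas_id smooth_fibre])

lemma vert_has_derivative:
  assumes "a \<in> Cinf TK"
  shows "((\<lambda>y. a (fst p, y)) has_derivative blinfun_apply (vert a p)) (at (snd p))"
proof -
  have "((\<lambda>y. a (fst p, y)) has_derivative frechet_derivative (\<lambda>y. a (fst p, y)) (at (snd p))) (at (snd p))"
    by (rule smooth_on_has_derivative[OF slice_fibre[OF assms]]) simp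
  then show ?thesis
    by (simp add: vert_def fibre_diff_def bounded_linear_Blinfun_apply[OF has_derivative_bounded_linear])
qed

lemma vert_apply: "a \<in> Cinf TK \<Longrightarrow> vert a p y = frechet_derivative (\<lambda>y. a (fst p, y)) (at (snd p)) y"
  by (simp flip: frechet_derivative_at[OF vert_has_derivative])

text \<open>Places the point \<open>p\<close> and the increment \<open>v\<close> in separate
  variables, so that smoothness in \<open>p\<close> follows from joint smoothness.\<close>

lemma vert_eq:
  "a \<in> Cinf TK \<Longrightarrow> vert a p y = chart_deriv id_chart id_chart (\<lambda>v. a (fst p, snd p + v)) 0 y"
  unfolding vert_apply chart_deriv_def by (simp add: frechet_derivative_shift[where f = "\<lambda>y. a (fst p, y)"])

lemma vert_unique:
  "((\<lambda>y. a (fst p, y)) has_derivative blinfun_apply \<phi>) (at (snd p)) \<Longrightarrow> vert a p = \<phi>"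
  unfolding vert_def fibre_diff_def by (simp add: blinfun_apply_inverse flip: frechet_derivative_at)

lemma vert_const: "vert (\<lambda>p. r) p = 0"
  by (rule vert_unique) (simp add: zero_blinfun.rep_eq)

lemma vert_add: "a \<in> Cinf TK \<Longrightarrow> b \<in> Cinf TK \<Longrightarrow> vert (\<lambda>p. a p + b p) p = vert a p + vert b p"
  by (rule vert_unique) (simp add: plus_blinfun.rep_eq has_derivative_add vert_has_derivative)

lemma vert_mult:
  assumes "a \<in> Cinf TK" "b \<in> Cinf TK"
  shows "vert (\<lambda>p. a p * b p) p = b p *\<^sub>R vert a p + a p *\<^sub>R vert b p"
  by (rule vert_unique, rule has_derivative_eq_rhs[OF has_derivative_mult[OF vert_has_derivative[OF assms(1)] vert_has_derivative[OF assms(2)]]])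
    (simp add: fun_eq_iff blinfun.add_left blinfun.scaleR_left)

lemma hor_const: "hor (\<lambda>p. r) p = 0"
  and hor_add: "a \<in> Cinf TK \<Longrightarrow> b \<in> Cinf TK \<Longrightarrow> hor (\<lambda>p. a p + b p) p = hor a p + hor b p"
  and hor_mult: "a \<in> Cinf TK \<Longrightarrow> b \<in> Cinf TK \<Longrightarrow> hor (\<lambda>p. a p * b p) p = b p *\<^sub>R hor a p + a p *\<^sub>R hor b p"
  by (simp_all add: hor_def left_diff_add left_diff_mult slice_base)

lemma hor_eq: "a \<in> Cinf TK \<Longrightarrow> hor a p x = chart_deriv bc id_chart (\<lambda>h. a (fst p \<cdot> h, snd p)) (one K) x"
  by (simp add: hor_def left_diff_apply slice_base)

lemma point_derivation_vert: "FT.point_derivation p (\<lambda>a. vert a p y)"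
  by (simp add: FT.point_derivation_def vert_const vert_add vert_mult blinfun.add_left blinfun.scaleR_left)

lemma point_derivation_hor: "FT.point_derivation p (\<lambda>a. hor a p x)"
  by (simp add: FT.point_derivation_def hor_const hor_add hor_mult blinfun.add_left blinfun.scaleR_left)

lemma vert_Cinf:
  assumes a: "a \<in> Cinf TK"
  shows "(\<lambda>p. vert a p y) \<in> Cinf TK"
proof -
  note M = smooth_atlas_prod[OF tangent_atlas smooth_atlas_id]
  note s1 = smooth_map_fst[OF tangent_atlas smooth_atlas_id] and s2 = smooth_map_snd[OF tangent_atlas smooth_atlas_id]
  have "smooth_map (prod_atlas (prod_atlas (atlas K) ({id_chart} :: ('e, 'e) chart set)) ({id_chart} :: ('e, 'e) chart set)) {id_chart}
      (\<lambda>q. a (fst (fst q), snd (fst q) + snd q))"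
    by (rule smooth_map_compose[OF M tangent_atlas smooth_atlas_id _ a[unfolded tangent_Cinf_iff]],
        intro smooth_map_Pair[OF M atlas smooth_atlas_id] smooth_map_add[OF M] s2
          smooth_map_compose[OF M tangent_atlas atlas s1 smooth_base] smooth_map_compose[OF M tangent_atlas smooth_atlas_id s1 smooth_fibre])
  from smooth_map_chart_deriv_snd[OF tangent_atlas smooth_atlas_id this, of id_chart 0 y]
  show ?thesis
    by (simp add: tangent_Cinf_iff vert_eq[OF a])
qed

lemma hor_Cinf:
  assumes a: "a \<in> Cinf TK"
  shows "(\<lambda>p. hor a p x) \<in> Cinf TK"
proof -
  note M = smooth_atlas_prod[OF tangent_atlas atlas]
  note s1 = smooth_map_fst[OF tangent_atlas atlas] and s2 = smooth_map_snd[OF tangent_atlas atlas]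
  have "smooth_map (prod_atlas (prod_atlas (atlas K) ({id_chart} :: ('e, 'e) chart set)) (atlas K)) {id_chart}
      (\<lambda>q. a (fst (fst q) \<cdot> snd q, snd (fst q)))"
    by (rule smooth_map_compose[OF M tangent_atlas smooth_atlas_id _ a[unfolded tangent_Cinf_iff]],
        intro smooth_map_Pair[OF M atlas smooth_atlas_id] smooth_mul[OF M] s2
          smooth_map_compose[OF M tangent_atlas atlas s1 smooth_base] smooth_map_compose[OF M tangent_atlas smooth_atlas_id s1 smooth_fibre])
  from smooth_map_chart_deriv_snd[OF tangent_atlas atlas this base_chart one_in_base, of x]
  show ?thesis
    by (simp add: tangent_Cinf_iff hor_eq[OF a])
qed

lemma vert_field: "a \<in> Cinf TK \<Longrightarrow> vert a \<in> FT.covector_fields"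
  and hor_field: "a \<in> Cinf TK \<Longrightarrow> hor a \<in> FT.covector_fields"
  by (simp_all add: FT.covector_fields_def vert_Cinf hor_Cinf)

lemma vert_vert:
  assumes a: "a \<in> Cinf TK"
  shows "vert (\<lambda>p. blinfun_apply (vert a p) y) p z = vert (\<lambda>p. blinfun_apply (vert a p) z) p y"
  using second_derivative_symmetric[OF slice_fibre[OF a] open_UNIV UNIV_I, of "fst p" y "snd p" z]
  by (simp add: vert_apply[OF vert_Cinf[OF a]], simp add: vert_apply[OF a])

text \<open>Both sides differentiate \<open>a (fst p \<cdot> h, snd p + v)\<close> at
  \<open>h = one K\<close> and \<open>v = 0\<close>, where \<open>h\<close> and \<open>v\<close> are
  independent.\<close>

lemma vert_hor:
  assumes a: "a \<in> Cinf TK"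
  shows "vert (\<lambda>p. blinfun_apply (hor a p) x) p y = hor (\<lambda>p. blinfun_apply (vert a p) y) p x"
proof -
  note M = smooth_atlas_prod[OF smooth_atlas_id atlas]
  note s1 = smooth_map_fst[OF smooth_atlas_id atlas] and s2 = smooth_map_snd[OF smooth_atlas_id atlas]
  have F: "smooth_map (prod_atlas ({id_chart} :: ('e, 'e) chart set) (atlas K)) {id_chart} (\<lambda>q. a (fst p \<cdot> snd q, snd p + fst q))"
    by (rule smooth_map_compose[OF M tangent_atlas smooth_atlas_id _ a[unfolded tangent_Cinf_iff]],
        intro smooth_map_Pair[OF M atlas smooth_atlas_id] smooth_mul[OF M] smooth_map_add[OF M] s1 s2
          smooth_map_const[OF M atlas] smooth_map_const[OF M smooth_atlas_id])
  show ?thesis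
    using chart_deriv_commute[OF smooth_atlas_id atlas F _ base_chart _ one_in_base, of id_chart 0 x y]
    by (simp add: vert_eq[OF hor_Cinf[OF a]] hor_eq[OF vert_Cinf[OF a]], simp add: vert_eq[OF a] hor_eq[OF a])
qed

text \<open>Right multiplication by \<open>(h, v)\<close> sends a fibre point \<open>u\<close> to
  \<open>Ad K (inverse_of h) u + v\<close>. Hence the direction \<open>x\<close> in the group moves
  the fibre coordinate with velocity \<open>- adj x u\<close>.\<close>

lemma tangent_left_diff:
  assumes a: "a \<in> Cinf TK"
  shows "left_diff TK a p (x, y) = hor a p x + vert a p (y - adj x (snd p))"
proof -
  obtain g u where p: "p = (g, u)"
    by (cases p)
  let ?A = "{id_chart} :: ('e, 'e) chart set"
  \<comment> \<open>\<open>h\<close> enters \<open>a\<close> both through the base point and through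
    \<open>Ad\<close>; \<open>H\<close> separates the two occurrences so that the chain rule
    applies.\<close>
  define H where "H q = a (g \<cdot> fst q, snd q)" for q
  have H: "smooth_map (prod_atlas (atlas K) ?A) {id_chart} H"
    unfolding H_def
    by (rule smooth_map_compose[OF tangent_atlas tangent_atlas smooth_atlas_id _ a[unfolded tangent_Cinf_iff]],
        intro smooth_map_Pair[OF tangent_atlas atlas smooth_atlas_id] smooth_mul[OF tangent_atlas]
          smooth_map_const[OF tangent_atlas atlas] smooth_base smooth_fibre)
  have Ad: "smooth_map (atlas K) ?A (\<lambda>h. Ad K (inverse_of h) u)"
    by (intro smooth_Ad_apply[OF atlas] smooth_inverse[OF atlas] smooth_ident smooth_map_const[OF atlas smooth_atlas_id])
  have dAd: "chart_deriv bc id_chart (\<lambda>h. Ad K (inverse_of h) u) (one K) x = - adj x u"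
  proof (rule euclidean_eqI)
    fix b
    have "chart_deriv bc id_chart (\<lambda>h. Ad K (inverse_of h) u) (one K) x \<bullet> b
        = chart_deriv bc id_chart (\<lambda>h. Ad K (inverse_of h) u \<bullet> b) (one K) x"
      by (rule chart_deriv_linear_compose[OF atlas Ad base_chart one_in_base bounded_linear_inner_left, symmetric])
    also have "\<dots> = L x (\<lambda>h. Ad K (inverse_of h) u \<bullet> b) (one K)"
      by (simp add: L_eq[OF Ad_inverse_Cinf])
    finally show "chart_deriv bc id_chart (\<lambda>h. Ad K (inverse_of h) u) (one K) x \<bullet> b = - adj x u \<bullet> b"
      by (simp add: L_Ad_inverse)
  qed
  have F: "smooth_map (prod_atlas (atlas K) ?A) {id_chart} (\<lambda>q. a (mult TK p q))"
    using Lie_group.Cinf_translate(1)[OF Lie_group_tangent a, of p] by (simp only: tangent_Cinf_iff)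
  have pc: "prod_chart bc id_chart \<in> prod_atlas (atlas K) ?A"
    using base_chart by (auto simp: prod_atlas_iff)
  have "left_diff TK a p (x, y) = chart_deriv (prod_chart bc id_chart) id_chart (\<lambda>q. a (mult TK p q)) (one K, 0) (x, y)"
    using Lie_group.left_diff_apply[OF Lie_group_tangent a, of p] by simp
  also have "\<dots> = chart_deriv bc id_chart (\<lambda>h. a (mult TK p (h, 0))) (one K) x
      + chart_deriv id_chart id_chart (\<lambda>v. a (mult TK p (one K, v))) 0 y"
    by (rule chart_deriv_prod[OF atlas smooth_atlas_id smooth_atlas_id F base_chart _ _ one_in_base]) auto
  also have "chart_deriv id_chart id_chart (\<lambda>v. a (mult TK p (one K, v))) 0 y = vert a p y"
    by (simp add: vert_eq[OF a])
  also have "chart_deriv bc id_chart (\<lambda>h. a (mult TK p (h, 0))) (one K) x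
      = chart_deriv bc id_chart (\<lambda>h. H (h, Ad K (inverse_of h) u)) (one K) x"
    by (simp add: p H_def)
  also have "\<dots> = chart_deriv (prod_chart bc id_chart) id_chart H (one K, u)
      (chart_deriv bc (prod_chart bc id_chart) (\<lambda>h. (h, Ad K (inverse_of h) u)) (one K) x)"
    using chart_deriv_compose[OF atlas tangent_atlas smooth_atlas_id smooth_map_Pair[OF atlas atlas smooth_atlas_id smooth_ident Ad] H
        base_chart _ _ one_in_base, of "prod_chart bc id_chart" id_chart x] pc one_in_base
    by simp
  also have "chart_deriv bc (prod_chart bc id_chart) (\<lambda>h. (h, Ad K (inverse_of h) u)) (one K) x = (x, - adj x u)"
    using chart_deriv_Pair[OF atlas atlas smooth_atlas_id smooth_ident Ad base_chart base_chart _ one_in_base one_in_base, of id_chart x]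
    by (simp add: chart_deriv_ident[OF base one_in_base] dAd)
  also have "chart_deriv (prod_chart bc id_chart) id_chart H (one K, u) (x, - adj x u)
      = chart_deriv bc id_chart (\<lambda>h. H (h, u)) (one K) x + chart_deriv id_chart id_chart (\<lambda>v. H (one K, v)) u (- adj x u)"
    by (rule chart_deriv_prod[OF atlas smooth_atlas_id smooth_atlas_id H base_chart _ _ one_in_base]) auto
  also have "chart_deriv bc id_chart (\<lambda>h. H (h, u)) (one K) x = hor a p x"
    by (simp add: hor_eq[OF a] p H_def)
  also have "chart_deriv id_chart id_chart (\<lambda>v. H (one K, v)) u (- adj x u) = vert a p (- adj x u)"
    by (simp add: vert_apply[OF a] p H_def chart_deriv_def)
  finally show ?thesis
    by (simp add: p blinfun.diff_right blinfun.minus_right)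
qed

end

section \<open>The Poisson bracket on the tangent bundle\<close>

context Poisson_Lie_group
begin

interpretation FT: function_algebra "Cinf TK"
  by (rule tangent_function_algebra)

abbreviation "P a b \<equiv> tangent_bracket K D a b"

text \<open>The dressing field lifted to the tangent bundle with the fibre coordinate held
  fixed.\<close>

definition Th :: "('e \<Rightarrow>\<^sub>L real) \<Rightarrow> ('g \<times> 'e \<Rightarrow> real) \<Rightarrow> 'g \<times> 'e \<Rightarrow> real" where
  "Th \<phi> b p = T \<phi> (\<lambda>g. b (g, snd p)) (fst p)"

lemma Th_eq: "Th \<phi> b p = D (fst p) \<phi> (hor b p)"
  by (simp add: Th_def T_eq hor_def)

lemma P_eq: "P a b p = lb (vert a p) (vert b p) (snd p) + Th (vert a p) b p - Th (vert b p) a p"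
  by (simp add: tangent_bracket_def vert_def Th_def split_beta)

lemma P_antisym: "P a b p = - P b a p"
  unfolding P_eq by (subst lb_antisym) (simp add: blinfun.minus_left)

lemma Th_linear: "Th (\<phi> + \<psi>) b p = Th \<phi> b p + Th \<psi> b p" "Th (\<phi> - \<psi>) b p = Th \<phi> b p - Th \<psi> b p"
  "Th (r *\<^sub>R \<phi>) b p = r * Th \<phi> b p" "Th (- \<phi>) b p = - Th \<phi> b p"
  by (simp_all add: Th_eq D_simps)

lemma linear_Th: "linear (\<lambda>\<phi>. Th \<phi> b p)"
  by (rule linearI) (simp_all add: Th_linear)

lemma Th_Cinf:
  assumes "b \<in> Cinf TK"
  shows "(\<lambda>p. Th \<phi> b p) \<in> Cinf TK"
  unfolding Th_eq
  by (rule FT.linear_field_closed[OF _ base_fun_Cinf[OF D_Cinf] hor_field[OF assms]])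
    (use D_bilinear in \<open>auto simp: bilinear_def\<close>)

lemmas Th_field_Cinf = FT.linear_field_closed[OF linear_Th Th_Cinf]
lemmas deriv_Th = FT.point_derivation_linear_field[OF _ linear_Th Th_Cinf]

lemma fibre_linear_Cinf: "(\<lambda>p. blinfun_apply \<omega> (snd p)) \<in> Cinf TK"
  by (rule fibre_fun_Cinf) (rule smooth_on_bounded_linear[OF blinfun.bounded_linear_right])

lemma linear_fibre_apply: "linear (\<lambda>\<omega>. blinfun_apply \<omega> (snd p))"
  by (rule linearI) (simp_all add: blinfun.add_left blinfun.scaleR_left)

lemmas field_fibre_Cinf = FT.linear_field_closed[OF linear_fibre_apply fibre_linear_Cinf]
lemmas deriv_field_fibre = FT.point_derivation_linear_field[OF _ linear_fibre_apply fibre_linear_Cinf]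

lemma P_Cinf:
  assumes "a \<in> Cinf TK" "b \<in> Cinf TK"
  shows "P a b \<in> Cinf TK"
proof -
  have "(\<lambda>p. lb (vert a p) (vert b p) (snd p) + Th (vert a p) b p - Th (vert b p) a p) \<in> Cinf TK"
    by (intro FT.add_closed FT.diff_closed field_fibre_Cinf FT.covector_fields_bilinear[OF lb_bilinear] Th_field_Cinf vert_field assms)
  then show ?thesis
    by (simp flip: P_eq)
qed

lemma point_derivation_Th: "FT.point_derivation p (\<lambda>b. Th \<phi> b p)"
  by (simp add: FT.point_derivation_def Th_eq hor_const hor_add hor_mult D_simps)

text \<open>One product rule for three derivations: vertical, horizontal and along lifted dressing
  fields. They differ only in their action on the fibre coordinate and on \<open>Th\<close> with
  frozen covectors.\<close>

lemma deriv_P: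
  assumes \<delta>: "FT.point_derivation p \<delta>" and a: "a \<in> Cinf TK" and b: "b \<in> Cinf TK"
  shows "\<delta> (P a b) = lb (FT.covector_deriv \<delta> (vert a)) (vert b p) (snd p)
    + lb (vert a p) (FT.covector_deriv \<delta> (vert b)) (snd p)
    + \<delta> (\<lambda>q. lb (vert a p) (vert b p) (snd q))
    + Th (FT.covector_deriv \<delta> (vert a)) b p + \<delta> (\<lambda>q. Th (vert a p) b q)
    - Th (FT.covector_deriv \<delta> (vert b)) a p - \<delta> (\<lambda>q. Th (vert b p) a q)"
proof -
  note va = vert_field[OF a] and vb = vert_field[OF b]
  have f: "(\<lambda>q. lb (vert a q) (vert b q)) \<in> FT.covector_fields"
    by (rule FT.covector_fields_bilinear[OF lb_bilinear va vb])
  have "\<delta> (P a b) = \<delta> (\<lambda>p. lb (vert a p) (vert b p) (snd p) + Th (vert a p) b p - Th (vert b p) a p)"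
    by (simp flip: P_eq)
  also have "\<dots> = \<delta> (\<lambda>p. lb (vert a p) (vert b p) (snd p)) + \<delta> (\<lambda>p. Th (vert a p) b p) - \<delta> (\<lambda>p. Th (vert b p) a p)"
    by (simp add: FT.point_derivationD[OF \<delta>] FT.add_closed field_fibre_Cinf[OF f] Th_field_Cinf va vb a b)
  finally show ?thesis
    unfolding deriv_Th[OF \<delta> b va] deriv_Th[OF \<delta> a vb] deriv_field_fibre[OF \<delta> f] FT.covector_deriv_bilinear[OF \<delta> lb_bilinear va vb]
    by (simp add: blinfun.add_left)
qed

section \<open>How vertical, horizontal and dressing derivatives commute\<close>

lemma vert_cong: "(\<And>y. f (fst p, y) = h (fst p, y)) \<Longrightarrow> vert f p = vert h p"
  by (simp add: vert_def fibre_diff_def)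

lemma vert_fibre_linear: "vert (\<lambda>q. blinfun_apply \<omega> (snd q)) p = \<omega>"
  by (simp add: vert_def)

lemma hor_fibre_linear: "hor (\<lambda>q. blinfun_apply \<omega> (snd q)) p = 0"
  by (simp add: hor_def)

lemma Th_fibre_linear: "Th \<phi> (\<lambda>q. blinfun_apply \<omega> (snd q)) p = 0"
  by (simp add: Th_eq hor_fibre_linear D_simps)

text \<open>The bivector depends on the base point alone, so a vertical derivative passes through it
  and, by \<open>vert_hor\<close>, reaches \<open>b\<close>.\<close>

lemma vert_Th:
  assumes b: "b \<in> Cinf TK"
  shows "vert (\<lambda>p. Th \<phi> b p) p y = Th \<phi> (\<lambda>p. vert b p y) p"
proof -
  let ?\<delta> = "\<lambda>a. vert a p y"
  have c: "FT.covector_deriv ?\<delta> (hor b) = hor (\<lambda>p. vert b p y) p"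
    by (rule blinfun_eqI) (simp add: FT.covector_deriv_apply[OF point_derivation_vert hor_field[OF b]] vert_hor[OF b])
  have z: "FT.covector_deriv ?\<delta> (\<lambda>_. \<phi>) = 0"
    by (simp add: FT.covector_deriv_def vert_const)
  have "?\<delta> (\<lambda>p. Th \<phi> b p) = ?\<delta> (\<lambda>q. D (fst p) \<phi> (hor b q))"
    using vert_cong[of "\<lambda>p. Th \<phi> b p" p "\<lambda>q. D (fst p) \<phi> (hor b q)"] by (simp add: Th_eq)
  also have "\<dots> = Th \<phi> (\<lambda>p. vert b p y) p"
    unfolding FT.point_derivation_bilinear[OF point_derivation_vert D_bilinear FT.covector_fields_const hor_field[OF b]] c z
    by (simp add: Th_eq D_simps)
  finally show ?thesis .
qed

lemma hor_Th:
  assumes b: "b \<in> Cinf TK"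
  shows "hor (\<lambda>p. Th \<phi> b p) p x
    = Th \<phi> (\<lambda>p. hor b p x) p - Th (coad x \<phi>) b p + lb \<phi> (hor b p) x"
  using L_T[OF slice_base[OF b], of x \<phi> "snd p" "fst p"] by (simp add: Th_def hor_def left_diff_L_apply)

lemma Th_Th:
  assumes b: "b \<in> Cinf TK"
  shows "Th \<phi> (\<lambda>p. Th \<psi> b p) p - Th \<psi> (\<lambda>p. Th \<phi> b p) p = Th (lb \<phi> \<psi>) b p"
  using T_commutator[OF slice_base[OF b], of \<phi> \<psi> "snd p" "fst p"] by (simp add: Th_def)

text \<open>Each of the three derivations commutes with vertical differentiation; thus a derived
  vertical differential is again the vertical differential of a function and fits into
  \<open>P\<close>.\<close>

lemma covector_deriv_vert:
  assumes b: "b \<in> Cinf TK"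
  shows "FT.covector_deriv (\<lambda>a. vert a p y) (vert b) = vert (\<lambda>p. vert b p y) p"
    and "FT.covector_deriv (\<lambda>a. hor a p x) (vert b) = vert (\<lambda>p. hor b p x) p"
    and "FT.covector_deriv (\<lambda>a. Th \<phi> a p) (vert b) = vert (\<lambda>p. Th \<phi> b p) p"
  by (rule blinfun_eqI, simp add: FT.covector_deriv_apply[OF point_derivation_vert vert_field[OF b]] vert_vert[OF b, of y])
    (rule blinfun_eqI, simp add: FT.covector_deriv_apply[OF point_derivation_hor vert_field[OF b]] vert_hor[OF b],
     rule blinfun_eqI, simp add: FT.covector_deriv_apply[OF point_derivation_Th vert_field[OF b]] vert_Th[OF b])

text \<open>The bracket depends explicitly on the fibre coordinate only through its summand with
  \<open>lb\<close>, where it is linear. This is the sole obstruction to a constant vertical field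
  being a derivation of the bracket.\<close>

lemma vert_P:
  assumes a: "a \<in> Cinf TK" and b: "b \<in> Cinf TK"
  shows "vert (P a b) p y = P (\<lambda>p. vert a p y) b p + P a (\<lambda>p. vert b p y) p
    + lb (vert a p) (vert b p) y"
  using deriv_P[OF point_derivation_vert[of p y] a b]
  unfolding covector_deriv_vert[OF a] covector_deriv_vert[OF b] vert_fibre_linear vert_Th[OF a] vert_Th[OF b]
    P_eq[of "\<lambda>p. vert a p y"] P_eq[of a "\<lambda>p. vert b p y"]
  by simp

text \<open>Here the defect comes from the dressing fields not commuting. The product rule produces
  them in the wrong order in two places, and \<open>Th_Th\<close> restores the order.\<close>

lemma Th_P:
  assumes a: "a \<in> Cinf TK" and b: "b \<in> Cinf TK"
  shows "Th \<phi> (P a b) p = P (\<lambda>p. Th \<phi> a p) b p + P a (\<lambda>p. Th \<phi> b p) p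
    + Th (lb \<phi> (vert a p)) b p - Th (lb \<phi> (vert b p)) a p"
  using deriv_P[OF point_derivation_Th[of p \<phi>] a b]
  unfolding covector_deriv_vert[OF a] covector_deriv_vert[OF b] Th_fibre_linear
    P_eq[of "\<lambda>p. Th \<phi> a p"] P_eq[of a "\<lambda>p. Th \<phi> b p"] Th_Th[OF a, symmetric] Th_Th[OF b, symmetric]
  by simp

text \<open>The defect consists of the last two terms of \<open>hor_Th\<close>, once for each
  dressing field in the bracket.\<close>

lemma hor_P:
  assumes a: "a \<in> Cinf TK" and b: "b \<in> Cinf TK"
  shows "hor (P a b) p x = P (\<lambda>p. hor a p x) b p + P a (\<lambda>p. hor b p x) p
    + (lb (vert a p) (hor b p) x - Th (coad x (vert a p)) b p)
    - (lb (vert b p) (hor a p) x - Th (coad x (vert b p)) a p)"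
  using deriv_P[OF point_derivation_hor[of p x] a b]
  unfolding covector_deriv_vert[OF a] covector_deriv_vert[OF b] hor_fibre_linear hor_Th[OF a] hor_Th[OF b]
    P_eq[of "\<lambda>p. hor a p x"] P_eq[of a "\<lambda>p. hor b p x"]
  by simp

subsection \<open>Jacobi identity\<close>

text \<open>\<open>Sv c p\<close> represents the part of the Hamiltonian vector field of \<open>c\<close> that only involves
  the vertical differential of the other argument.\<close>

definition Sv :: "('g \<times> 'e \<Rightarrow> real) \<Rightarrow> 'g \<times> 'e \<Rightarrow> 'e" where
  "Sv c p = (\<Sum>b\<in>Basis. (lb (blinfun_inner_left b) (vert c p) (snd p) + Th (blinfun_inner_left b) c p) *\<^sub>R b)"

lemma Sv_apply: "blinfun_apply \<phi> (Sv c p) = lb \<phi> (vert c p) (snd p) + Th \<phi> c p"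
proof -
  have "linear (\<lambda>\<phi>. lb \<phi> (vert c p) (snd p) + Th \<phi> c p)"
    by (rule linearI) (simp_all add: lb_simps Th_linear blinfun.add_left blinfun.scaleR_left algebra_simps)
  then have "lb \<phi> (vert c p) (snd p) + Th \<phi> c p
      = (\<Sum>b\<in>Basis. blinfun_apply \<phi> b * (lb (blinfun_inner_left b) (vert c p) (snd p) + Th (blinfun_inner_left b) c p))"
    using linear_blinfun_expansion by force
  then show ?thesis
    by (simp add: Sv_def blinfun.sum_right blinfun.scaleR_right mult.commute)
qed

lemma P_Sv: "P a c p = vert a p (Sv c p) - Th (vert c p) a p"
  by (simp add: P_eq Sv_apply)

text \<open>\<open>P_Sv\<close> splits the outer Hamiltonian field of \<open>a\<close> into a
  vertical field along \<open>Sv a p\<close> and a dressing field, both with coefficients frozen at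
  \<open>p\<close>. \<open>vert_P\<close> and \<open>Th_P\<close> then expand the inner bracket into
  terms whose cyclic sums cancel by inspection.\<close>

lemma P_P:
  assumes a: "a \<in> Cinf TK" and b: "b \<in> Cinf TK" and c: "c \<in> Cinf TK"
  shows "P a (P b c) p =
      vert (\<lambda>q. blinfun_apply (vert c q) (Sv a p)) p (Sv b p)
    - vert (\<lambda>q. blinfun_apply (vert b q) (Sv a p)) p (Sv c p)
    + vert (Th (vert c p) b) p (Sv a p) - vert (Th (vert b p) c) p (Sv a p)
    + vert (Th (vert a p) b) p (Sv c p) - vert (Th (vert a p) c) p (Sv b p)
    + Th (vert b p) (Th (vert a p) c) p - Th (vert c p) (Th (vert a p) b) p
    + Th (lb (vert a p) (vert b p)) c p - Th (lb (vert a p) (vert c p)) b p - Th (lb (vert b p) (vert c p)) a p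
    + lb (vert a p) (lb (vert b p) (vert c p)) (snd p)"
proof -
  have "P a (P b c) p = - P (P b c) a p"
    by (rule P_antisym)
  also have "\<dots> = Th (vert a p) (P b c) p - vert (P b c) p (Sv a p)"
    by (simp add: P_Sv)
  also have "vert (P b c) p (Sv a p)
      = P (\<lambda>q. vert b q (Sv a p)) c p - P (\<lambda>q. vert c q (Sv a p)) b p
      + lb (vert b p) (vert c p) (Sv a p)"
    using vert_P[OF b c] P_antisym[of b] by simp
  also have "Th (vert a p) (P b c) p = P (Th (vert a p) b) c p - P (Th (vert a p) c) b p
      + Th (lb (vert a p) (vert b p)) c p - Th (lb (vert a p) (vert c p)) b p"
    using Th_P[OF b c] P_antisym[of b] by simp
  finally show ?thesis
    using lb_antisym[of "lb (vert b p) (vert c p)" "vert a p"]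
    unfolding P_Sv[of "Th _ _" _ p] P_Sv[of "\<lambda>q. vert b q (Sv a p)" c p]
      P_Sv[of "\<lambda>q. vert c q (Sv a p)" b p]
    by (simp add: vert_Th a b c Sv_apply[of "lb (vert b p) (vert c p)"] blinfun.minus_left)
qed

lemma P_jacobi:
  assumes lie: "lie_bracket lb" and a: "a \<in> Cinf TK" and b: "b \<in> Cinf TK" and c: "c \<in> Cinf TK"
  shows "P a (P b c) p + P b (P c a) p + P c (P a b) p = 0"
proof -
  let ?a = "vert a p" and ?b = "vert b p" and ?c = "vert c p"
  have "lb ?a (lb ?b ?c) + lb ?b (lb ?c ?a) + lb ?c (lb ?a ?b) = 0"
    using lie unfolding lie_bracket_def by blast
  then have j: "lb ?a (lb ?b ?c) (snd p) + lb ?b (lb ?c ?a) (snd p)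
      + lb ?c (lb ?a ?b) (snd p) = 0"
    by (metis blinfun.add_left zero_blinfun.rep_eq)
  have s: "Th (lb \<psi> \<phi>) k p = - Th (lb \<phi> \<psi>) k p" for \<phi> \<psi> k
    by (subst lb_antisym) (simp add: Th_linear)
  show ?thesis
    \<comment> \<open>The second vertical derivatives cancel by symmetry and the mixed terms with
      \<open>vert\<close> and \<open>Th\<close> by cyclicity. Commutators of dressing fields cancel
      the remaining terms with \<open>Th\<close>, and \<open>j\<close> is the Jacobi identity of
      \<open>lb\<close> evaluated at the fibre point.\<close>
    using j vert_vert[OF a, of "Sv b p" p "Sv c p"] vert_vert[OF b, of "Sv c p" p "Sv a p"] vert_vert[OF c, of "Sv a p" p "Sv b p"]
      Th_Th[OF a, of ?b ?c p] Th_Th[OF b, of ?c ?a p] Th_Th[OF c, of ?a ?b p]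
      s[of ?b ?a c] s[of ?c ?b a] s[of ?a ?c b]
    unfolding P_P[OF a b c] P_P[OF b c a] P_P[OF c a b]
    by linarith
qed

lemma tangent_poisson_bracket:
  assumes lie: "lie_bracket lb"
  shows "poisson_bracket TK (tangent_bracket K D)"
  unfolding poisson_bracket_def
proof (intro conjI ballI allI)
  fix f h k :: "'g \<times> 'e \<Rightarrow> real"
  assume f: "f \<in> Cinf TK" and h: "h \<in> Cinf TK"
  show "P f h \<in> Cinf TK"
    by (rule P_Cinf[OF f h])
  show "P f h = (\<lambda>g. - P h f g)"
    using P_antisym by blast
  assume k: "k \<in> Cinf TK"
  show "P (\<lambda>g. r * f g + h g) k = (\<lambda>g. r * P f k g + P h k g)" for r
  proof
    fix p
    have "vert (\<lambda>g. r * f g + h g) p = r *\<^sub>R vert f p + vert h p" "hor (\<lambda>g. r * f g + h g) p = r *\<^sub>R hor f p + hor h p"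
      using f h by (simp_all add: vert_add hor_add vert_mult hor_mult FT.mult_closed FT.const_closed vert_const hor_const)
    then show "P (\<lambda>g. r * f g + h g) k p = r * P f k p + P h k p"
      by (simp add: P_eq Th_eq lb_simps D_simps blinfun.add_left blinfun.scaleR_left algebra_simps)
  qed
  show "P f (\<lambda>g. h g * k g) = (\<lambda>g. P f h g * k g + h g * P f k g)"
    by (simp add: fun_eq_iff P_eq Th_eq vert_mult[OF h k] hor_mult[OF h k] lb_simps D_simps blinfun.add_left blinfun.scaleR_left algebra_simps)
  show "P f (P h k) p + P h (P k f) p + P k (P f h) p = 0" for p
    by (rule P_jacobi[OF lie f h k])
qed

end

subsection \<open>Infinitesimal multiplicativity\<close>

text \<open>The dual of a product as the product of the duals. A left-covariant preconnection on the
  tangent group takes its product on the former space, while the semidirect sum lives on the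
  latter.\<close>

definition blinfun_split :: "(('e::euclidean_space \<times> 'f::euclidean_space) \<Rightarrow>\<^sub>L real) \<Rightarrow> ('e \<Rightarrow>\<^sub>L real) \<times> ('f \<Rightarrow>\<^sub>L real)" where
  "blinfun_split \<zeta> = (Blinfun (\<lambda>x. blinfun_apply \<zeta> (x, 0)), Blinfun (\<lambda>y. blinfun_apply \<zeta> (0, y)))"

definition blinfun_join :: "('e::euclidean_space \<Rightarrow>\<^sub>L real) \<times> ('f::euclidean_space \<Rightarrow>\<^sub>L real) \<Rightarrow> (('e \<times> 'f) \<Rightarrow>\<^sub>L real)" where
  "blinfun_join p = Blinfun (\<lambda>z. blinfun_apply (fst p) (fst z) + blinfun_apply (snd p) (snd z))"

lemma blinfun_split_apply [simp]:
  "blinfun_apply (fst (blinfun_split \<zeta>)) x = blinfun_apply \<zeta> (x, 0)"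
  "blinfun_apply (snd (blinfun_split \<zeta>)) y = blinfun_apply \<zeta> (0, y)"
  unfolding blinfun_split_def fst_conv snd_conv
  by (subst bounded_linear_Blinfun_apply;
      auto intro!: bounded_linear_compose[OF blinfun.bounded_linear_right] bounded_linear_Pair bounded_linear_ident bounded_linear_zero)+

lemma blinfun_join_apply [simp]:
  "blinfun_apply (blinfun_join p) z = blinfun_apply (fst p) (fst z) + blinfun_apply (snd p) (snd z)"
  unfolding blinfun_join_def
  by (subst bounded_linear_Blinfun_apply)
    (auto intro!: bounded_linear_add bounded_linear_compose[OF blinfun.bounded_linear_right] bounded_linear_fst bounded_linear_snd)

lemma blinfun_split_join [simp]: "blinfun_split (blinfun_join p) = p"
  by (intro prod_eqI blinfun_eqI) simp_all

lemma blinfun_join_split [simp]: "blinfun_join (blinfun_split \<zeta>) = \<zeta>"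
  by (rule blinfun_eqI) (simp flip: blinfun.add_right)

lemma linear_blinfun_split: "linear blinfun_split"
  by (rule linearI; rule prod_eqI; rule blinfun_eqI) (simp_all add: blinfun.add_left blinfun.scaleR_left)

lemma linear_blinfun_join: "linear blinfun_join"
  by (rule linearI) (auto intro!: blinfun_eqI simp: blinfun.add_left blinfun.scaleR_left algebra_simps)

lemma pre_lie_structure_transport:
  assumes i: "linear i" and j: "linear j" and ji: "\<And>x. j (i x) = x" and ij: "\<And>y. i (j y) = y"
    and pl: "pre_lie_structure lb pl"
  shows "pre_lie_structure (\<lambda>x y. j (lb (i x) (i y))) (\<lambda>x y. j (pl (i x) (i y)))"
proof -
  have bil: "bilinear (\<lambda>x y. j (M (i x) (i y)))" if "bilinear M" for M
    unfolding bilinear_def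
  proof (intro conjI allI)
    show "linear (\<lambda>y. j (M (i x) (i y)))" for x
      using linear_compose[OF linear_compose[OF i, of "M (i x)"] j] that by (simp add: bilinear_def o_def)
    show "linear (\<lambda>x. j (M (i x) (i y)))" for y
      using linear_compose[OF linear_compose[OF i, of "\<lambda>x. M x (i y)"] j] that by (simp add: bilinear_def o_def)
  qed
  show ?thesis
    using pl unfolding pre_lie_structure_def lie_bracket_def
    by (auto simp: bil ij linear_0[OF j] simp flip: linear_add[OF j] linear_diff[OF j])
qed

context Poisson_Lie_group
begin

interpretation FT: function_algebra "Cinf TK"
  by (rule tangent_function_algebra)

lemma covector_deriv_coad:
  assumes "FT.point_derivation p \<delta>" "s \<in> FT.covector_fields"
  shows "FT.covector_deriv \<delta> (\<lambda>q. coad x (s q)) = coad x (FT.covector_deriv \<delta> s)"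
proof -
  have "(\<lambda>q. coad x (s q)) \<in> FT.covector_fields"
    using assms(2) by (simp add: FT.covector_fields_def)
  then show ?thesis
    by (intro blinfun_eqI) (simp add: FT.covector_deriv_apply[OF assms(1)] assms(2))
qed

text \<open>\<open>W\<close> is the correction in a left-invariant derivative. Its direction
  \<open>adj x (snd q)\<close> moves with the fibre coordinate, which adds a coadjoint term to the
  vertical differential and nothing to the horizontal one.\<close>

lemma coad_fibre:
  fixes x :: 'e
  assumes a: "a \<in> Cinf TK"
  defines "W \<equiv> \<lambda>q. vert a q (adj x (snd q))"
  shows "W \<in> Cinf TK"
    and "vert W p = vert (\<lambda>q. vert a q (adj x (snd p))) p + coad x (vert a p)"
    and "hor W p = hor (\<lambda>q. vert a q (adj x (snd p))) p"
proof -
  have W: "W = (\<lambda>q. coad x (vert a q) (snd q))"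
    by (simp add: W_def)
  have f: "(\<lambda>q. coad x (vert a q)) \<in> FT.covector_fields"
    using vert_field[OF a] by (simp add: FT.covector_fields_def)
  show "W \<in> Cinf TK"
    unfolding W by (rule field_fibre_Cinf[OF f])
  show "vert W p = vert (\<lambda>q. vert a q (adj x (snd p))) p + coad x (vert a p)"
  proof (rule blinfun_eqI)
    fix z
    show "vert W p z = blinfun_apply (vert (\<lambda>q. blinfun_apply (vert a q) (adj x (snd p))) p + coad x (vert a p)) z"
      unfolding W deriv_field_fibre[OF point_derivation_vert f] covector_deriv_coad[OF point_derivation_vert vert_field[OF a]]
        covector_deriv_vert[OF a] vert_fibre_linear
      using vert_vert[OF a, of z p "adj x (snd p)"] by (simp add: blinfun.add_left)
  qed
  show "hor W p = hor (\<lambda>q. vert a q (adj x (snd p))) p"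
  proof (rule blinfun_eqI)
    fix z
    show "hor W p z = hor (\<lambda>q. blinfun_apply (vert a q) (adj x (snd p))) p z"
      unfolding W deriv_field_fibre[OF point_derivation_hor f] covector_deriv_coad[OF point_derivation_hor vert_field[OF a]]
        covector_deriv_vert[OF a] hor_fibre_linear
      using vert_hor[OF a, of z p "adj x (snd p)"] by simp
  qed
qed

lemma tangent_left_field: "a \<in> Cinf TK \<Longrightarrow> left_field TK (x, y) a p
    = hor a p x + vert a p y - vert a p (adj x (snd p))"
  by (simp add: left_field_def tangent_left_diff blinfun.diff_right)

text \<open>Antisymmetry rewrites the fibre velocity \<open>- adj x (snd p)\<close> as
  \<open>adj (snd p) x\<close>, so the correction is the coadjoint action of the fibre
  point.\<close>

lemma split_tangent_left_diff:
  assumes "a \<in> Cinf TK"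
  shows "blinfun_split (left_diff TK a p) = (hor a p + coad (snd p) (vert a p), vert a p)"
proof (intro prod_eqI blinfun_eqI)
  fix x
  have "vert a p (- adj x (snd p)) = vert a p (adj (snd p) x)"
    by (simp flip: adj_antisym)
  then show "blinfun_apply (fst (blinfun_split (left_diff TK a p))) x
      = blinfun_apply (fst (hor a p + coad (snd p) (vert a p), vert a p)) x"
    by (simp add: tangent_left_diff[OF assms] blinfun.add_left)
next
  fix y
  show "blinfun_apply (snd (blinfun_split (left_diff TK a p))) y
      = blinfun_apply (snd (hor a p + coad (snd p) (vert a p), vert a p)) y"
    using linear_0[OF linear_adj(1)] by (simp add: tangent_left_diff[OF assms] blinfun.zero_right)
qed

text \<open>The right-hand side freezes the fibre point in the correction, as the application of
  \<open>vert_P\<close> at a fixed direction requires. The last two terms pay for this, by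
  \<open>coad_fibre\<close>.\<close>

lemma P_field_left:
  assumes a: "a \<in> Cinf TK"
  shows "P (\<lambda>q. left_field TK (x, y) a q) b p = P (\<lambda>q. hor a q x) b p + P (\<lambda>q. vert a q y) b p
    - P (\<lambda>q. vert a q (adj x (snd p))) b p
    - lb (coad x (vert a p)) (vert b p) (snd p) - Th (coad x (vert a p)) b p"
proof -
  let ?h = "\<lambda>q. hor a q x" and ?v = "\<lambda>q. vert a q y"
    and ?W = "\<lambda>q. vert a q (adj x (snd q))"
  note W = coad_fibre[OF a, of x]
  have c: "?h \<in> Cinf TK" "?v \<in> Cinf TK" "(\<lambda>q. - ?W q) \<in> Cinf TK" "(\<lambda>q. ?h q + ?v q) \<in> Cinf TK"
    by (intro hor_Cinf vert_Cinf a W FT.minus_closed FT.add_closed)+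
  have m: "vert (\<lambda>q. - ?W q) p = - vert ?W p" "hor (\<lambda>q. - ?W q) p = - hor ?W p"
    using vert_mult[OF FT.const_closed W(1), of "-1" p] hor_mult[OF FT.const_closed W(1), of "-1" p]
    by (simp_all add: vert_const hor_const)
  have e: "(\<lambda>q. left_field TK (x, y) a q) = (\<lambda>q. (?h q + ?v q) + - ?W q)"
    by (simp add: tangent_left_field[OF a])
  show ?thesis
    unfolding e P_eq Th_eq vert_add[OF c(4,3)] hor_add[OF c(4,3)] vert_add[OF c(1,2)] hor_add[OF c(1,2)] m W(2,3)
    by (simp add: lb_simps D_simps blinfun.add_left blinfun.minus_left blinfun.diff_left)
qed

text \<open>The terms \<open>Th (coad x _)\<close> from \<open>hor_P\<close> agree with those from
  \<open>P_field_left\<close>, and the mixed terms with \<open>lb\<close> and \<open>hor\<close>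
  belong to the semidirect bracket. What is left is linear in the fibre point and is exactly
  \<open>lb_cocycle\<close> for \<open>x\<close> and \<open>snd p\<close>.\<close>

lemma tangent_L_P:
  assumes a: "a \<in> Cinf TK" and b: "b \<in> Cinf TK"
  shows "left_field TK X (P a b) p = P (\<lambda>q. left_field TK X a q) b p + P a (\<lambda>q. left_field TK X b q) p
    + blinfun_apply (blinfun_join (semidirect_bracket lb (blinfun_split (left_diff TK a p)) (blinfun_split (left_diff TK b p)))) X"
proof -
  obtain x y where X: "X = (x, y)"
    by (cases X)
  let ?u = "snd p" and ?a = "vert a p" and ?b = "vert b p"
  have "left_field TK X (P a b) p = hor (P a b) p x + vert (P a b) p y
      - vert (P a b) p (adj x ?u)"
    by (simp add: X tangent_left_field P_Cinf a b)
  moreover have "P a (\<lambda>q. left_field TK X b q) p = P a (\<lambda>q. hor b q x) p + P a (\<lambda>q. vert b q y) p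
    - P a (\<lambda>q. vert b q (adj x ?u)) p
    + lb (coad x ?b) ?a ?u + Th (coad x ?b) a p"
    using P_field_left[OF b, of x y a p] P_antisym[of a] by (simp add: X)
  moreover have "blinfun_apply (blinfun_join (semidirect_bracket lb (blinfun_split (left_diff TK a p)) (blinfun_split (left_diff TK b p)))) X
      = lb ?a (hor b p) x + lb ?a (coad ?u ?b) x
        - lb ?b (hor a p) x - lb ?b (coad ?u ?a) x + lb ?a ?b y"
    by (simp add: X split_tangent_left_diff a b semidirect_bracket_def lb_simps blinfun.add_left blinfun.diff_left)
  moreover have "lb ?b (coad ?u ?a) x = - lb (coad ?u ?a) ?b x"
    "lb (coad x ?b) ?a ?u = - lb ?a (coad x ?b) ?u"
    by (subst lb_antisym, simp add: blinfun.minus_left)+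
  ultimately show ?thesis
    using lb_cocycle[of ?a ?b x ?u] P_field_left[OF a, of x y b p]
    by (simp add: X hor_P[OF a b] vert_P[OF a b])
qed

theorem tangent_preconnection:
  assumes "pre_lie_structure (semidirect_bracket lb) pl" "lie_bracket lb"
  shows "\<exists>\<gamma> :: ('g \<times> 'e, 'e \<times> 'e) preconn.
    preconnection TK (tangent_bracket K D) \<gamma> \<and> poisson_compatible TK (tangent_bracket K D) \<gamma> \<and>
    left_covariant TK (tangent_bracket K D) \<gamma> \<and> flat_preconnection TK (tangent_bracket K D) \<gamma>"
proof -
  have "Poisson_group TK (tangent_bracket K D)"
    using Lie_group_tangent tangent_poisson_bracket[OF assms(2)]
    by (simp add: Poisson_group_def Poisson_group_axioms_def)
  from Poisson_group.left_covariant_flat_preconnection[OF this tangent_L_P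
      pre_lie_structure_transport[OF linear_blinfun_split linear_blinfun_join blinfun_join_split blinfun_split_join assms(1)]]
  show ?thesis .
qed

end

section \<open>The semidirect sum\<close>

text \<open>In the commutator the product \<open>ast\<close> cancels by commutativity. In the first
  component of the pre-Lie identity the triple \<open>ast\<close> products cancel by commutativity
  and associativity, the Leibniz rule matches the mixed terms, and the rest says that
  \<open>lb\<close> is a representation. The second component is the pre-Lie identity of
  \<open>pl\<close>.\<close>

lemma semidirect_pre_lie:
  fixes lb pl ast :: "'v::real_vector \<Rightarrow> 'v \<Rightarrow> 'v"
  assumes pl: "pre_lie_structure lb pl" and ast: "poisson_algebra ast lb"
  shows "pre_lie_structure (semidirect_bracket lb) (\<lambda>(\<phi>, f) (\<psi>, h). (ast \<phi> \<psi> + lb f \<psi>, pl f h))"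
    (is "pre_lie_structure _ ?p")
proof -
  have bil: "bilinear lb" "bilinear pl" "bilinear ast"
    using pl ast by (auto simp: pre_lie_structure_def poisson_algebra_def lie_bracket_def)
  note [simp] = bil[THEN bilinear_ladd] bil[THEN bilinear_radd] bil[THEN bilinear_lmul] bil[THEN bilinear_rmul]
    bil[THEN bilinear_lsub] bil[THEN bilinear_rsub]
  have lb0: "lb x x = 0" and jac: "lb x (lb y z) + lb y (lb z x) + lb z (lb x y) = 0" for x y z
    using pl by (auto simp: pre_lie_structure_def lie_bracket_def)
  have anti: "lb x y = - lb y x" for x y
    using lb0[of "x + y"] lb0[of x] lb0[of y] by (simp add: eq_neg_iff_add_eq_0 add.commute)
  have jac': "lb (lb x y) z = lb x (lb y z) - lb y (lb x z)" for x y z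
  proof -
    have "lb (lb x y) z = - lb z (lb x y)" "lb y (lb z x) = - lb y (lb x z)"
      using anti[of "lb x y" z] anti[of z x] bilinear_rneg[OF bil(1)] by simp_all
    with jac[of x y z] show ?thesis
      by (simp add: algebra_simps)
  qed
  have plc: "pl x y - pl y x = lb x y" and pla: "pl (pl x y) z - pl (pl y x) z = pl x (pl y z) - pl y (pl x z)" for x y z
    using pl by (auto simp: pre_lie_structure_def)
  have astc: "ast x y = ast y x" and asta: "ast (ast x y) z = ast x (ast y z)"
    and leib: "lb f (ast x y) = ast (lb f x) y + ast x (lb f y)" for x y z f
    using ast unfolding poisson_algebra_def by blast+
  show ?thesis
    unfolding pre_lie_structure_def lie_bracket_def
  proof (intro conjI allI)
    show "bilinear (semidirect_bracket lb)" "bilinear ?p"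
      unfolding bilinear_def semidirect_bracket_def
      by (auto intro!: linearI simp: split_beta algebra_simps)
  next
    fix X Y Z :: "'v \<times> 'v"
    obtain x f where X: "X = (x, f)" by (cases X)
    obtain y g where Y: "Y = (y, g)" by (cases Y)
    obtain z h where Z: "Z = (z, h)" by (cases Z)
    show "semidirect_bracket lb X X = 0"
      by (simp add: X semidirect_bracket_def lb0 zero_prod_def)
    show "semidirect_bracket lb X (semidirect_bracket lb Y Z) + semidirect_bracket lb Y (semidirect_bracket lb Z X)
        + semidirect_bracket lb Z (semidirect_bracket lb X Y) = 0"
      using jac[of f g h] by (simp add: X Y Z semidirect_bracket_def zero_prod_def jac' algebra_simps)
    show "?p X Y - ?p Y X = semidirect_bracket lb X Y"
      by (simp add: X Y semidirect_bracket_def plc astc[of y x])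
    have "ast (ast x y + lb f y) z + lb (pl f g) z - (ast (ast y x + lb g x) z + lb (pl g f) z)
        = ast x (ast y z + lb g z) + lb f (ast y z + lb g z) - (ast y (ast x z + lb f z) + lb g (ast x z + lb f z))"
    proof -
      \<comment> \<open>Only the commutator of \<open>pl\<close> enters here, and it equals
        \<open>lb f g\<close>; the claim is therefore the Jacobi identity.\<close>
      have "lb (pl f g) z - lb (pl g f) z = lb f (lb g z) - lb g (lb f z)"
        using jac'[of f g z] bilinear_lsub[OF bil(1), of "pl f g" "pl g f" z] by (simp only: plc)
      moreover have "ast y (ast x z) = ast x (ast y z)" "ast (ast y x) z = ast x (ast y z)"
        by (metis asta astc)+
      ultimately show ?thesis
        by (simp add: leib asta algebra_simps)
    qed
    then show "?p (?p X Y) Z - ?p (?p Y X) Z = ?p X (?p Y Z) - ?p Y (?p X Z)"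
      by (simp add: X Y Z pla)
  qed
qed

theorem theorem5p6:
  fixes G :: "('g::{t2_space,second_countable_topology}, 'e::euclidean_space) lie_group_data"
    and br :: "'g bracket"
    and D :: "'g \<Rightarrow> 'e tensor2"
    and pl ast :: "('e \<Rightarrow>\<^sub>L real) \<Rightarrow> ('e \<Rightarrow>\<^sub>L real) \<Rightarrow> ('e \<Rightarrow>\<^sub>L real)"
  assumes "poisson_lie_group G br"
    and "left_bivector G br D"
    and "connected (UNIV :: 'g set)"
    and "simply_connected (UNIV :: 'g set)"
    and "pre_lie_structure (dual_bracket G D) pl"
    and "poisson_algebra ast (dual_bracket G D)"
  shows "pre_lie_structure (semidirect_bracket (dual_bracket G D))
           (\<lambda>(\<phi>, f) (\<psi>, h). (ast \<phi> \<psi> + dual_bracket G D f \<psi>, pl f h)) \<and>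
         (\<exists>\<gamma> :: ('g \<times> 'e, 'e \<times> 'e) preconn.
            preconnection (tangent_group G) (tangent_bracket G D) \<gamma> \<and>
            poisson_compatible (tangent_group G) (tangent_bracket G D) \<gamma> \<and>
            left_covariant (tangent_group G) (tangent_bracket G D) \<gamma> \<and>
            flat_preconnection (tangent_group G) (tangent_bracket G D) \<gamma>)"
proof -
  have "Poisson_Lie_group G br D"
    using assms(1,2)
    by (simp add: Poisson_Lie_group_def Poisson_Lie_group_axioms_def Poisson_group_def Poisson_group_axioms_def
        Lie_group_def poisson_lie_group_def)
  moreover have "pre_lie_structure (semidirect_bracket (dual_bracket G D))
      (\<lambda>(\<phi>, f) (\<psi>, h). (ast \<phi> \<psi> + dual_bracket G D f \<psi>, pl f h))"
    by (rule semidirect_pre_lie[OF assms(5,6)])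
  moreover have "lie_bracket (dual_bracket G D)"
    using assms(5) by (simp add: pre_lie_structure_def)
  ultimately show ?thesis
    using Poisson_Lie_group.tangent_preconnection by blast
qed

end
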